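(* Let the transmitters form a Neyman-Scott cluster process $\phi$ on $\mathbb{R}^2$ with parent intensity $\lambda_p$, a Poisson number of points per cluster with mean $\bar c$, and isotropic scattering density $f$; assume Rayleigh fading and no noise. Let $T>0$ and let the receiver be at $z$ with $\|z\|=R>0$. Let $\lambda=\lambda_p\bar c$ and $\hat\beta=\sup_{y\in\mathbb{R}^2}\beta(R,y)$. Then $$\mathbb{P}(\text{success})\ \le\ P_p\Big(\frac{\lambda}{1+\bar c\,\hat\beta}\Big),$$ where $P_p(x)$ denotes the success probability (same $R$, $T$, $g$, fading) when $\phi$ is a Poisson point process of intensity $x$.
   Context: Neyman-Scott cluster process: the parents form a stationary Poisson point process on $\mathbb{R}^2$ of intensity $\lambda_p>0$; to each parent $x$ is attached an independent cluster with a Poisson number (mean $\bar c>0$) of points located at $x$ plus i.i.d. displacements with isotropic probability density $f$; $\phi$ is the union of all clusters (parents not included). $\mathbb{P}(\text{success})=\mathbb{P}^{!0}\big(h\,g(z)/I_\phi(z)\ge T\big)$, where $I_\phi(z)=\sum_{x\in\phi}h_xg(x-z)$, $h$ and the $h_x$ are i.i.d. exponential random variables independent of $\phi$, and $\mathbb{P}^{!0}$ is the probability under the reduced Palm distribution of $\phi$ at the origin (conditioning on a point of $\phi$ at the origin and removing it). It depends on $z$ only through $R=\|z\|$. $\beta(R,y)=\int_{\mathbb{R}^2}\frac{g(x-y-z)}{g(R)/T+g(x-y-z)}f(x)\,dx$ with $z=(R,0)$; $g(R)$ is the value of $g$ at any point of norm $R$. For a Poisson point process of intensity $x$ the success probability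 is $P_p(x)=\exp\big(-x\int_{\mathbb{R}^2}\beta(R,y)\,dy\big)=\exp\big(-x\int_{\mathbb{R}^2}\frac{g(y)}{g(R)/T+g(y)}\,dy\big)$. The path-loss function $g:\mathbb{R}^2\setminus\{o\}\to\mathbb{R}^+$ is a continuous, positive, non-increasing function of $\|x\|$, with $\int_{\mathbb{R}^2\setminus B(o,\epsilon)}g(x)\,dx<\infty$ for all $\epsilon>0$, and $\lim_{\|x\|\to\infty}g(x)/g(x-y)=1$ for all $y\in\mathbb{R}^2$. *)

theory Defs
  imports "HOL-Probability.Probability"
begin

type_synonym plane = "real^2"

subsection \<open>Point processes\<close>

definition locally_finite :: "plane set \<Rightarrow> bool" where
  "locally_finite A \<longleftrightarrow> (\<forall>B. bounded B \<longrightarrow> finite (A \<inter> B))"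

text \<open>Configurations are sets because all processes below are simple; the sigma-algebra is
  generated by the counts on bounded Borel sets.\<close>

definition configs :: "plane set measure" where
  "configs = sigma (Collect locally_finite)
     {{A. locally_finite A \<and> card (A \<inter> B) = n} | B n. B \<in> sets borel \<and> bounded B}"

definition point_process :: "'a measure \<Rightarrow> ('a \<Rightarrow> plane set) \<Rightarrow> bool" where
  "point_process M \<Phi> \<longleftrightarrow> prob_space M \<and> \<Phi> \<in> measurable M configs"

definition poisson_process :: "'a measure \<Rightarrow> real \<Rightarrow> ('a \<Rightarrow> plane set) \<Rightarrow> bool" where
  "poisson_process M l \<Phi> \<longleftrightarrow> point_process M \<Phi> \<and>
     (\<forall>B n. B \<in> sets borel \<longrightarrow> bounded B \<longrightarrow>
        measure M {\<omega> \<in> space M. card (\<Phi> \<omega> \<inter> B) = n} =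
          exp (- (l * measure lborel B)) * (l * measure lborel B) ^ n / fact n) \<and>
     (\<forall>B :: nat \<Rightarrow> plane set. (\<forall>k. B k \<in> sets borel \<and> bounded (B k)) \<longrightarrow> disjoint_family B \<longrightarrow>
        prob_space.indep_vars M (\<lambda>_. count_space UNIV) (\<lambda>k \<omega>. card (\<Phi> \<omega> \<inter> B k)) UNIV)"

definition isotropic_density :: "(plane \<Rightarrow> real) \<Rightarrow> bool" where
  "isotropic_density f \<longleftrightarrow> f \<in> borel_measurable borel \<and> (\<forall>x. 0 \<le> f x) \<and>
     (\<integral>\<^sup>+x. ennreal (f x) \<partial>lborel) = 1 \<and> (\<forall>x y. norm x = norm y \<longrightarrow> f x = f y)"

text \<open>The parents \<open>Y\<close>, almost surely infinite in number, are enumerated without repetition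
  by \<open>X\<close>. The cluster of the parent \<open>X i\<close> consists of the \<open>N i\<close> points
  \<open>X i + D (i, j)\<close> with \<open>j < N i\<close>. The equation of laws says that the whole sequence \<open>X\<close>,
  all the \<open>N i\<close> and all the \<open>D (i, j)\<close> are independent, each \<open>N i\<close> being Poisson with mean \<open>c\<close>
  and each \<open>D (i, j)\<close> having density \<open>f\<close>.\<close>

definition neyman_scott_process ::
  "'a measure \<Rightarrow> real \<Rightarrow> real \<Rightarrow> (plane \<Rightarrow> real) \<Rightarrow> ('a \<Rightarrow> plane set) \<Rightarrow> bool" where
  "neyman_scott_process M lp c f \<Phi> \<longleftrightarrow> point_process M \<Phi> \<and>
     (\<exists>(Y :: 'a \<Rightarrow> plane set) (X :: nat \<Rightarrow> 'a \<Rightarrow> plane)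
        (N :: nat \<Rightarrow> 'a \<Rightarrow> nat) (D :: nat \<times> nat \<Rightarrow> 'a \<Rightarrow> plane).
        poisson_process M lp Y \<and>
        (\<forall>i. X i \<in> measurable M borel) \<and>
        (\<forall>i. N i \<in> measurable M (count_space UNIV)) \<and>
        (\<forall>k. D k \<in> measurable M borel) \<and>
        (AE \<omega> in M. bij_betw (\<lambda>i. X i \<omega>) UNIV (Y \<omega>)) \<and>
        distr M
          (Pi\<^sub>M UNIV (\<lambda>_. borel) \<Otimes>\<^sub>M (Pi\<^sub>M UNIV (\<lambda>_. count_space UNIV) \<Otimes>\<^sub>M Pi\<^sub>M UNIV (\<lambda>_. borel)))
          (\<lambda>\<omega>. (\<lambda>i. X i \<omega>, \<lambda>i. N i \<omega>, \<lambda>k. D k \<omega>)) =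
        distr M (Pi\<^sub>M UNIV (\<lambda>_. borel)) (\<lambda>\<omega> i. X i \<omega>) \<Otimes>\<^sub>M
          (Pi\<^sub>M UNIV (\<lambda>_. measure_pmf (poisson_pmf c)) \<Otimes>\<^sub>M
           Pi\<^sub>M UNIV (\<lambda>_. density lborel (\<lambda>x. ennreal (f x)))) \<and>
        (AE \<omega> in M. \<Phi> \<omega> = (\<Union>i. {X i \<omega> + D (i, j) \<omega> | j. j < N i \<omega>})))"

subsection \<open>Reduced Palm distribution at the origin\<close>

text \<open>The two definitions below are for stationary processes with positive finite intensity;
  stationarity makes the choice of the unit square as the sampling window immaterial.\<close>

definition intensity :: "'a measure \<Rightarrow> ('a \<Rightarrow> plane set) \<Rightarrow> ennreal" where
  "intensity M \<Phi> = (\<integral>\<^sup>+\<omega>. of_nat (card (\<Phi> \<omega> \<inter> cbox 0 One)) \<partial>M)"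

definition reduced_palm :: "'a measure \<Rightarrow> ('a \<Rightarrow> plane set) \<Rightarrow> plane set measure" where
  "reduced_palm M \<Phi> = measure_of (space configs) (sets configs)
     (\<lambda>E. (\<integral>\<^sup>+\<omega>. (\<Sum>x \<in> \<Phi> \<omega> \<inter> cbox 0 One. indicator E ((\<lambda>y. y - x) ` (\<Phi> \<omega> - {x}))) \<partial>M)
            / intensity M \<Phi>)"

subsection \<open>Path loss, fading and success probability\<close>

text \<open>The path loss is only meaningful away from the origin; its value at 0 is arbitrary.
  Monotonicity in the norm makes it radially symmetric.\<close>

definition path_loss :: "(plane \<Rightarrow> real) \<Rightarrow> bool" where
  "path_loss g \<longleftrightarrow>
     continuous_on (- {0}) g \<and> (\<forall>x. x \<noteq> 0 \<longrightarrow> 0 < g x) \<and>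
     (\<forall>x y. x \<noteq> 0 \<longrightarrow> y \<noteq> 0 \<longrightarrow> norm x \<le> norm y \<longrightarrow> g y \<le> g x) \<and>
     (\<forall>\<epsilon>>0. set_integrable lborel (- ball 0 \<epsilon>) g) \<and>
     (\<forall>y. ((\<lambda>x. g x / g (x - y)) \<longlongrightarrow> 1) at_infinity)"

text \<open>The coordinate \<open>None\<close> is the fading \<open>h\<close> of the desired link, \<open>Some x\<close> the fading
  \<open>h\<^sub>x\<close> of the interferer at \<open>x\<close>; \<open>\<mu>\<close> is the rate of the exponential law.\<close>

definition fading :: "real \<Rightarrow> (plane option \<Rightarrow> real) measure" where
  "fading \<mu> = Pi\<^sub>M UNIV (\<lambda>_. density lborel (\<lambda>t. ennreal (exponential_density \<mu> t)))"

definition interference ::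
  "(plane \<Rightarrow> real) \<Rightarrow> plane \<Rightarrow> (plane option \<Rightarrow> real) \<Rightarrow> plane set \<Rightarrow> ennreal" where
  "interference g z h A = (\<integral>\<^sup>+x. ennreal (h (Some x) * g (x - z)) \<partial>count_space A)"

text \<open>The signal-to-interference ratio is taken in \<^typ>\<open>ennreal\<close>: it is infinite without
  interference and 0 for infinite interference. The fading being independent of the
  configuration, its law is used unchanged after conditioning on the configuration.\<close>

definition success_given :: "real \<Rightarrow> (plane \<Rightarrow> real) \<Rightarrow> real \<Rightarrow> plane \<Rightarrow> plane set \<Rightarrow> ennreal" where
  "success_given \<mu> g T z A = emeasure (fading \<mu>)
     {h \<in> space (fading \<mu>). ennreal T \<le> ennreal (h None * g z) / interference g z h A}"

definition success_prob ::
  "real \<Rightarrow> (plane \<Rightarrow> real) \<Rightarrow> real \<Rightarrow> plane \<Rightarrow> 'a measure \<Rightarrow> ('a \<Rightarrow> plane set) \<Rightarrow> ennreal" where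
  "success_prob \<mu> g T z M \<Phi> = (\<integral>\<^sup>+A. success_given \<mu> g T z A \<partial>(reduced_palm M \<Phi>))"

definition cluster_beta ::
  "(plane \<Rightarrow> real) \<Rightarrow> (plane \<Rightarrow> real) \<Rightarrow> real \<Rightarrow> real \<Rightarrow> plane \<Rightarrow> real" where
  "cluster_beta f g T R y =
     (let z = vector [R, 0] in
        \<integral>x. g (x - y - z) / (g z / T + g (x - y - z)) * f x \<partial>lborel)"

end

theory Submission
  imports Defs "HOL-Real_Asymp.Real_Asymp"
begin

text \<open>
  Integrating out the fading, the success probability of a configuration is
  \<open>exp (- \<Sum>x. ln (1 + T g (x - z) / g z))\<close>, so both sides are Palm expectations of exponential
  functionals. For the Poisson process a lower bound suffices: cut the unit square into small cells,
  keep only the cells with exactly one point, and use the independence of the remaining points; the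
  path loss seen from a point of the cell differs from the one seen from its corner by a term that
  vanishes with the mesh. For the cluster process an upper bound suffices: discard the other points of
  the cluster of the typical point, integrate out the cluster sizes and displacements given the
  parents, and apply the Mecke formula to the parents. The result is
  \<open>exp (- lp \<integral> 1 - exp (- c b(y)) dy)\<close> where \<open>b\<close> is \<open>\<beta>(R, \<cdot>)\<close> up to a rotation, and the claim follows from
  \<open>1 - exp (- t) \<ge> t / (1 + t)\<close> and \<open>\<integral> \<beta>(R, y) dy = \<integral> g / (g z / T + g)\<close>.
\<close>

subsection \<open>The exponential functional on extended nonnegative reals\<close>

text \<open>The obstacle is that a Laplace functional handles a fixed weight function, while in a
  Palm average the weight moves with the typical point. For clusters the typical point is a parent
  plus a displacement with a density. With its position \<open>p\<close> as integration variable the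
  weight no longer depends on the parent, and a Mecke inequality for fixed weights suffices. A
  Poisson point has no such displacement, so there the position can be frozen only approximately,
  which is what the small cells do. The independence hypothesis on a Poisson process concerns counts
  in bounded sets alone, so every functional is built up from such counts. Integrals take values in
  [0, infinity] throughout: an infinite interference is then an ordinary value, with success
  probability 0, and no finiteness of shot noise has to be shown. The denominator 1 + c B of the
  final intensity comes from replacing \<open>\<beta>\<close> by its supremum in t / (1 + t), and
  only in the denominator; the numerator has to stay as it is for its integral to be
  computable.\<close>

definition nexp :: "ennreal \<Rightarrow> ennreal" where
  "nexp s = (if s = \<top> then 0 else ennreal (exp (- enn2real s)))"

lemma nexp_ennreal: "0 \<le> x \<Longrightarrow> nexp (ennreal x) = ennreal (exp (- x))"
  by (simp add: nexp_def)

lemma nexp_0 [simp]: "nexp 0 = 1"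
  by (simp add: nexp_def)

lemma nexp_top [simp]: "nexp \<top> = 0"
  by (simp add: nexp_def)

lemma nexp_le_1 [simp]: "nexp s \<le> 1"
  by (simp add: nexp_def)

lemma nexp_neq_top [simp]: "nexp s \<noteq> \<top>" "nexp s < \<top>"
  by (simp_all add: nexp_def)

lemma nexp_eq_0_iff [simp]: "nexp s = 0 \<longleftrightarrow> s = \<top>"
  by (simp add: nexp_def)

lemma nexp_add: "nexp (a + b) = nexp a * nexp b"
proof (cases "a = \<top> \<or> b = \<top>")
  case False
  then show ?thesis
    by (simp add: nexp_def enn2real_plus top.not_eq_extremum exp_add exp_diff exp_minus
      flip: ennreal_mult' add: field_simps)
qed auto

lemma nexp_sum: "finite I \<Longrightarrow> nexp (sum f I) = (\<Prod>i\<in>I. nexp (f i))"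
  by (induction I rule: finite_induct) (auto simp: nexp_add)

lemma nexp_of_nat_mult: "nexp (of_nat n * a) = nexp a ^ n"
  by (induction n) (auto simp: nexp_add distrib_right)

lemma nexp_antimono: "a \<le> b \<Longrightarrow> nexp b \<le> nexp a"
  by (cases "b = \<top>") (auto simp: nexp_def top_unique intro!: enn2real_mono simp: top.not_eq_extremum)

text \<open>Continuity includes the value \<open>\<top>\<close>, so limits of partial sums may be
  taken under \<open>nexp\<close> whether or not the full sum is finite.\<close>

lemma nexp_tendsto:
  assumes "(s \<longlongrightarrow> l) F"
  shows "((\<lambda>n. nexp (s n)) \<longlongrightarrow> nexp l) F"
proof (cases "l = \<top>")
  case True
  show ?thesis unfolding True nexp_top
  proof (rule order_tendstoI)
    fix e :: ennreal assume "0 < e"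
    then obtain y where y: "0 < y" "y < e"
      using dense by blast
    then obtain r where r: "0 < r" "ennreal r < e"
      by (cases y) auto
    \<comment> \<open>The absolute value keeps the threshold faithful under \<open>ennreal\<close>,
      and exp (- |ln r|) is still at most r.\<close>
    have "\<forall>\<^sub>F n in F. ennreal (\<bar>ln r\<bar>) < s n"
      using assms True by (simp add: order_tendsto_iff)
    then show "\<forall>\<^sub>F n in F. nexp (s n) < e"
    proof eventually_elim
      case (elim n)
      have "nexp (s n) \<le> nexp (ennreal \<bar>ln r\<bar>)" using elim by (intro nexp_antimono) auto
      also have "\<dots> = ennreal (exp (- \<bar>ln r\<bar>))" by (simp add: nexp_ennreal)
      also have "\<dots> \<le> ennreal (exp (ln r))" by (intro ennreal_leI) auto
      finally show ?case using r by simp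
    qed
  qed auto
next
  case False
  then have fin: "\<forall>\<^sub>F n in F. s n < \<top>"
    using assms by (simp add: order_tendsto_iff top.not_eq_extremum)
  have "((\<lambda>n. enn2real (s n)) \<longlongrightarrow> enn2real l) F"
    using False assms by (intro tendsto_enn2real) (auto simp: top.not_eq_extremum)
  then have "((\<lambda>n. ennreal (exp (- enn2real (s n)))) \<longlongrightarrow> ennreal (exp (- enn2real l))) F"
    by (intro tendsto_ennrealI tendsto_exp tendsto_minus)
  moreover have eq: "\<forall>\<^sub>F n in F. ennreal (exp (- enn2real (s n))) = nexp (s n)"
    using fin by eventually_elim (auto simp: nexp_def)
  ultimately have "((\<lambda>n. nexp (s n)) \<longlongrightarrow> ennreal (exp (- enn2real l))) F"
    using tendsto_cong[OF eq] by blast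
  then show ?thesis
    using False by (simp add: nexp_def)
qed

lemma nexp_measurable [measurable]: "nexp \<in> borel_measurable borel"
  unfolding nexp_def by measurable

lemma one_minus_nexp_le: "1 - nexp x \<le> x"
proof (cases x)
  case (real r)
  have "1 - exp (- r) \<le> r" using exp_ge_add_one_self[of "- r"] by simp
  then show ?thesis using real
    by (simp add: nexp_ennreal ennreal_minus flip: ennreal_1)
qed simp

subsection \<open>Sums over random configurations and the reduced Palm distribution\<close>

lemma space_configs: "space configs = Collect locally_finite"
  by (auto simp: configs_def space_measure_of_conv)

lemma card_measurable_configs:
  assumes "B \<in> sets borel" "bounded B"
  shows "(\<lambda>A. card (A \<inter> B)) \<in> measurable configs (count_space UNIV)"
proof (subst measurable_count_space_eq2_countable, safe)
  fix n
  have "(\<lambda>A. card (A \<inter> B)) -` {n} \<inter> space configs = {A. locally_finite A \<and> card (A \<inter> B) = n}"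
    by (auto simp: space_configs)
  also have "\<dots> \<in> sets configs"
    unfolding configs_def using assms by (intro in_measure_of) auto
  finally show "(\<lambda>A. card (A \<inter> B)) -` {n} \<inter> space configs \<in> sets configs" .
qed auto

lemma measurable_configsI:
  assumes "\<And>\<omega>. \<omega> \<in> space N \<Longrightarrow> locally_finite (F \<omega>)"
    and "\<And>B. B \<in> sets borel \<Longrightarrow> bounded B \<Longrightarrow> (\<lambda>\<omega>. card (F \<omega> \<inter> B)) \<in> measurable N (count_space UNIV)"
  shows "F \<in> measurable N configs"
  unfolding configs_def
proof (rule measurable_measure_of, goal_cases)
  case (3 E)
  then obtain B :: "plane set" and n where E: "E = {A. locally_finite A \<and> card (A \<inter> B) = n}"
    and "B \<in> sets borel" "bounded B" by auto
  show ?case unfolding E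
  proof -
    from assms(2)[OF \<open>B \<in> sets borel\<close> \<open>bounded B\<close>]
    have "(\<lambda>\<omega>. card (F \<omega> \<inter> B)) -` {n} \<inter> space N \<in> sets N"
      by (rule measurable_sets) auto
    also have "(\<lambda>\<omega>. card (F \<omega> \<inter> B)) -` {n} \<inter> space N =
        F -` {A. locally_finite A \<and> card (A \<inter> B) = n} \<inter> space N"
      using assms(1) by auto
    finally show "F -` {A. locally_finite A \<and> card (A \<inter> B) = n} \<inter> space N \<in> sets N" .
  qed
qed (use assms(1) in auto)

lemma nn_integral_indicator_count_space:
  "finite {x\<in>A. P x} \<Longrightarrow> (\<integral>\<^sup>+x. (if P x then 1 else 0) \<partial>count_space A) = of_nat (card {x\<in>A. P x})"
  by (subst nn_integral_count_space'[of "{x\<in>A. P x}"]) auto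

text \<open>The sets \<open>C\<close> with this property contain the rectangles and form a Dynkin
  system. The bounded window \<open>W\<close> keeps all counts finite, so that a complement amounts
  to a subtraction of real numbers.\<close>

lemma count_kernel_measurable_bounded:
  assumes F: "F \<in> measurable N configs" and C: "C \<in> sets (N \<Otimes>\<^sub>M borel)"
    and W: "W \<in> sets borel" "bounded W"
  shows "(\<lambda>\<omega>. real (card {x \<in> F \<omega> \<inter> W. (\<omega>, x) \<in> C})) \<in> borel_measurable N"
proof -
  have lf: "finite (F \<omega> \<inter> W)" if "\<omega> \<in> space N" for \<omega>
    using measurable_space[OF F that] W by (auto simp: space_configs locally_finite_def)
  have card_meas: "(\<lambda>\<omega>. real (card (F \<omega> \<inter> B))) \<in> borel_measurable N"
    if "B \<in> sets borel" "bounded B" for B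
    by (rule measurable_compose[OF measurable_compose[OF F card_measurable_configs[OF that]]]) simp
  show ?thesis
    using Int_stable_pair_measure_generator pair_measure_closed C[unfolded sets_pair_measure]
  proof (induction rule: sigma_sets_induct_disjoint)
    case (basic C)
    then obtain A B where C: "C = A \<times> B" and [measurable]: "A \<in> sets N" and B: "B \<in> sets borel"
      by auto
    have "(\<lambda>\<omega>. indicator A \<omega> * real (card (F \<omega> \<inter> (B \<inter> W)))) \<in> borel_measurable N"
      using card_meas[of "B \<inter> W"] B W by (auto intro!: borel_measurable_times)
    also have "(\<lambda>\<omega>. indicator A \<omega> * real (card (F \<omega> \<inter> (B \<inter> W)))) =
        (\<lambda>\<omega>. real (card {x \<in> F \<omega> \<inter> W. (\<omega>, x) \<in> C}))"
    proof
      fix \<omega>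
      have "{x \<in> F \<omega> \<inter> W. (\<omega>, x) \<in> C} = (if \<omega> \<in> A then F \<omega> \<inter> (B \<inter> W) else {})"
        using C by auto
      then show "indicator A \<omega> * real (card (F \<omega> \<inter> (B \<inter> W))) = real (card {x \<in> F \<omega> \<inter> W. (\<omega>, x) \<in> C})"
        by simp
    qed
    finally show ?case .
  next
    case empty
    then show ?case by simp
  next
    case (compl C)
    have "(\<lambda>\<omega>. real (card (F \<omega> \<inter> W)) - real (card {x \<in> F \<omega> \<inter> W. (\<omega>, x) \<in> C})) \<in> borel_measurable N"
      using compl card_meas[OF W] by auto
    moreover have "real (card {x \<in> F \<omega> \<inter> W. (\<omega>, x) \<in> space N \<times> space borel - C}) =
        real (card (F \<omega> \<inter> W)) - real (card {x \<in> F \<omega> \<inter> W. (\<omega>, x) \<in> C})" if "\<omega> \<in> space N" for \<omega>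
    proof -
      let ?C = "{x \<in> F \<omega> \<inter> W. (\<omega>, x) \<in> C}"
      have eq: "{x \<in> F \<omega> \<inter> W. (\<omega>, x) \<in> space N \<times> space borel - C} = F \<omega> \<inter> W - ?C"
        using that by auto
      have sub: "?C \<subseteq> F \<omega> \<inter> W" by auto
      show ?thesis
        unfolding eq card_Diff_subset[OF finite_subset[OF sub lf[OF that]] sub]
        by (rule of_nat_diff[OF card_mono[OF lf[OF that] sub]])
    qed
    ultimately show ?case by (simp cong: measurable_cong)
  next
    case (union C)
    have 1: "(\<lambda>\<omega>. \<Sum>i. ennreal (real (card {x \<in> F \<omega> \<inter> W. (\<omega>, x) \<in> C i}))) \<in> borel_measurable N"
      using union.IH by measurable
    have 2: "(\<Sum>i. ennreal (real (card {x \<in> F \<omega> \<inter> W. (\<omega>, x) \<in> C i}))) =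
        ennreal (real (card {x \<in> F \<omega> \<inter> W. (\<omega>, x) \<in> (\<Union>i. C i)}))" if "\<omega> \<in> space N" for \<omega>
    proof -
      have fin: "finite {x \<in> F \<omega> \<inter> W. (\<omega>, x) \<in> D}" for D
        using lf[OF that] by (rule rev_finite_subset) auto
      have eq: "emeasure (count_space UNIV) {x \<in> F \<omega> \<inter> W. (\<omega>, x) \<in> D} = ennreal (real (card {x \<in> F \<omega> \<inter> W. (\<omega>, x) \<in> D}))" for D
        using fin by (simp add: ennreal_of_nat_eq_real_of_nat)
      \<comment> \<open>Counting measure supplies the countable additivity of the cardinality over
        the disjoint \<open>C i\<close>.\<close>
      have "(\<Sum>i. emeasure (count_space UNIV) {x \<in> F \<omega> \<inter> W. (\<omega>, x) \<in> C i}) =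
          emeasure (count_space UNIV) (\<Union>i. {x \<in> F \<omega> \<inter> W. (\<omega>, x) \<in> C i})"
        using union by (intro suminf_emeasure) (auto simp: disjoint_family_on_def)
      also have "(\<Union>i. {x \<in> F \<omega> \<inter> W. (\<omega>, x) \<in> C i}) = {x \<in> F \<omega> \<inter> W. (\<omega>, x) \<in> (\<Union>i. C i)}"
        by auto
      finally show ?thesis by (simp only: eq)
    qed
    have "(\<lambda>\<omega>. ennreal (real (card {x \<in> F \<omega> \<inter> W. (\<omega>, x) \<in> (\<Union>i. C i)}))) \<in> borel_measurable N"
      by (rule iffD1[OF measurable_cong[OF 2] 1])
    then have "(\<lambda>\<omega>. enn2real (ennreal (real (card {x \<in> F \<omega> \<inter> W. (\<omega>, x) \<in> (\<Union>i. C i)})))) \<in> borel_measurable N"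
      by (rule borel_measurable_enn2real)
    then show ?case by simp
  qed
qed

lemma SUP_indicator_cball:
  fixes f :: "plane \<Rightarrow> ennreal"
  shows "(SUP n. f x * indicator (cball 0 (real n)) x) = f x"
proof (rule antisym)
  obtain n where "norm x \<le> real n" using real_arch_simple by blast
  then have "f x = f x * indicator (cball 0 (real n)) x" by simp
  then show "f x \<le> (SUP n. f x * indicator (cball 0 (real n)) x)"
    by (rule order_trans[OF eq_refl SUP_upper]) auto
qed (auto intro!: SUP_least split: split_indicator)

lemma incseq_indicator_cball:
  fixes f :: "plane \<Rightarrow> ennreal"
  shows "incseq (\<lambda>n x. f x * indicator (cball 0 (real n)) x)"
  by (auto simp: incseq_def le_fun_def split: split_indicator)

text \<open>Exhaustion by balls carries statements on bounded windows to the whole plane. The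
  disjunction covers the two measures in use, Lebesgue measure and counting measure on a
  configuration.\<close>

lemma nn_integral_cball_SUP:
  fixes f :: "plane \<Rightarrow> ennreal"
  assumes "f \<in> borel_measurable M" "sets M = sets borel \<or> (\<exists>A. M = count_space A)"
  shows "integral\<^sup>N M f = (SUP n. \<integral>\<^sup>+x. f x * indicator (cball 0 (real n)) x \<partial>M)"
proof -
  have "(\<lambda>x. f x * indicator (cball 0 (real n)) x) \<in> borel_measurable M" for n
  proof (cases "sets M = sets borel")
    case True
    then show ?thesis using assms(1) by (intro borel_measurable_times_ennreal borel_measurable_indicator) auto
  qed (use assms in auto)
  then show ?thesis
    by (subst nn_integral_monotone_convergence_SUP[OF incseq_indicator_cball, symmetric])
      (auto simp: SUP_indicator_cball)
qed

text \<open>A configuration thus acts as a measurable kernel. Only indicators need an argument: over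
  a ball they give a finite count, and balls exhaust the plane.\<close>

lemma count_integral_measurable:
  assumes F: "F \<in> measurable N configs" and H: "H \<in> borel_measurable (N \<Otimes>\<^sub>M borel)"
  shows "(\<lambda>\<omega>. \<integral>\<^sup>+x. H (\<omega>, x) \<partial>count_space (F \<omega>)) \<in> borel_measurable N"
  using H
proof (induction rule: borel_measurable_induct)
  case (cong f g)
  have "(\<integral>\<^sup>+x. f (\<omega>, x) \<partial>count_space (F \<omega>)) = (\<integral>\<^sup>+x. g (\<omega>, x) \<partial>count_space (F \<omega>))" if "\<omega> \<in> space N" for \<omega>
    using cong(3) that by (intro nn_integral_cong) (auto simp: space_pair_measure)
  then show ?case using cong by (simp cong: measurable_cong)
next
  case (set C)
  have lf: "finite (F \<omega> \<inter> cball 0 (real n))" if "\<omega> \<in> space N" for \<omega> n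
    using measurable_space[OF F that] by (auto simp: space_configs locally_finite_def)
  have "(\<lambda>\<omega>. SUP n. ennreal (real (card {x \<in> F \<omega> \<inter> cball 0 (real n). (\<omega>, x) \<in> C}))) \<in> borel_measurable N"
    by (intro borel_measurable_SUP measurable_compose[OF count_kernel_measurable_bounded[OF F set] measurable_ennreal]) auto
  moreover have "(SUP n. ennreal (real (card {x \<in> F \<omega> \<inter> cball 0 (real n). (\<omega>, x) \<in> C}))) =
      (\<integral>\<^sup>+x. indicator C (\<omega>, x) \<partial>count_space (F \<omega>))" if \<omega>: "\<omega> \<in> space N" for \<omega>
  proof (subst nn_integral_cball_SUP)
    have "(\<integral>\<^sup>+x. indicator C (\<omega>, x) * indicator (cball 0 (real n)) x \<partial>count_space (F \<omega>)) =
       ennreal (real (card {x \<in> F \<omega> \<inter> cball 0 (real n). (\<omega>, x) \<in> C}))" for n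
    proof -
      have "{x\<in>F \<omega>. (\<omega>, x) \<in> C \<and> x \<in> cball 0 (real n)} = {x \<in> F \<omega> \<inter> cball 0 (real n). (\<omega>, x) \<in> C}"
        by auto
      moreover have "finite {x \<in> F \<omega> \<inter> cball 0 (real n). (\<omega>, x) \<in> C}"
        using lf[OF \<omega>, of n] by (rule rev_finite_subset) auto
      moreover have "(\<integral>\<^sup>+x. indicator C (\<omega>, x) * indicator (cball 0 (real n)) x \<partial>count_space (F \<omega>)) =
        (\<integral>\<^sup>+x. (if (\<omega>, x) \<in> C \<and> x \<in> cball 0 (real n) then 1 else 0) \<partial>count_space (F \<omega>))"
        by (intro nn_integral_cong) (auto split: split_indicator)
      ultimately show ?thesis
        by (simp add: nn_integral_indicator_count_space ennreal_of_nat_eq_real_of_nat)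
    qed
    then show "(SUP n. ennreal (real (card {x \<in> F \<omega> \<inter> cball 0 (real n). (\<omega>, x) \<in> C}))) =
      (SUP n. \<integral>\<^sup>+x. indicator C (\<omega>, x) * indicator (cball 0 (real n)) x \<partial>count_space (F \<omega>))"
      by simp
  qed auto
  ultimately show ?case by (simp cong: measurable_cong)
next
  case (mult u c)
  then show ?case by (simp add: nn_integral_cmult)
next
  case (add u v)
  then show ?case by (simp add: nn_integral_add)
next
  case (seq U)
  have "(\<integral>\<^sup>+x. (SUP i. U i) (\<omega>, x) \<partial>count_space (F \<omega>)) = (SUP i. \<integral>\<^sup>+x. U i (\<omega>, x) \<partial>count_space (F \<omega>))" for \<omega>
    using seq(3) unfolding SUP_apply
    by (subst nn_integral_monotone_convergence_SUP) (auto simp: incseq_def le_fun_def)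
  moreover have "(\<lambda>\<omega>. SUP i. \<integral>\<^sup>+x. U i (\<omega>, x) \<partial>count_space (F \<omega>)) \<in> borel_measurable N"
    using seq by (intro borel_measurable_SUP) auto
  ultimately show ?case by simp
qed


section \<open>Palm averages of a point process\<close>

abbreviation reduced_shift :: "plane set \<Rightarrow> plane \<Rightarrow> plane set" where
  "reduced_shift A x \<equiv> (\<lambda>y. y - x) ` (A - {x})"

lemma locally_finite_reduced_shift:
  assumes "locally_finite A"
  shows "locally_finite (reduced_shift A x)"
  unfolding locally_finite_def
proof safe
  fix B :: "plane set" assume "bounded B"
  then have "bounded ((+) x ` B)"
    by (rule bounded_translation)
  then have "finite (A \<inter> (+) x ` B)"
    using assms by (simp add: locally_finite_def)
  then have "finite ((\<lambda>y. y - x) ` (A \<inter> (+) x ` B))"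
    by simp
  moreover have "reduced_shift A x \<inter> B \<subseteq> (\<lambda>y. y - x) ` (A \<inter> (+) x ` B)"
    by (auto intro!: image_eqI simp: algebra_simps)
  ultimately show "finite (reduced_shift A x \<inter> B)"
    by (rule finite_subset[rotated])
qed

lemma count_integral_reduced_shift:
  "(\<integral>\<^sup>+y. w y \<partial>count_space (reduced_shift A x)) = (\<integral>\<^sup>+y. w (y - x) \<partial>count_space (A - {x}))"
  by (rule nn_integral_bij_count_space[symmetric]) (auto simp: bij_betw_def inj_on_def)

lemma count_integral_Diff:
  "(\<integral>\<^sup>+y. w y \<partial>count_space (A - B)) = (\<integral>\<^sup>+y. w y * indicator (- B) y \<partial>count_space A)"
  by (auto simp: nn_integral_count_space_indicator[of A] nn_integral_count_space_indicator[of "A - B"]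
      intro!: nn_integral_cong split: split_indicator)

text \<open>The count of the shifted configuration in \<open>B\<close> is an integral over the
  original configuration of a function jointly measurable in configuration, shift and point. The
  factor \<open>indicator (- {0})\<close> deletes the point that is moved to the origin.\<close>

lemma reduced_shift_measurable:
  "(\<lambda>(A, x). reduced_shift A x) \<in> measurable (configs \<Otimes>\<^sub>M borel) configs"
proof (rule measurable_configsI)
  fix \<omega> :: "plane set \<times> plane" assume "\<omega> \<in> space (configs \<Otimes>\<^sub>M borel)"
  then show "locally_finite (case \<omega> of (A, x) \<Rightarrow> reduced_shift A x)"
    by (auto simp: space_pair_measure space_configs locally_finite_reduced_shift)
next
  fix B :: "plane set" assume B[measurable]: "B \<in> sets borel" and "bounded B"
  define c :: "plane set \<times> plane \<Rightarrow> nat" where "c = (\<lambda>\<omega>. card ((case \<omega> of (A, x) \<Rightarrow> reduced_shift A x) \<inter> B))"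
  have "(\<lambda>\<omega>. \<integral>\<^sup>+y. (\<lambda>(\<omega>, y). indicator B (y - snd \<omega>) * indicator (- {0}) (y - snd \<omega>)) (\<omega>, y) \<partial>count_space (fst \<omega>))
      \<in> borel_measurable (configs \<Otimes>\<^sub>M (borel :: plane measure))"
    by (rule count_integral_measurable) (auto intro!: borel_measurable_times_ennreal)
  moreover have "(\<integral>\<^sup>+y. (\<lambda>(\<omega>, y). indicator B (y - snd \<omega>) * indicator (- {0}) (y - snd \<omega>)) (\<omega>, y) \<partial>count_space (fst \<omega>)) =
      of_nat (c \<omega>)" if "\<omega> \<in> space (configs \<Otimes>\<^sub>M (borel :: plane measure))" for \<omega>
  proof -
    obtain A x where \<omega>: "\<omega> = (A, x)" by force
    have "locally_finite (reduced_shift A x)"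
      using that by (auto simp: \<omega> space_pair_measure space_configs locally_finite_reduced_shift)
    then have fin: "finite (reduced_shift A x \<inter> B)"
      using \<open>bounded B\<close> by (simp add: locally_finite_def)
    have "(\<integral>\<^sup>+y. indicator B (y - x) * indicator (- {0}) (y - x) \<partial>count_space A) =
        (\<integral>\<^sup>+y. indicator B (y - x) \<partial>count_space (A - {x}))"
      unfolding count_integral_Diff by (intro nn_integral_cong) (auto split: split_indicator)
    also have "\<dots> = (\<integral>\<^sup>+y. indicator B y \<partial>count_space (reduced_shift A x))"
      by (simp add: count_integral_reduced_shift)
    also have "\<dots> = of_nat (card {y \<in> reduced_shift A x. y \<in> B})"
      using fin by (subst nn_integral_indicator_count_space[symmetric])
        (auto simp: Int_def indicator_def of_bool_def intro!: nn_integral_cong)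
    also have "{y \<in> reduced_shift A x. y \<in> B} = reduced_shift A x \<inter> B" by auto
    finally show ?thesis by (simp add: \<omega> c_def)
  qed
  ultimately have *: "(\<lambda>\<omega>. of_nat (c \<omega>) :: ennreal) \<in> borel_measurable (configs \<Otimes>\<^sub>M (borel :: plane measure))"
    by (simp cong: measurable_cong)
  have "c \<in> measurable (configs \<Otimes>\<^sub>M borel) (count_space UNIV)"
  proof (subst measurable_count_space_eq2_countable, safe)
    fix n
    have "(\<lambda>\<omega>. of_nat (c \<omega>) :: ennreal) -` {of_nat n} \<inter> space (configs \<Otimes>\<^sub>M (borel :: plane measure)) \<in> sets (configs \<Otimes>\<^sub>M (borel :: plane measure))"
      by (rule measurable_sets[OF *]) auto
    then show "c -` {n} \<inter> space (configs \<Otimes>\<^sub>M borel) \<in> sets (configs \<Otimes>\<^sub>M borel)"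
      by (simp add: vimage_def)
  qed auto
  then show "(\<lambda>\<omega>. card ((case \<omega> of (A, x) \<Rightarrow> reduced_shift A x) \<inter> B)) \<in> measurable (configs \<Otimes>\<^sub>M borel) (count_space UNIV)"
    by (simp add: c_def)
qed

text \<open>The finite sum in \<open>reduced_palm\<close> rewritten as an integral, so that it
  extends to functions with values in [0, infinity] and obeys monotone convergence.\<close>

definition palm_sum :: "(plane set \<Rightarrow> ennreal) \<Rightarrow> plane set \<Rightarrow> ennreal" where
  "palm_sum F A = (\<integral>\<^sup>+x. F (reduced_shift A x) * indicator (cbox 0 One) x \<partial>count_space A)"

lemma palm_sum_measurable:
  assumes [measurable]: "F \<in> borel_measurable configs"
  shows "palm_sum F \<in> borel_measurable configs"
proof -
  have [measurable]: "(\<lambda>p. F (reduced_shift (fst p) (snd p))) \<in> borel_measurable (configs \<Otimes>\<^sub>M borel)"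
    using measurable_compose[OF reduced_shift_measurable assms] by (simp add: case_prod_beta)
  have "(\<lambda>A. \<integral>\<^sup>+x. (\<lambda>p. F (reduced_shift (fst p) (snd p)) * indicator (cbox 0 One) (snd p)) (A, x) \<partial>count_space A)
      \<in> borel_measurable configs"
    by (rule count_integral_measurable) measurable
  then show ?thesis
    by (simp add: palm_sum_def[abs_def])
qed

lemma palm_sum_indicator:
  assumes "locally_finite A"
  shows "palm_sum (indicator E) A = (\<Sum>x \<in> A \<inter> cbox 0 One. indicator E (reduced_shift A x))"
proof -
  have "finite (A \<inter> cbox 0 One)"
    using assms by (simp add: locally_finite_def)
  then have "palm_sum (indicator E) A = (\<Sum>x \<in> A \<inter> cbox 0 One. indicator E (reduced_shift A x) * indicator (cbox 0 One) x)"
    unfolding palm_sum_def by (intro nn_integral_count_space') auto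
  then show ?thesis by simp
qed

lemma sets_reduced_palm: "sets (reduced_palm M \<Phi>) = sets configs"
  by (simp add: reduced_palm_def)

text \<open>\<open>measure_of\<close> yields the zero measure unless the given set function is a
  measure, so countable additivity has to be established before the defining formula can be read
  off.\<close>

lemma emeasure_reduced_palm:
  assumes "point_process M \<Phi>" and E: "E \<in> sets configs"
  shows "emeasure (reduced_palm M \<Phi>) E = (\<integral>\<^sup>+\<omega>. palm_sum (indicator E) (\<Phi> \<omega>) \<partial>M) / intensity M \<Phi>"
proof -
  have \<Phi>: "\<Phi> \<in> measurable M configs"
    using assms by (simp add: point_process_def)
  have meas: "(\<lambda>\<omega>. palm_sum (indicator E) (\<Phi> \<omega>)) \<in> borel_measurable M" if "E \<in> sets configs" for E
    by (rule measurable_compose[OF \<Phi> palm_sum_measurable]) (use that in auto)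
  define m where "m = (\<lambda>E. (\<integral>\<^sup>+\<omega>. palm_sum (indicator E) (\<Phi> \<omega>) \<partial>M) / intensity M \<Phi>)"
  have m: "(\<integral>\<^sup>+\<omega>. (\<Sum>x \<in> \<Phi> \<omega> \<inter> cbox 0 One. indicator E ((\<lambda>y. y - x) ` (\<Phi> \<omega> - {x}))) \<partial>M) / intensity M \<Phi> = m E" for E
    unfolding m_def using measurable_space[OF \<Phi>]
    by (intro arg_cong2[where f = "(/)"] nn_integral_cong palm_sum_indicator[symmetric]) (auto simp: space_configs)
  have palm: "reduced_palm M \<Phi> = measure_of (space configs) (sets configs) m"
    by (simp add: reduced_palm_def m)
  have "emeasure (reduced_palm M \<Phi>) E = m E"
  proof (rule emeasure_measure_of[OF palm])
    show "countably_additive (sets (reduced_palm M \<Phi>)) m"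
    proof (rule countably_additiveI)
      fix D :: "nat \<Rightarrow> plane set set"
      assume D: "range D \<subseteq> sets (reduced_palm M \<Phi>)" "disjoint_family D"
      have "palm_sum (indicator (\<Union>i. D i)) A = (\<Sum>i. palm_sum (indicator (D i)) A)" for A
        unfolding palm_sum_def suminf_indicator[OF D(2), symmetric]
        by (simp add: nn_integral_suminf[symmetric] ennreal_suminf_multc)
      then show "(\<Sum>i. m (D i)) = m (\<Union>i. D i)"
        using D unfolding m_def
        by (simp add: divide_ennreal_def ennreal_suminf_multc nn_integral_suminf meas sets_reduced_palm image_subset_iff)
    qed
  qed (use E sets.space_closed[of configs] in \<open>auto simp: sets_reduced_palm positive_def m_def palm_sum_def\<close>)
  then show ?thesis by (simp add: m_def)
qed

lemma nn_integral_reduced_palm: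
  assumes "point_process M \<Phi>" and F: "F \<in> borel_measurable configs"
  shows "(\<integral>\<^sup>+A. F A \<partial>reduced_palm M \<Phi>) = (\<integral>\<^sup>+\<omega>. palm_sum F (\<Phi> \<omega>) \<partial>M) / intensity M \<Phi>"
  using F
proof (induction rule: borel_measurable_induct)
  have \<Phi>: "\<Phi> \<in> measurable M configs"
    using assms by (simp add: point_process_def)
  have lf: "locally_finite (\<Phi> \<omega>)" if "\<omega> \<in> space M" for \<omega>
    using measurable_space[OF \<Phi> that] by (simp add: space_configs)
  have meas: "(\<lambda>\<omega>. palm_sum F (\<Phi> \<omega>)) \<in> borel_measurable M" if "F \<in> borel_measurable configs" for F
    by (rule measurable_compose[OF \<Phi> palm_sum_measurable]) fact
  note cong_sets = measurable_cong_sets[OF sets_reduced_palm refl]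
  {
    case (cong F G)
    have "(\<integral>\<^sup>+A. F A \<partial>reduced_palm M \<Phi>) = (\<integral>\<^sup>+A. G A \<partial>reduced_palm M \<Phi>)"
      using cong(3) by (intro nn_integral_cong) (simp add: sets_eq_imp_space_eq[OF sets_reduced_palm])
    moreover have "palm_sum F (\<Phi> \<omega>) = palm_sum G (\<Phi> \<omega>)" if "\<omega> \<in> space M" for \<omega>
      unfolding palm_sum_def using lf[OF that] cong(3)
      by (intro nn_integral_cong) (simp add: space_configs locally_finite_reduced_shift)
    then have "(\<integral>\<^sup>+\<omega>. palm_sum F (\<Phi> \<omega>) \<partial>M) = (\<integral>\<^sup>+\<omega>. palm_sum G (\<Phi> \<omega>) \<partial>M)"
      by (rule nn_integral_cong)
    ultimately show ?case using cong(4) by simp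
  next
    case (set E)
    then show ?case
      by (simp add: sets_reduced_palm emeasure_reduced_palm[OF assms(1)])
  next
    case (mult F c)
    have "palm_sum (\<lambda>A. c * F A) A = c * palm_sum F A" for A
      unfolding palm_sum_def by (simp add: nn_integral_cmult[symmetric] mult.assoc)
    then show ?case
      using mult by (simp add: nn_integral_cmult cong_sets meas ennreal_times_divide)
  next
    case (add F G)
    have "palm_sum (\<lambda>A. F A + G A) A = palm_sum F A + palm_sum G A" for A
      unfolding palm_sum_def by (simp add: nn_integral_add[symmetric] distrib_right)
    then show ?case
      using add by (simp add: nn_integral_add cong_sets meas divide_ennreal_def distrib_right add.commute)
  next
    case (seq U)
    have ps: "palm_sum (SUP i. U i) A = (SUP i. palm_sum (U i) A)" for A
    proof -
      have "palm_sum (SUP i. U i) A = (\<integral>\<^sup>+x. (SUP i. U i (reduced_shift A x) * indicator (cbox 0 One) x) \<partial>count_space A)"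
        unfolding palm_sum_def SUP_apply by (intro nn_integral_cong) (simp add: SUP_mult_right_ennreal)
      also have "\<dots> = (SUP i. palm_sum (U i) A)"
        unfolding palm_sum_def using seq(3)
        by (intro nn_integral_monotone_convergence_SUP) (auto simp: incseq_def le_fun_def intro!: mult_right_mono)
      finally show ?thesis .
    qed
    have inc: "incseq (\<lambda>i \<omega>. palm_sum (U i) (\<Phi> \<omega>))"
      using seq(3) unfolding palm_sum_def
      by (auto simp: incseq_def le_fun_def intro!: nn_integral_mono mult_right_mono)
    have "(\<integral>\<^sup>+A. (SUP i. U i) A \<partial>reduced_palm M \<Phi>) = (SUP i. \<integral>\<^sup>+A. U i A \<partial>reduced_palm M \<Phi>)"
      unfolding SUP_apply using seq by (intro nn_integral_monotone_convergence_SUP) (auto simp: cong_sets)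
    also have "\<dots> = (\<integral>\<^sup>+\<omega>. palm_sum (SUP i. U i) (\<Phi> \<omega>) \<partial>M) / intensity M \<Phi>"
      unfolding ps seq.IH using inc seq(1)
      by (simp add: nn_integral_monotone_convergence_SUP meas divide_ennreal_def SUP_mult_right_ennreal)
    finally show ?case .
  }
qed

subsection \<open>Laplace functional and Mecke formula of a Poisson process\<close>

text \<open>The generating function of a Poisson variable of mean \<open>m\<close>. It is used for
  the counts of the Poisson process and again for the cluster sizes.\<close>

lemma suminf_poisson_power:
  assumes "0 \<le> m" "s \<le> 1"
  shows "(\<Sum>n. s ^ n * ennreal (exp (- m) * m ^ n / fact n)) = nexp (ennreal m * (1 - s))"
proof -
  obtain r where r: "s = ennreal r" "0 \<le> r" "r \<le> 1"
    using assms(2) by (cases s) (auto simp: top_unique)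
  have "(\<lambda>n. exp (- m) * ((m * r) ^ n /\<^sub>R fact n)) sums (exp (- m) * exp (m * r))"
    by (intro sums_mult exp_converges)
  also have "exp (- m) * exp (m * r) = exp (- (m * (1 - r)))"
    by (simp add: exp_add[symmetric] algebra_simps)
  finally have "(\<Sum>n. ennreal (exp (- m) * ((m * r) ^ n /\<^sub>R fact n))) = ennreal (exp (- (m * (1 - r))))"
    using assms(1) r by (intro suminf_ennreal_eq) auto
  moreover have "s ^ n * ennreal (exp (- m) * m ^ n / fact n) = ennreal (exp (- m) * ((m * r) ^ n /\<^sub>R fact n))" for n
    unfolding r(1) using assms(1) r(2)
    by (simp add: ennreal_power ennreal_mult'[symmetric] power_mult_distrib divide_simps)
  moreover have "ennreal m * (1 - s) = ennreal (m * (1 - r))"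
    using r assms(1) by (simp add: ennreal_mult ennreal_minus flip: ennreal_1)
  ultimately show ?thesis
    using r assms(1) by (simp add: nexp_ennreal)
qed

lemma suminf_poisson_mean:
  assumes "0 \<le> m"
  shows "(\<Sum>n. of_nat n * ennreal (exp (- m) * m ^ n / fact n)) = ennreal m"
proof -
  have "(\<lambda>n. m * exp (- m) * (m ^ n /\<^sub>R fact n)) sums (m * exp (- m) * exp m)"
    by (intro sums_mult exp_converges)
  \<comment> \<open>The term at 0 of the mean vanishes, so the sum may start at 1; the factor n then
    cancels against the factorial.\<close>
  also have "(\<lambda>n. m * exp (- m) * (m ^ n /\<^sub>R fact n)) = (\<lambda>n. real (Suc n) * (exp (- m) * m ^ Suc n / fact (Suc n)))"
    by (rule ext) (simp add: divide_simps)
  also have "m * exp (- m) * exp m = m"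
    by (simp add: exp_minus)
  finally have "(\<lambda>n. real n * (exp (- m) * m ^ n / fact n)) sums m"
    by (subst (asm) sums_Suc_iff) simp
  then have "(\<Sum>n. ennreal (real n * (exp (- m) * m ^ n / fact n))) = ennreal m"
    using assms by (intro suminf_ennreal_eq) auto
  moreover have "of_nat n * ennreal (exp (- m) * m ^ n / fact n) = ennreal (real n * (exp (- m) * m ^ n / fact n))" for n
    using assms by (subst ennreal_mult) (auto simp: ennreal_of_nat_eq_real_of_nat)
  ultimately show ?thesis by simp
qed

lemma nn_integral_nat_valued:
  assumes [measurable]: "N \<in> measurable M (count_space UNIV)"
  shows "(\<integral>\<^sup>+\<omega>. \<phi> (N \<omega>) \<partial>M) = (\<Sum>n. \<phi> n * emeasure M {\<omega> \<in> space M. N \<omega> = n})"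
proof -
  have "(\<integral>\<^sup>+\<omega>. \<phi> (N \<omega>) \<partial>M) = (\<integral>\<^sup>+\<omega>. (\<Sum>n. \<phi> n * indicator {\<omega> \<in> space M. N \<omega> = n} \<omega>) \<partial>M)"
  proof (rule nn_integral_cong)
    fix \<omega> assume \<omega>: "\<omega> \<in> space M"
    have "(\<Sum>n. \<phi> n * indicator {\<omega> \<in> space M. N \<omega> = n} \<omega>) = (\<Sum>n\<in>{N \<omega>}. \<phi> n * indicator {\<omega> \<in> space M. N \<omega> = n} \<omega>)"
      by (rule suminf_finite) auto
    then show "\<phi> (N \<omega>) = (\<Sum>n. \<phi> n * indicator {\<omega> \<in> space M. N \<omega> = n} \<omega>)"
      using \<omega> by simp
  qed
  also have "\<dots> = (\<Sum>n. \<phi> n * emeasure M {\<omega> \<in> space M. N \<omega> = n})"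
    by (simp add: nn_integral_suminf nn_integral_cmult)
  finally show ?thesis .
qed

lemma count_integral_const_measurable:
  assumes "Y \<in> measurable M configs" "w \<in> borel_measurable borel"
  shows "(\<lambda>\<omega>. \<integral>\<^sup>+x. w x \<partial>count_space (Y \<omega>)) \<in> borel_measurable M"
proof -
  have "(\<lambda>\<omega>. \<integral>\<^sup>+x. (w \<circ> snd) (\<omega>, x) \<partial>count_space (Y \<omega>)) \<in> borel_measurable M"
    using assms by (intro count_integral_measurable) auto
  then show ?thesis by simp
qed

lemma count_integral_remove:
  "x \<in> A \<Longrightarrow> (\<integral>\<^sup>+y. w y \<partial>count_space A) = w x + (\<integral>\<^sup>+y. w y \<partial>count_space (A - {x}))"
proof -
  assume "x \<in> A"
  have "(\<integral>\<^sup>+y. w y \<partial>count_space A) = (\<integral>\<^sup>+y. w y * indicator {x} y + w y * indicator (- {x}) y \<partial>count_space A)"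
    by (intro nn_integral_cong) (auto split: split_indicator)
  also have "\<dots> = (\<integral>\<^sup>+y. w y * indicator {x} y \<partial>count_space A) + (\<integral>\<^sup>+y. w y \<partial>count_space (A - {x}))"
    by (simp add: nn_integral_add count_integral_Diff)
  also have "(\<integral>\<^sup>+y. w y * indicator {x} y \<partial>count_space A) = w x"
    using \<open>x \<in> A\<close> by (subst nn_integral_count_space'[of "{x}"]) auto
  finally show ?thesis .
qed

lemma count_integral_indicator:
  "finite (A \<inter> B) \<Longrightarrow> (\<integral>\<^sup>+y. indicator B y \<partial>count_space A) = of_nat (card (A \<inter> B))"
  by (subst nn_integral_count_space'[of "A \<inter> B"]) auto

text \<open>With \<open>a\<close> and \<open>b\<close> exponentials it separates the contributions
  of two summed weights to a Laplace exponent. Subtraction is truncated on \<open>ennreal\<close>,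
  hence the detour through real numbers in [0, 1].\<close>

lemma one_minus_mult_ennreal:
  fixes a b :: ennreal
  assumes "a \<le> 1" "b \<le> 1"
  shows "1 - a * b = (1 - a) + a * (1 - b)"
proof -
  obtain r where r: "a = ennreal r" "0 \<le> r" "r \<le> 1"
    using assms by (cases a) (auto simp: top_unique)
  obtain s where s: "b = ennreal s" "0 \<le> s" "s \<le> 1"
    using assms by (cases b) (auto simp: top_unique)
  have rs: "1 - ennreal r * ennreal s = ennreal (1 - r * s)"
    using r s by (simp add: ennreal_minus ennreal_mult[symmetric] flip: ennreal_1)
  have "(1 - ennreal r) + ennreal r * (1 - ennreal s) = ennreal (1 - r) + ennreal (r * (1 - s))"
    using r s by (simp add: ennreal_minus ennreal_mult flip: ennreal_1)
  also have "\<dots> = ennreal ((1 - r) + r * (1 - s))"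
    using r s by (intro ennreal_plus[symmetric]) auto
  also have "(1 - r) + r * (1 - s) = 1 - r * s"
    by (simp add: algebra_simps)
  finally show ?thesis
    unfolding r(1) s(1) rs ..
qed

text \<open>The derivative of 1 - exp (- t p) at t = 0 along t = 1 / (n + 1). It holds for p
  infinite as well, where the quotient is n + 1.\<close>

lemma nexp_difference_quotient_tendsto:
  "(\<lambda>n. of_nat (Suc n) * (1 - nexp (p / of_nat (Suc n)))) \<longlonglongrightarrow> p"
proof (cases p)
  case (real r)
  have eq: "of_nat (Suc n) * (1 - nexp (p / of_nat (Suc n))) = ennreal (real (Suc n) * (1 - exp (- (r / real (Suc n)))))" for n
    using real by (simp add: divide_ennreal ennreal_of_nat_eq_real_of_nat nexp_ennreal ennreal_minus ennreal_mult
        flip: ennreal_1 del: of_nat_Suc)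
  have lim: "(\<lambda>n. real (Suc n) * (1 - exp (- (r / real (Suc n))))) \<longlonglongrightarrow> r"
    by real_asymp
  show ?thesis
    unfolding eq using tendsto_ennrealI[OF lim] unfolding \<open>p = ennreal r\<close>[symmetric] .
next
  case top
  have "(\<lambda>n. of_nat (Suc n) :: ennreal) \<longlonglongrightarrow> \<top>"
    using LIMSEQ_Suc[OF of_nat_tendsto_top_ennreal] by simp
  then show ?thesis
    using top by (simp add: ennreal_top_divide)
qed

section \<open>The Laplace functional, built from independent counts\<close>

locale homogeneous_poisson =
  fixes M :: "'a measure" and l :: real and Y :: "'a \<Rightarrow> plane set"
  assumes poisson: "poisson_process M l Y" and rate_nonneg: "0 \<le> l"
begin

sublocale prob_space M
  using poisson by (simp add: poisson_process_def point_process_def)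

lemma Y_measurable: "Y \<in> measurable M configs"
  using poisson by (simp add: poisson_process_def point_process_def)

lemma locally_finite_Y: "\<omega> \<in> space M \<Longrightarrow> locally_finite (Y \<omega>)"
  using measurable_space[OF Y_measurable] by (simp add: space_configs)

lemma finite_Y: "\<omega> \<in> space M \<Longrightarrow> bounded B \<Longrightarrow> finite (Y \<omega> \<inter> B)"
  using locally_finite_Y by (simp add: locally_finite_def)

lemma count_measurable:
  "B \<in> sets borel \<Longrightarrow> bounded B \<Longrightarrow> (\<lambda>\<omega>. card (Y \<omega> \<inter> B)) \<in> measurable M (count_space UNIV)"
  by (rule measurable_compose[OF Y_measurable card_measurable_configs])

lemma nn_integral_count:
  assumes "B \<in> sets borel" "bounded B"
  shows "(\<integral>\<^sup>+\<omega>. \<phi> (card (Y \<omega> \<inter> B)) \<partial>M) =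
    (\<Sum>n. \<phi> n * ennreal (exp (- (l * measure lborel B)) * (l * measure lborel B) ^ n / fact n))"
  using poisson assms
  by (subst nn_integral_nat_valued[OF count_measurable]) (auto simp: poisson_process_def emeasure_eq_measure)

lemma nn_integral_prod_counts:
  fixes B :: "nat \<Rightarrow> plane set"
  assumes B: "\<And>k. B k \<in> sets borel" "\<And>k. bounded (B k)" "disjoint_family B"
  shows "(\<integral>\<^sup>+\<omega>. (\<Prod>k<n. \<phi> k (card (Y \<omega> \<inter> B k))) \<partial>M) = (\<Prod>k<n. \<integral>\<^sup>+\<omega>. \<phi> k (card (Y \<omega> \<inter> B k)) \<partial>M)"
proof (rule indep_vars_nn_integral)
  have "indep_vars (\<lambda>_. count_space UNIV) (\<lambda>k \<omega>. card (Y \<omega> \<inter> B k)) UNIV"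
    using poisson B by (simp add: poisson_process_def)
  then have "indep_vars (\<lambda>_. count_space UNIV) (\<lambda>k \<omega>. card (Y \<omega> \<inter> B k)) {..<n}"
    by (rule indep_vars_subset) simp
  then show "indep_vars (\<lambda>_. borel) (\<lambda>k \<omega>. \<phi> k (card (Y \<omega> \<inter> B k))) {..<n}"
    by (rule indep_vars_compose2) simp
qed auto

text \<open>Index 0 is reserved for the set whose count enters through \<open>h\<close>, and the
  step function \<open>w\<close> lives on the others. Independence of the counts factorises the
  expectation, and each factor is a Poisson generating function.\<close>

lemma laplace_finite:
  fixes B :: "nat \<Rightarrow> plane set" and a :: "nat \<Rightarrow> ennreal"
  assumes B: "\<And>k. B k \<in> sets borel" "\<And>k. bounded (B k)" "disjoint_family B"
    and w: "\<And>x. w x = (\<Sum>k\<in>{1..<n}. a k * indicator (B k) x)" and n: "0 < n"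
  shows "(\<integral>\<^sup>+\<omega>. h (card (Y \<omega> \<inter> B 0)) * nexp (\<integral>\<^sup>+x. w x \<partial>count_space (Y \<omega>)) \<partial>M) =
    (\<integral>\<^sup>+\<omega>. h (card (Y \<omega> \<inter> B 0)) \<partial>M) * nexp (ennreal l * (\<integral>\<^sup>+x. 1 - nexp (w x) \<partial>lborel))"
proof -
  have split: "{..<n} = insert 0 {1..<n}" using n by auto
  define \<phi> where "\<phi> k m = (if k = 0 then h m else nexp (a k) ^ m)" for k m
  have "(\<integral>\<^sup>+\<omega>. h (card (Y \<omega> \<inter> B 0)) * nexp (\<integral>\<^sup>+x. w x \<partial>count_space (Y \<omega>)) \<partial>M) =
      (\<integral>\<^sup>+\<omega>. (\<Prod>k<n. \<phi> k (card (Y \<omega> \<inter> B k))) \<partial>M)"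
  proof (rule nn_integral_cong)
    fix \<omega> assume \<omega>: "\<omega> \<in> space M"
    have "(\<integral>\<^sup>+x. w x \<partial>count_space (Y \<omega>)) = (\<Sum>k\<in>{1..<n}. of_nat (card (Y \<omega> \<inter> B k)) * a k)"
      unfolding w using finite_Y[OF \<omega> B(2)]
      by (subst nn_integral_sum) (auto simp: nn_integral_cmult count_integral_indicator mult.commute)
    then have "nexp (\<integral>\<^sup>+x. w x \<partial>count_space (Y \<omega>)) = (\<Prod>k\<in>{1..<n}. nexp (a k) ^ card (Y \<omega> \<inter> B k))"
      by (simp add: nexp_sum nexp_of_nat_mult)
    then show "h (card (Y \<omega> \<inter> B 0)) * nexp (\<integral>\<^sup>+x. w x \<partial>count_space (Y \<omega>)) = (\<Prod>k<n. \<phi> k (card (Y \<omega> \<inter> B k)))"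
      unfolding split by (simp add: \<phi>_def)
  qed
  also have "\<dots> = (\<Prod>k<n. \<integral>\<^sup>+\<omega>. \<phi> k (card (Y \<omega> \<inter> B k)) \<partial>M)"
    by (rule nn_integral_prod_counts[OF B])
  also have "\<dots> = (\<integral>\<^sup>+\<omega>. h (card (Y \<omega> \<inter> B 0)) \<partial>M) * (\<Prod>k\<in>{1..<n}. \<integral>\<^sup>+\<omega>. nexp (a k) ^ card (Y \<omega> \<inter> B k) \<partial>M)"
    unfolding split by (simp add: \<phi>_def)
  also have "(\<Prod>k\<in>{1..<n}. \<integral>\<^sup>+\<omega>. nexp (a k) ^ card (Y \<omega> \<inter> B k) \<partial>M) =
      (\<Prod>k\<in>{1..<n}. nexp (ennreal l * (emeasure lborel (B k) * (1 - nexp (a k)))))"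
  proof (rule prod.cong[OF refl])
    fix k
    have fin: "emeasure lborel (B k) < \<infinity>" using B(2) by (rule emeasure_bounded_finite)
    show "(\<integral>\<^sup>+\<omega>. nexp (a k) ^ card (Y \<omega> \<inter> B k) \<partial>M) = nexp (ennreal l * (emeasure lborel (B k) * (1 - nexp (a k))))"
      using rate_nonneg fin
      by (subst nn_integral_count[OF B(1,2)], subst suminf_poisson_power)
        (auto simp: ennreal_mult emeasure_eq_ennreal_measure mult.assoc)
  qed
  also have "\<dots> = nexp (ennreal l * (\<Sum>k\<in>{1..<n}. emeasure lborel (B k) * (1 - nexp (a k))))"
    by (simp add: nexp_sum sum_distrib_left)
  also have "(\<Sum>k\<in>{1..<n}. emeasure lborel (B k) * (1 - nexp (a k))) = (\<integral>\<^sup>+x. (\<Sum>k\<in>{1..<n}. (1 - nexp (a k)) * indicator (B k) x) \<partial>lborel)"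
    using B(1) by (subst nn_integral_sum) (auto simp: nn_integral_cmult mult.commute[of "emeasure _ _"])
  also have "\<dots> = (\<integral>\<^sup>+x. 1 - nexp (w x) \<partial>lborel)"
  proof (rule nn_integral_cong)
    \<comment> \<open>At most one of the disjoint sets contains \<open>x\<close>, so
      \<open>1 - nexp\<close> may be applied to the sum term by term.\<close>
    fix x
    show "(\<Sum>k\<in>{1..<n}. (1 - nexp (a k)) * indicator (B k) x) = 1 - nexp (w x)"
    proof (cases "\<exists>k\<in>{1..<n}. x \<in> B k")
      case True
      then obtain k where k: "k \<in> {1..<n}" "x \<in> B k" by auto
      then have "indicator (B j) x = (if j = k then 1 else 0 :: ennreal)" for j
        using B(3) by (auto simp: disjoint_family_on_def split: split_indicator)
      then show ?thesis
        using k unfolding w by (simp add: if_distrib[of "times _"] cong: if_cong)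
    next
      case False
      then have "indicator (B j) x = (0 :: ennreal)" if "j \<in> {1..<n}" for j
        using that by auto
      then show ?thesis unfolding w by simp
    qed
  qed
  finally show ?thesis .
qed

lemma laplace_simple:
  assumes w: "simple_function lborel w" and R: "\<And>x. x \<notin> cball 0 R \<Longrightarrow> w x = 0"
    and Q: "Q \<in> sets borel" "bounded Q" "\<And>x. x \<in> Q \<Longrightarrow> w x = 0"
  shows "(\<integral>\<^sup>+\<omega>. h (card (Y \<omega> \<inter> Q)) * nexp (\<integral>\<^sup>+x. w x \<partial>count_space (Y \<omega>)) \<partial>M) =
    (\<integral>\<^sup>+\<omega>. h (card (Y \<omega> \<inter> Q)) \<partial>M) * nexp (ennreal l * (\<integral>\<^sup>+x. 1 - nexp (w x) \<partial>lborel))"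
proof -
  define S where "S = range w - {0}"
  have "finite S" using w by (simp add: simple_function_def S_def)
  then obtain e where e: "bij_betw e {0..<card S} S"
    using ex_bij_betw_nat_finite by blast
  \<comment> \<open>The nonzero level sets of \<open>w\<close> are shifted by one to leave index 0
    to \<open>Q\<close>, and the family is padded with empty sets because independence is formulated
    for infinite sequences. Only nonzero values are listed, which makes the level sets bounded and
    disjoint from \<open>Q\<close>.\<close>
  define B where "B k = (if k = 0 then Q else if k \<le> card S then w -` {e (k - 1)} else {})" for k
  have eS: "e (k - 1) \<in> S" if "k \<noteq> 0" "k \<le> card S" for k
    using bij_betw_apply[OF e, of "k - 1"] that by auto
  have "(\<integral>\<^sup>+\<omega>. h (card (Y \<omega> \<inter> B 0)) * nexp (\<integral>\<^sup>+x. w x \<partial>count_space (Y \<omega>)) \<partial>M) =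
    (\<integral>\<^sup>+\<omega>. h (card (Y \<omega> \<inter> B 0)) \<partial>M) * nexp (ennreal l * (\<integral>\<^sup>+x. 1 - nexp (w x) \<partial>lborel))"
  proof (rule laplace_finite[where n = "Suc (card S)" and a = "\<lambda>k. e (k - 1)"])
    have "w -` {a} \<in> sets borel" for a
      using measurable_sets[OF borel_measurable_simple_function[OF w], of "{a}"] by simp
    then show "B k \<in> sets borel" for k
      using Q(1) by (simp add: B_def)
    show "bounded (B k)" for k
    proof -
      have "w -` {e (k - 1)} \<subseteq> cball 0 R" if "k \<noteq> 0" "k \<le> card S"
        using eS[OF that] R by (force simp: S_def)
      then show ?thesis
        using Q(2) bounded_subset[OF bounded_cball] by (auto simp: B_def)
    qed
    show "disjoint_family B"
    proof -
      have "B i \<inter> B j = {}" if "i < j" for i j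
      proof (cases "i = 0")
        case True
        then show ?thesis using Q(3) eS[of j] that by (auto simp: B_def S_def)
      next
        case False
        have "e (i - 1) \<noteq> e (j - 1)" if "j \<le> card S"
        proof
          assume "e (i - 1) = e (j - 1)"
          moreover have "i - 1 \<in> {0..<card S}" "j - 1 \<in> {0..<card S}"
            using that \<open>i < j\<close> False by auto
          ultimately have "i - 1 = j - 1"
            using bij_betw_imp_inj_on[OF e, THEN inj_onD] by blast
          then show False using \<open>i < j\<close> False by linarith
        qed
        then show ?thesis using False that by (auto simp: B_def)
      qed
      then show ?thesis
        unfolding disjoint_family_on_def by (metis Int_commute linorder_neqE_nat)
    qed
    show "w x = (\<Sum>k\<in>{1..<Suc (card S)}. e (k - 1) * indicator (B k) x)" for x
    proof (cases "w x = 0")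
      case True
      then have "e (k - 1) * indicator (B k) x = 0" if "k \<in> {1..<Suc (card S)}" for k
        using eS[of k] that by (auto simp: B_def S_def split: split_indicator)
      then show ?thesis using True by (metis (no_types, lifting) sum.neutral)
    next
      case False
      then obtain j where j: "j < card S" "e j = w x"
        using bij_betw_imp_surj_on[OF e] by (auto simp: S_def image_iff set_eq_iff) (metis atLeast0LessThan lessThan_iff rangeI)
      have "e (k - 1) * indicator (B k) x = (if k = Suc j then w x else 0)" if "k \<in> {1..<Suc (card S)}" for k
      proof (cases "k = Suc j")
        case True
        then show ?thesis using j by (simp add: B_def)
      next
        case False
        have "e (k - 1) \<noteq> e j"
        proof
          assume "e (k - 1) = e j"
          moreover have "k - 1 < card S" using that by auto
          ultimately have "k - 1 = j"
            using bij_betw_imp_inj_on[OF e, THEN inj_onD, of "k - 1" j] j(1) by simp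
          then show False using False that by auto
        qed
        then show ?thesis using False that j(2) by (simp add: B_def)
      qed
      then show ?thesis using j by simp
    qed
  qed simp
  then show ?thesis by (simp add: B_def)
qed

text \<open>The factor \<open>h\<close> records that the count in \<open>Q\<close> is independent of the points outside \<open>Q\<close>.\<close>

lemma laplace_functional:
  assumes w: "w \<in> borel_measurable borel"
    and Q: "Q \<in> sets borel" "bounded Q" "\<And>x. x \<in> Q \<Longrightarrow> w x = 0" and h: "\<And>n. h n \<le> 1"
  shows "(\<integral>\<^sup>+\<omega>. h (card (Y \<omega> \<inter> Q)) * nexp (\<integral>\<^sup>+x. w x \<partial>count_space (Y \<omega>)) \<partial>M) =
    (\<integral>\<^sup>+\<omega>. h (card (Y \<omega> \<inter> Q)) \<partial>M) * nexp (ennreal l * (\<integral>\<^sup>+x. 1 - nexp (w x) \<partial>lborel))"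
proof -
  have w': "w \<in> borel_measurable lborel" using w by simp
  obtain F where "incseq F \<and> (\<forall>i. (\<forall>x. F i x < \<top>) \<and> simple_function lborel (F i)) \<and> w = (SUP i. F i)"
    using borel_measurable_implies_simple_function_sequence[OF w'] by (rule exE)
  then have F: "simple_function lborel (F i)" "incseq F" and F_SUP: "(SUP i. F i x) = w x" for i x
    by (simp_all add: SUP_apply[symmetric])
  \<comment> \<open>The cut-off to balls makes the nonzero level sets bounded.\<close>
  define W where "W n x = F n x * indicator (cball 0 (real n)) x" for n x
  have simple: "simple_function lborel (W n)" for n
    unfolding W_def by (intro simple_function_mult F simple_function_indicator) auto
  then have [measurable]: "W n \<in> borel_measurable borel" for n
    using borel_measurable_simple_function[of lborel "W n"] by simp
  note [measurable] = w
  have inc: "incseq W"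
    using F(2) by (auto simp: incseq_def le_fun_def W_def intro!: mult_mono split: split_indicator)
  have lim: "(\<lambda>n. W n x) \<longlonglongrightarrow> w x" for x
  proof -
    have "(\<lambda>n. F n x) \<longlonglongrightarrow> w x"
      unfolding F_SUP[symmetric] using F(2) by (intro LIMSEQ_SUP) (auto simp: incseq_def le_fun_def)
    moreover have "\<forall>\<^sub>F n in sequentially. F n x = W n x"
    proof -
      obtain m where "norm x \<le> real m" using real_arch_simple by blast
      then have "F n x = W n x" if "m \<le> n" for n using that by (simp add: W_def)
      then show ?thesis by (auto simp: eventually_sequentially)
    qed
    ultimately show ?thesis by (rule Lim_transform_eventually)
  qed
  have le: "W n x \<le> w x" for n x
    using F_SUP[of x] SUP_upper[of n UNIV "\<lambda>i. F i x"] by (auto simp: W_def split: split_indicator)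
  have count_meas [measurable]: "(\<lambda>\<omega>. card (Y \<omega> \<inter> Q)) \<in> measurable M (count_space UNIV)"
    by (rule count_measurable[OF Q(1,2)])
  have h_meas [measurable]: "(\<lambda>\<omega>. h (card (Y \<omega> \<inter> Q))) \<in> borel_measurable M"
    by (rule measurable_compose[OF count_meas]) simp
  have h_fin: "(\<integral>\<^sup>+\<omega>. h (card (Y \<omega> \<inter> Q)) \<partial>M) \<le> 1"
    using nn_integral_mono[of M "\<lambda>\<omega>. h (card (Y \<omega> \<inter> Q))" "\<lambda>_. 1"] h by (simp add: emeasure_space_1)
  note [measurable] = count_integral_const_measurable[OF Y_measurable]
  \<comment> \<open>As \<open>W n\<close> increases, these integrands decrease, so the passage to
    the limit uses domination by 1 on a probability space. On the Lebesgue side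
    \<open>1 - nexp\<close> increases and monotone convergence applies.\<close>
  have "(\<lambda>n. \<integral>\<^sup>+\<omega>. h (card (Y \<omega> \<inter> Q)) * nexp (\<integral>\<^sup>+x. W n x \<partial>count_space (Y \<omega>)) \<partial>M) \<longlonglongrightarrow>
      (\<integral>\<^sup>+\<omega>. h (card (Y \<omega> \<inter> Q)) * nexp (\<integral>\<^sup>+x. w x \<partial>count_space (Y \<omega>)) \<partial>M)"
  proof (rule nn_integral_dominated_convergence[where w = "\<lambda>_. 1"])
    show "AE \<omega> in M. h (card (Y \<omega> \<inter> Q)) * nexp (\<integral>\<^sup>+x. W j x \<partial>count_space (Y \<omega>)) \<le> 1" for j
      using mult_mono[OF h nexp_le_1] by auto
    have "(\<lambda>n. \<integral>\<^sup>+x. W n x \<partial>count_space (Y \<omega>)) \<longlonglongrightarrow> (\<integral>\<^sup>+x. w x \<partial>count_space (Y \<omega>))" for \<omega>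
      by (rule nn_integral_LIMSEQ[OF inc _ lim]) simp
    moreover have "h k < \<top>" for k using h[of k] by (simp add: le_less_trans)
    ultimately show "AE \<omega> in M. (\<lambda>n. h (card (Y \<omega> \<inter> Q)) * nexp (\<integral>\<^sup>+x. W n x \<partial>count_space (Y \<omega>))) \<longlonglongrightarrow>
        h (card (Y \<omega> \<inter> Q)) * nexp (\<integral>\<^sup>+x. w x \<partial>count_space (Y \<omega>))"
      by (intro AE_I2 ennreal_tendsto_cmult nexp_tendsto)
  qed (auto simp: emeasure_space_1)
  moreover have "(\<lambda>n. (\<integral>\<^sup>+\<omega>. h (card (Y \<omega> \<inter> Q)) \<partial>M) * nexp (ennreal l * (\<integral>\<^sup>+x. 1 - nexp (W n x) \<partial>lborel))) \<longlonglongrightarrow>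
      (\<integral>\<^sup>+\<omega>. h (card (Y \<omega> \<inter> Q)) \<partial>M) * nexp (ennreal l * (\<integral>\<^sup>+x. 1 - nexp (w x) \<partial>lborel))"
  proof (intro ennreal_tendsto_cmult nexp_tendsto)
    show "(\<lambda>n. \<integral>\<^sup>+x. 1 - nexp (W n x) \<partial>lborel) \<longlonglongrightarrow> (\<integral>\<^sup>+x. 1 - nexp (w x) \<partial>lborel)"
    proof (rule nn_integral_LIMSEQ)
      show "incseq (\<lambda>n x. 1 - nexp (W n x))"
        using inc by (auto simp: incseq_def le_fun_def intro!: ennreal_mono_minus nexp_antimono)
      show "(\<lambda>n. 1 - nexp (W n x)) \<longlonglongrightarrow> 1 - nexp (w x)" for x
        by (rule tendsto_diff_ennreal_general[OF tendsto_const nexp_tendsto[OF lim]]) simp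
    qed measurable
  qed (use h_fin in \<open>auto simp: le_less_trans\<close>)
  moreover have "(\<integral>\<^sup>+\<omega>. h (card (Y \<omega> \<inter> Q)) * nexp (\<integral>\<^sup>+x. W n x \<partial>count_space (Y \<omega>)) \<partial>M) =
      (\<integral>\<^sup>+\<omega>. h (card (Y \<omega> \<inter> Q)) \<partial>M) * nexp (ennreal l * (\<integral>\<^sup>+x. 1 - nexp (W n x) \<partial>lborel))" for n
  proof (rule laplace_simple[OF simple _ Q(1,2), of "real n"])
    show "W n x = 0" if "x \<notin> cball 0 (real n)" for x
      using that by (simp add: W_def)
    show "W n x = 0" if "x \<in> Q" for x
      using le[of n x] Q(3)[OF that] by simp
  qed
  ultimately show ?thesis
    using LIMSEQ_unique by simp
qed

lemma laplace:
  assumes "w \<in> borel_measurable borel"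
  shows "(\<integral>\<^sup>+\<omega>. nexp (\<integral>\<^sup>+x. w x \<partial>count_space (Y \<omega>)) \<partial>M) = nexp (ennreal l * (\<integral>\<^sup>+x. 1 - nexp (w x) \<partial>lborel))"
  using laplace_functional[OF assms, of "{}" "\<lambda>_. 1"] by (simp add: emeasure_space_1)

section \<open>First moments and the Mecke inequality\<close>

lemma nn_integral_count_mean:
  assumes "B \<in> sets borel" "bounded B"
  shows "(\<integral>\<^sup>+\<omega>. of_nat (card (Y \<omega> \<inter> B)) \<partial>M) = ennreal l * emeasure lborel B"
  using rate_nonneg emeasure_bounded_finite[OF assms(2)]
  by (subst nn_integral_count[OF assms], subst suminf_poisson_mean)
    (auto simp: ennreal_mult emeasure_eq_ennreal_measure)

text \<open>The induction starts from mean counts. These are exhausted over balls since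
  \<open>card\<close> of an infinite set is 0 and says nothing about unbounded sets.\<close>

lemma campbell:
  assumes "w \<in> borel_measurable borel"
  shows "(\<integral>\<^sup>+\<omega>. \<integral>\<^sup>+x. w x \<partial>count_space (Y \<omega>) \<partial>M) = ennreal l * (\<integral>\<^sup>+x. w x \<partial>lborel)"
  using assms
proof (induction rule: borel_measurable_induct)
  note [measurable] = count_integral_const_measurable[OF Y_measurable]
  {
    case (cong f g)
    then show ?case by (simp cong: nn_integral_cong)
  next
    case (set B)
    have "(\<integral>\<^sup>+\<omega>. \<integral>\<^sup>+x. indicator B x \<partial>count_space (Y \<omega>) \<partial>M) =
        (\<integral>\<^sup>+\<omega>. (SUP n. \<integral>\<^sup>+x. indicator B x * indicator (cball 0 (real n)) x \<partial>count_space (Y \<omega>)) \<partial>M)"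
      by (intro nn_integral_cong nn_integral_cball_SUP) auto
    also have "\<dots> = (SUP n. \<integral>\<^sup>+\<omega>. \<integral>\<^sup>+x. indicator B x * indicator (cball 0 (real n)) x \<partial>count_space (Y \<omega>) \<partial>M)"
      using set by (intro nn_integral_monotone_convergence_SUP)
        (auto simp: incseq_def le_fun_def intro!: nn_integral_mono count_integral_const_measurable Y_measurable
          borel_measurable_times_ennreal borel_measurable_indicator split: split_indicator)
    also have "\<dots> = (SUP n. ennreal l * (\<integral>\<^sup>+x. indicator B x * indicator (cball 0 (real n)) x \<partial>lborel))"
    proof (rule SUP_cong[OF refl])
      fix n
      have bd: "bounded (B \<inter> cball 0 (real n))" by (rule bounded_Int) auto
      have "(\<integral>\<^sup>+\<omega>. \<integral>\<^sup>+x. indicator B x * indicator (cball 0 (real n)) x \<partial>count_space (Y \<omega>) \<partial>M) =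
          (\<integral>\<^sup>+\<omega>. of_nat (card (Y \<omega> \<inter> (B \<inter> cball 0 (real n)))) \<partial>M)"
        by (intro nn_integral_cong) (simp add: count_integral_indicator finite_Y[OF _ bd] flip: indicator_inter_arith)
      also have "\<dots> = ennreal l * emeasure lborel (B \<inter> cball 0 (real n))"
        using set by (intro nn_integral_count_mean bd) auto
      finally show "(\<integral>\<^sup>+\<omega>. \<integral>\<^sup>+x. indicator B x * indicator (cball 0 (real n)) x \<partial>count_space (Y \<omega>) \<partial>M) =
        ennreal l * (\<integral>\<^sup>+x. indicator B x * indicator (cball 0 (real n)) x \<partial>lborel)"
        using set by (simp flip: indicator_inter_arith)
    qed
    also have "\<dots> = ennreal l * (\<integral>\<^sup>+x. indicator B x \<partial>lborel)"
      using set by (subst nn_integral_cball_SUP[of "indicator B"]) (auto simp: SUP_mult_left_ennreal)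
    finally show ?case .
  next
    case (mult u c)
    then show ?case by (simp add: nn_integral_cmult mult.left_commute)
  next
    case (add u v)
    then show ?case by (simp add: nn_integral_add distrib_left)
  next
    case (seq U)
    have "(\<integral>\<^sup>+x. (SUP i. U i) x \<partial>count_space (Y \<omega>)) = (SUP i. \<integral>\<^sup>+x. U i x \<partial>count_space (Y \<omega>))" for \<omega>
      using seq(3) unfolding SUP_apply by (subst nn_integral_monotone_convergence_SUP) (auto simp: incseq_def le_fun_def)
    moreover have "(\<integral>\<^sup>+x. (SUP i. U i) x \<partial>lborel) = (SUP i. \<integral>\<^sup>+x. U i x \<partial>lborel)"
      using seq(1,3) unfolding SUP_apply by (subst nn_integral_monotone_convergence_SUP) auto
    moreover have "(\<integral>\<^sup>+\<omega>. (SUP i. \<integral>\<^sup>+x. U i x \<partial>count_space (Y \<omega>)) \<partial>M) = (SUP i. \<integral>\<^sup>+\<omega>. \<integral>\<^sup>+x. U i x \<partial>count_space (Y \<omega>) \<partial>M)"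
      using seq(1,3) by (intro nn_integral_monotone_convergence_SUP) (auto simp: incseq_def le_fun_def intro!: nn_integral_mono count_integral_const_measurable Y_measurable)
    ultimately show ?case
      by (simp add: seq.IH SUP_mult_left_ennreal)
  }
qed

text \<open>One half of the Mecke formula, obtained by differentiating the Laplace functional in the
  direction \<open>\<psi> = \<phi> e\<^sup>w\<close>.\<close>

lemma mecke_le:
  assumes [measurable]: "w \<in> borel_measurable borel" "\<phi> \<in> borel_measurable borel" and fin: "\<And>x. w x < \<top>"
  shows "(\<integral>\<^sup>+\<omega>. \<integral>\<^sup>+x. \<phi> x * nexp (\<integral>\<^sup>+y. w y \<partial>count_space (Y \<omega> - {x})) \<partial>count_space (Y \<omega>) \<partial>M) \<le>
    ennreal l * (\<integral>\<^sup>+x. \<phi> x \<partial>lborel) * nexp (ennreal l * (\<integral>\<^sup>+x. 1 - nexp (w x) \<partial>lborel))"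
proof -
  \<comment> \<open>The full sum over the configuration also contains the term of the point
    \<open>x\<close> itself. The factor \<open>inverse (nexp (w x))\<close> compensates for it, and
    finiteness of \<open>w\<close> makes it a true inverse.\<close>
  define \<psi> where "\<psi> x = \<phi> x * inverse (nexp (w x))" for x
  have [measurable]: "\<psi> \<in> borel_measurable borel" unfolding \<psi>_def by measurable
  have \<psi>: "nexp (w x) * \<psi> x = \<phi> x" for x
  proof -
    have "nexp (w x) = ennreal (exp (- enn2real (w x)))"
      using fin[of x] by (simp add: nexp_def)
    then have "inverse (nexp (w x)) * nexp (w x) = 1"
      by (simp add: inverse_ennreal ennreal_mult[symmetric])
    then show ?thesis by (simp add: \<psi>_def ac_simps)
  qed
  define S where "S \<omega> = (\<integral>\<^sup>+x. w x \<partial>count_space (Y \<omega>))" for \<omega>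
  define P where "P \<omega> = (\<integral>\<^sup>+x. \<psi> x \<partial>count_space (Y \<omega>))" for \<omega>
  have [measurable]: "S \<in> borel_measurable M" "P \<in> borel_measurable M"
    unfolding S_def[abs_def] P_def[abs_def] by (auto intro!: count_integral_const_measurable Y_measurable)
  define L where "L w = nexp (ennreal l * (\<integral>\<^sup>+x. 1 - nexp (w x) \<partial>lborel))" for w :: "plane \<Rightarrow> ennreal"
  let ?C = "L w * (ennreal l * (\<integral>\<^sup>+x. \<phi> x \<partial>lborel))"
  \<comment> \<open>The difference quotient of t |-> E nexp (S + t P) at 0 with t = 1 / (n + 1).
    Applying \<open>1 - nexp x \<le> x\<close> once in the exponent and once outside gives a bound
    free of n.\<close>
  have bound: "(\<integral>\<^sup>+\<omega>. nexp (S \<omega>) * (of_nat (Suc n) * (1 - nexp (P \<omega> / of_nat (Suc n)))) \<partial>M) \<le> ?C" for n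
  proof -
    define N :: ennreal where "N = of_nat (Suc n)"
    have N: "N * (x / N) = x" for x
      by (simp add: N_def ennreal_times_divide ennreal_mult_divide_eq mult.commute[of _ x] del: of_nat_Suc)
    have sum: "(\<integral>\<^sup>+x. w x + \<psi> x / N \<partial>count_space (Y \<omega>)) = S \<omega> + P \<omega> / N" for \<omega>
      unfolding S_def P_def by (simp add: nn_integral_add nn_integral_divide)
    define b where "b = (\<integral>\<^sup>+x. nexp (w x) * (1 - nexp (\<psi> x / N)) \<partial>lborel)"
    \<comment> \<open>Since 1 - a b = (1 - a) + a (1 - b), the Laplace exponent of the perturbed
      weight is that of \<open>w\<close> plus the increment \<open>b\<close>.\<close>
    have split: "L (\<lambda>x. w x + \<psi> x / N) = L w * nexp (ennreal l * b)"
      unfolding L_def b_def nexp_add[symmetric] distrib_left[symmetric]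
      by (subst nn_integral_add[symmetric]) (auto simp: one_minus_mult_ennreal nexp_add)
    have b: "N * b \<le> (\<integral>\<^sup>+x. \<phi> x \<partial>lborel)"
    proof -
      have "N * b = (\<integral>\<^sup>+x. N * (nexp (w x) * (1 - nexp (\<psi> x / N))) \<partial>lborel)"
        unfolding b_def by (simp add: nn_integral_cmult)
      also have "\<dots> \<le> (\<integral>\<^sup>+x. N * (nexp (w x) * (\<psi> x / N)) \<partial>lborel)"
        by (intro nn_integral_mono mult_left_mono one_minus_nexp_le) auto
      also have "\<dots> = (\<integral>\<^sup>+x. \<phi> x \<partial>lborel)"
        by (intro nn_integral_cong) (metis N \<psi> mult.left_commute)
      finally show ?thesis .
    qed
    have "(\<integral>\<^sup>+\<omega>. nexp (S \<omega>) * (N * (1 - nexp (P \<omega> / N))) \<partial>M) =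
        (\<integral>\<^sup>+\<omega>. N * (nexp (S \<omega>) - nexp (S \<omega> + P \<omega> / N)) \<partial>M)"
      by (intro nn_integral_cong) (simp add: nexp_add ennreal_right_diff_distrib mult.left_commute)
    also have "\<dots> = N * (\<integral>\<^sup>+\<omega>. nexp (S \<omega>) - nexp (S \<omega> + P \<omega> / N) \<partial>M)"
      by (rule nn_integral_cmult) measurable
    also have "(\<integral>\<^sup>+\<omega>. nexp (S \<omega>) - nexp (S \<omega> + P \<omega> / N) \<partial>M) =
        (\<integral>\<^sup>+\<omega>. nexp (S \<omega>) \<partial>M) - (\<integral>\<^sup>+\<omega>. nexp (S \<omega> + P \<omega> / N) \<partial>M)"
    proof (rule nn_integral_diff)
      have "(\<integral>\<^sup>+\<omega>. nexp (S \<omega> + P \<omega> / N) \<partial>M) \<le> (\<integral>\<^sup>+\<omega>. 1 \<partial>M)"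
        by (intro nn_integral_mono) auto
      then show "(\<integral>\<^sup>+\<omega>. nexp (S \<omega> + P \<omega> / N) \<partial>M) \<noteq> \<infinity>"
        by (auto simp: emeasure_space_1 top_unique)
    qed (auto intro!: nexp_antimono)
    also have "\<dots> = L w - L w * nexp (ennreal l * b)"
    proof -
      have "(\<integral>\<^sup>+\<omega>. nexp (S \<omega>) \<partial>M) = L w"
        unfolding L_def S_def by (rule laplace) simp
      moreover have "(\<integral>\<^sup>+\<omega>. nexp (S \<omega> + P \<omega> / N) \<partial>M) = L (\<lambda>x. w x + \<psi> x / N)"
        unfolding L_def sum[symmetric] by (rule laplace) simp
      ultimately show ?thesis by (simp add: split)
    qed
    also have "N * (L w - L w * nexp (ennreal l * b)) = N * (L w * (1 - nexp (ennreal l * b)))"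
      by (subst ennreal_right_diff_distrib) (auto simp: L_def)
    also have "\<dots> \<le> N * (L w * (ennreal l * b))"
      by (intro mult_left_mono one_minus_nexp_le) auto
    also have "\<dots> = L w * (ennreal l * (N * b))"
      by (simp add: ac_simps)
    also have "\<dots> \<le> ?C"
      by (intro mult_left_mono b) auto
    finally show ?thesis by (simp add: N_def)
  qed
  have "(\<integral>\<^sup>+\<omega>. \<integral>\<^sup>+x. \<phi> x * nexp (\<integral>\<^sup>+y. w y \<partial>count_space (Y \<omega> - {x})) \<partial>count_space (Y \<omega>) \<partial>M) =
      (\<integral>\<^sup>+\<omega>. nexp (S \<omega>) * P \<omega> \<partial>M)"
  proof (rule nn_integral_cong)
    fix \<omega>
    have "(\<integral>\<^sup>+x. \<phi> x * nexp (\<integral>\<^sup>+y. w y \<partial>count_space (Y \<omega> - {x})) \<partial>count_space (Y \<omega>)) =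
        (\<integral>\<^sup>+x. nexp (S \<omega>) * \<psi> x \<partial>count_space (Y \<omega>))"
    proof (rule nn_integral_cong)
      fix x assume "x \<in> space (count_space (Y \<omega>))"
      then have "S \<omega> = w x + (\<integral>\<^sup>+y. w y \<partial>count_space (Y \<omega> - {x}))"
        unfolding S_def by (intro count_integral_remove) simp
      then show "\<phi> x * nexp (\<integral>\<^sup>+y. w y \<partial>count_space (Y \<omega> - {x})) = nexp (S \<omega>) * \<psi> x"
        by (simp add: nexp_add \<psi>[symmetric] ac_simps)
    qed
    then show "(\<integral>\<^sup>+x. \<phi> x * nexp (\<integral>\<^sup>+y. w y \<partial>count_space (Y \<omega> - {x})) \<partial>count_space (Y \<omega>)) = nexp (S \<omega>) * P \<omega>"
      by (simp add: nn_integral_cmult P_def)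
  qed
  also have "\<dots> = (\<integral>\<^sup>+\<omega>. liminf (\<lambda>n. nexp (S \<omega>) * (of_nat (Suc n) * (1 - nexp (P \<omega> / of_nat (Suc n))))) \<partial>M)"
  proof (rule nn_integral_cong)
    fix \<omega>
    have "(\<lambda>n. nexp (S \<omega>) * (of_nat (Suc n) * (1 - nexp (P \<omega> / of_nat (Suc n))))) \<longlonglongrightarrow> nexp (S \<omega>) * P \<omega>"
      by (intro ennreal_tendsto_cmult nexp_difference_quotient_tendsto) simp
    then show "nexp (S \<omega>) * P \<omega> = liminf (\<lambda>n. nexp (S \<omega>) * (of_nat (Suc n) * (1 - nexp (P \<omega> / of_nat (Suc n)))))"
      by (intro lim_imp_Liminf[symmetric]) auto
  qed
  \<comment> \<open>Fatou's lemma transfers the uniform bound to the derivative; this is why one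
    inequality comes without any integrability condition on \<open>\<phi>\<close>.\<close>
  also have "\<dots> \<le> liminf (\<lambda>n. \<integral>\<^sup>+\<omega>. nexp (S \<omega>) * (of_nat (Suc n) * (1 - nexp (P \<omega> / of_nat (Suc n)))) \<partial>M)"
    by (rule nn_integral_liminf) measurable
  also have "\<dots> \<le> liminf (\<lambda>n. ?C)"
    by (intro Liminf_mono always_eventually allI bound)
  finally show ?thesis
    by (simp add: Liminf_const L_def ac_simps)
qed

end

subsection \<open>Success probability under Rayleigh fading\<close>

lemma nn_integral_count_space_countable:
  assumes "countable A"
  shows "(\<integral>\<^sup>+x. f x \<partial>count_space A) = (\<Sum>n. f (from_nat_into A n) * indicator (to_nat_on A ` A) n)"
proof -
  have "(\<integral>\<^sup>+x. f x \<partial>count_space A) = (\<integral>\<^sup>+x. f (from_nat_into A (to_nat_on A x)) \<partial>count_space A)"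
    using assms by (intro nn_integral_cong) simp
  also have "\<dots> = (\<integral>\<^sup>+n. f (from_nat_into A n) \<partial>count_space (to_nat_on A ` A))"
    using inj_on_to_nat_on[OF assms]
    by (intro nn_integral_bij_count_space[of "to_nat_on A"]) (simp add: bij_betw_def)
  also have "\<dots> = (\<integral>\<^sup>+n. f (from_nat_into A n) * indicator (to_nat_on A ` A) n \<partial>count_space UNIV)"
    by (rule nn_integral_count_space_indicator) simp
  finally show ?thesis
    by (simp add: nn_integral_count_space_nat)
qed

lemma nn_integral_PiM_prod:
  assumes M: "\<And>i. i \<in> I \<Longrightarrow> prob_space (M i)" and J: "finite J" "J \<subseteq> I"
    and f: "\<And>i. i \<in> J \<Longrightarrow> f i \<in> borel_measurable (M i)"
  shows "(\<integral>\<^sup>+x. (\<Prod>i\<in>J. f i (x i)) \<partial>PiM I M) = (\<Prod>i\<in>J. \<integral>\<^sup>+x. f i x \<partial>M i)"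
proof -
  \<comment> \<open>Outside \<open>I\<close> a point mass is put in, because the locale for products
    asks for a probability space at every index.\<close>
  define M' where "M' i = (if i \<in> I then M i else return (count_space UNIV) undefined)" for i
  interpret product_prob_space M' I
    by (rule product_prob_spaceI) (auto simp: M'_def M prob_space_return)
  have eq: "PiM I M = PiM I M'" by (intro PiM_cong) (auto simp: M'_def)
  have M'J: "M' i = M i" if "i \<in> J" for i using that J(2) by (auto simp: M'_def)
  have meas: "(\<lambda>x. \<Prod>i\<in>J. f i (x i)) \<in> borel_measurable (PiM J M')"
    using f J(1) by (intro borel_measurable_prod_ennreal measurable_compose[OF measurable_component_singleton])
      (auto simp: M'J)
  have "(\<integral>\<^sup>+x. (\<Prod>i\<in>J. f i (x i)) \<partial>PiM I M) = (\<integral>\<^sup>+x. (\<Prod>i\<in>J. f i (restrict x J i)) \<partial>PiM I M')"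
    unfolding eq by (intro nn_integral_cong prod.cong) auto
  also have "\<dots> = (\<integral>\<^sup>+x. (\<Prod>i\<in>J. f i (x i)) \<partial>distr (PiM I M') (PiM J M') (\<lambda>x. restrict x J))"
    using meas J by (subst nn_integral_distr) (auto intro!: measurable_restrict_subset)
  also have "\<dots> = (\<integral>\<^sup>+x. (\<Prod>i\<in>J. f i (x i)) \<partial>PiM J M')"
    using J by (simp add: distr_PiM_restrict_finite)
  also have "\<dots> = (\<Prod>i\<in>J. \<integral>\<^sup>+x. f i x \<partial>M' i)"
    using f J(1) by (intro product_nn_integral_prod) (auto simp: M'J)
  finally show ?thesis by (simp add: M'J)
qed

text \<open>Redrawing one coordinate independently leaves a product law unchanged. The inner
  integral still runs over all coordinates, so the index set stays \<open>UNIV\<close>.\<close>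

lemma nn_integral_PiM_split:
  assumes M: "\<And>i. prob_space (M i)" and f[measurable]: "f \<in> borel_measurable (PiM UNIV M)"
  shows "(\<integral>\<^sup>+x. f x \<partial>PiM UNIV M) = (\<integral>\<^sup>+x. \<integral>\<^sup>+y. f (y(i := x)) \<partial>PiM UNIV M \<partial>M i)"
proof -
  interpret P: prob_space "PiM UNIV M" by (intro prob_space_PiM M)
  have [measurable]: "(\<lambda>(x, X). X(i := x)) \<in> measurable (M i \<Otimes>\<^sub>M PiM UNIV M) (PiM UNIV M)"
    using measurable_add_dim[of i UNIV M] measurable_pair_swap_iff by (simp add: measurable_fun_upd)
  have eq: "PiM UNIV M = distr (M i \<Otimes>\<^sub>M PiM UNIV M) (PiM UNIV M) (\<lambda>(x, X). X(i := x))"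
    using distr_pair_PiM_eq_PiM[of UNIV M i] M by simp
  have "(\<integral>\<^sup>+x. f x \<partial>PiM UNIV M) = (\<integral>\<^sup>+x. f x \<partial>distr (M i \<Otimes>\<^sub>M PiM UNIV M) (PiM UNIV M) (\<lambda>(x, X). X(i := x)))"
    by (rule arg_cong[OF eq])
  also have "\<dots> = (\<integral>\<^sup>+p. f ((snd p)(i := fst p)) \<partial>(M i \<Otimes>\<^sub>M PiM UNIV M))"
    by (subst nn_integral_distr) (auto simp: case_prod_beta)
  also have "\<dots> = (\<integral>\<^sup>+x. \<integral>\<^sup>+y. f (y(i := x)) \<partial>PiM UNIV M \<partial>M i)"
    by (subst P.nn_integral_fst[symmetric]) (auto simp: case_prod_beta)
  finally show ?thesis .
qed

lemma exponential_tail: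
  assumes "0 < \<mu>"
  shows "emeasure (density lborel (\<lambda>t. ennreal (exponential_density \<mu> t))) {t. s \<le> ennreal t} = nexp (ennreal \<mu> * s)"
proof -
  let ?E = "density lborel (\<lambda>t. ennreal (exponential_density \<mu> t))"
  interpret E: prob_space ?E by (rule prob_space_exponential_density[OF assms])
  show ?thesis
  proof (cases s)
    case (real a)
    \<comment> \<open>The case 0 is separate: \<open>ennreal\<close> sends negative numbers to 0, so
      the set is then the whole line.\<close>
    show ?thesis
    proof (cases "a = 0")
      case True
      then show ?thesis using real E.emeasure_space_1 by simp
    next
      case False
      then have "{t. s \<le> ennreal t} = {t. a \<le> t}"
        using real by (auto simp: ennreal_le_iff2)
      moreover have "emeasure ?E {t. a \<le> t} = emeasure ?E {t. a < t}"
      proof (rule emeasure_eq_AE)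
        have "AE t in lborel. t \<noteq> a" by (rule AE_lborel_singleton)
        then show "AE t in ?E. (t \<in> {t. a \<le> t}) = (t \<in> {t. a < t})"
          by (subst AE_density) auto
      qed auto
      moreover have "E.prob {t \<in> space ?E. a < t} = exp (- a * \<mu>)"
        using real assms by (intro E.exponential_distributedD_gt) (auto simp: distributed_def distr_id2)
      ultimately show ?thesis
        using real assms by (simp add: E.emeasure_eq_measure nexp_ennreal ennreal_mult[symmetric] mult.commute)
    qed
  next
    case top
    have "{t. s \<le> ennreal t} = {}" using top by (auto simp: top_unique)
    then show ?thesis using top assms by (simp add: ennreal_mult_top)
  qed
qed

text \<open>Tilting an exponential density by exp (- a t) gives a multiple of the density of rate
  \<mu> + a. The value is written as an \<open>nexp\<close> so that a product over interferers
  becomes a sum in the exponent.\<close>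

lemma exponential_laplace:
  assumes "0 < \<mu>" "0 \<le> a"
  shows "(\<integral>\<^sup>+t. nexp (ennreal a * ennreal t) \<partial>density lborel (\<lambda>t. ennreal (exponential_density \<mu> t))) =
    nexp (ennreal (ln (1 + a / \<mu>)))"
proof -
  have "(\<integral>\<^sup>+t. nexp (ennreal a * ennreal t) \<partial>density lborel (\<lambda>t. ennreal (exponential_density \<mu> t))) =
      (\<integral>\<^sup>+t. ennreal (exponential_density \<mu> t) * nexp (ennreal a * ennreal t) \<partial>lborel)"
    by (subst nn_integral_density) auto
  also have "\<dots> = (\<integral>\<^sup>+t. ennreal (\<mu> / (\<mu> + a)) * ennreal (exponential_density (\<mu> + a) t) \<partial>lborel)"
  proof (rule nn_integral_cong)
    fix t :: real
    show "ennreal (exponential_density \<mu> t) * nexp (ennreal a * ennreal t) =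
        ennreal (\<mu> / (\<mu> + a)) * ennreal (exponential_density (\<mu> + a) t)"
    proof (cases "t < 0")
      case False
      have "exp (- t * \<mu>) * exp (- (a * t)) = exp (- t * (\<mu> + a))"
        by (simp add: mult_exp_exp algebra_simps)
      then have "(\<mu> * exp (- t * \<mu>)) * exp (- (a * t)) = (\<mu> / (\<mu> + a)) * ((\<mu> + a) * exp (- t * (\<mu> + a)))"
        using assms by simp
      then show ?thesis
        using False assms by (simp add: exponential_density_def nexp_ennreal ennreal_mult[symmetric])
    qed (simp add: exponential_density_def)
  qed
  also have "\<dots> = ennreal (\<mu> / (\<mu> + a)) * (\<integral>\<^sup>+t. ennreal (exponential_density (\<mu> + a) t) \<partial>lborel)"
    by (rule nn_integral_cmult) simp
  also have "(\<integral>\<^sup>+t. ennreal (exponential_density (\<mu> + a) t) \<partial>lborel) = 1"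
    using prob_space.emeasure_space_1[OF prob_space_exponential_density[of "\<mu> + a"]] assms
    by (simp add: emeasure_density)
  also have "ennreal (\<mu> / (\<mu> + a)) * 1 = nexp (ennreal (ln (1 + a / \<mu>)))"
    using assms by (simp add: nexp_ennreal exp_minus divide_simps add_pos_nonneg)
  finally show ?thesis .
qed

text \<open>Minus the logarithm of the factor by which an interferer at \<open>x\<close> lowers the
  success probability; the rate \<mu> has cancelled between the desired link and the interferer. The
  \<open>max 0\<close> mirrors the truncation by \<open>ennreal\<close> in
  \<open>interference\<close>, as \<open>g 0\<close> may be negative.\<close>

definition fading_loss :: "(plane \<Rightarrow> real) \<Rightarrow> real \<Rightarrow> plane \<Rightarrow> plane \<Rightarrow> ennreal" where
  "fading_loss g T z x = ennreal (ln (1 + T * max 0 (g (x - z)) / g z))"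

text \<open>The conventions a / 0 = infinity and a / infinity = 0 agree with the product form, so an
  empty and an infinite interference need no separate treatment.\<close>

lemma ennreal_le_divide_iff:
  fixes a b t :: ennreal
  assumes "0 < t" "t < \<top>" "0 < a" "a < \<top>"
  shows "t \<le> a / b \<longleftrightarrow> t * b \<le> a"
proof (cases "b = 0 \<or> b = \<top>")
  case True
  then show ?thesis
    using assms by (auto simp: ennreal_mult_top top_unique split: if_splits)
next
  case False
  then obtain r where r: "b = ennreal r" "0 < r" by (cases b) (auto simp: less_le)
  obtain s where s: "a = ennreal s" "0 \<le> s" using assms by (cases a) auto
  obtain u where u: "t = ennreal u" "0 \<le> u" using assms by (cases t) auto
  show ?thesis
    unfolding r(1) s(1) u(1) using r s u
    by (simp add: divide_ennreal ennreal_mult[symmetric] pos_le_divide_eq)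
qed

text \<open>Given the interference, the tail of the desired fading is an exponential of it. Its
  expectation is the Laplace transform of a sum of independent terms, one per interferer.\<close>

lemma success_given_eq:
  assumes "0 < \<mu>" "0 < T" "0 < g z" "countable A"
  shows "success_given \<mu> g T z A = nexp (\<integral>\<^sup>+x. fading_loss g T z x \<partial>count_space A)"
proof -
  let ?E = "density lborel (\<lambda>t. ennreal (exponential_density \<mu> t))"
  interpret E: prob_space ?E by (rule prob_space_exponential_density[OF assms(1)])
  interpret F: prob_space "fading \<mu>" unfolding fading_def by (intro prob_space_PiM E.prob_space_axioms)
  define G where "G x = max 0 (g (x - z))" for x
  define B where "B = to_nat_on A ` A"
  define X where "X n = from_nat_into A n" for n
  have X_inj: "inj_on X B"
    using assms(4) by (auto simp: inj_on_def X_def B_def)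
  define I where "I h = (\<Sum>n. ennreal (h (Some (X n))) * ennreal (G (X n)) * indicator B n)" for h :: "plane option \<Rightarrow> real"
  have [measurable]: "(\<lambda>h. h k) \<in> measurable (fading \<mu>) borel" for k
    unfolding fading_def by (rule measurable_compose[OF measurable_component_singleton]) auto
  have I_meas[measurable]: "I \<in> borel_measurable (fading \<mu>)"
    unfolding I_def[abs_def] by measurable
  have space: "space (fading \<mu>) = UNIV"
    by (simp add: fading_def space_PiM)
  have interference: "interference g z h A = (\<Sum>n. ennreal (h (Some (X n)) * g (X n - z)) * indicator B n)" for h
    unfolding interference_def B_def X_def by (rule nn_integral_count_space_countable[OF assms(4)])
  have [measurable]: "(\<lambda>h. interference g z h A) \<in> borel_measurable (fading \<mu>)"
    unfolding interference by measurable
  have pos: "AE h in fading \<mu>. 0 < h k" for k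
  proof -
    have "AE t in lborel. t \<noteq> (0::real)" by (rule AE_lborel_singleton)
    then have "AE t in ?E. 0 < t"
      by (subst AE_density) (auto simp: exponential_density_def)
    then show ?thesis
      unfolding fading_def by (intro AE_PiM_component E.prob_space_axioms) auto
  qed
  \<comment> \<open>Positive fading is what allows \<open>ennreal\<close> of each product h g to be
    split into factors; countability of \<open>A\<close> gives it almost surely for all interferers
    at once.\<close>
  have all_pos: "AE h in fading \<mu>. \<forall>n. 0 < h (Some (X n))"
    using pos by (simp add: AE_all_countable)
  define \<kappa> where "\<kappa> = T / g z"
  have \<kappa>: "0 < \<kappa>" using assms by (simp add: \<kappa>_def)
  have "success_given \<mu> g T z A = emeasure (fading \<mu>) {h \<in> space (fading \<mu>). ennreal \<kappa> * I h \<le> ennreal (h None)}"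
    unfolding success_given_def
  proof (rule emeasure_eq_AE)
    show "AE h in fading \<mu>. (h \<in> {h \<in> space (fading \<mu>). ennreal T \<le> ennreal (h None * g z) / interference g z h A}) =
        (h \<in> {h \<in> space (fading \<mu>). ennreal \<kappa> * I h \<le> ennreal (h None)})"
      using pos[of None] all_pos
    proof eventually_elim
      case (elim h)
      have "ennreal (h (Some (X n)) * g (X n - z)) = ennreal (h (Some (X n))) * ennreal (G (X n))" for n
        using elim(2) by (simp add: G_def max_def ennreal_mult[symmetric] ennreal_neg mult_pos_neg less_imp_le mult_nonneg_nonpos)
      then have eq: "interference g z h A = I h"
        unfolding interference I_def by simp
      have "ennreal T \<le> ennreal (h None * g z) / I h \<longleftrightarrow> ennreal T * I h \<le> ennreal (h None * g z)"
        using assms elim by (intro ennreal_le_divide_iff) auto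
      also have "\<dots> \<longleftrightarrow> ennreal \<kappa> * I h \<le> ennreal (h None)"
      proof (cases "I h")
        case (real r)
        have "T * r \<le> h None * g z \<longleftrightarrow> \<kappa> * r \<le> h None"
          using assms by (simp add: \<kappa>_def field_simps)
        then show ?thesis
          using real assms elim \<kappa> by (simp add: ennreal_mult[symmetric])
      next
        case top
        then show ?thesis using assms \<kappa> by (simp add: ennreal_mult_top top_unique)
      qed
      finally show ?case by (simp add: eq space)
    qed
  qed measurable
  also have "\<dots> = (\<integral>\<^sup>+h. indicator {h \<in> space (fading \<mu>). ennreal \<kappa> * I h \<le> ennreal (h None)} h \<partial>fading \<mu>)"
    by (rule nn_integral_indicator[symmetric]) measurable
  \<comment> \<open>Coordinate \<open>None\<close> is redrawn. \<open>I\<close> reads only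
    coordinates \<open>Some x\<close>, so it is unaffected, and after an exchange of integrals the
    exponential tail can be inserted.\<close>
  also have "\<dots> = (\<integral>\<^sup>+x. \<integral>\<^sup>+h. indicator {h \<in> space (fading \<mu>). ennreal \<kappa> * I h \<le> ennreal (h None)} (h(None := x)) \<partial>fading \<mu> \<partial>?E)"
    using E.prob_space_axioms unfolding fading_def by (intro nn_integral_PiM_split) (auto simp flip: fading_def)
  also have "\<dots> = (\<integral>\<^sup>+x. \<integral>\<^sup>+h. indicator {t. ennreal \<kappa> * I h \<le> ennreal t} x \<partial>fading \<mu> \<partial>?E)"
    by (intro nn_integral_cong) (simp add: space I_def indicator_def)
  also have "\<dots> = (\<integral>\<^sup>+h. \<integral>\<^sup>+x. indicator {t. ennreal \<kappa> * I h \<le> ennreal t} x \<partial>?E \<partial>fading \<mu>)"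
  proof -
    interpret pair_sigma_finite ?E "fading \<mu>" ..
    have "(\<lambda>(x, h). indicator {t. ennreal \<kappa> * I h \<le> ennreal t} x :: ennreal) \<in> borel_measurable (?E \<Otimes>\<^sub>M fading \<mu>)"
      by measurable
    then show ?thesis by (intro Fubini'[symmetric])
  qed
  also have "\<dots> = (\<integral>\<^sup>+h. nexp (ennreal (\<mu> * \<kappa>) * I h) \<partial>fading \<mu>)"
  proof (rule nn_integral_cong)
    fix h
    have "(\<integral>\<^sup>+x. indicator {t. ennreal \<kappa> * I h \<le> ennreal t} x \<partial>?E) = emeasure ?E {t. ennreal \<kappa> * I h \<le> ennreal t}"
      by (rule nn_integral_indicator) simp
    then show "(\<integral>\<^sup>+x. indicator {t. ennreal \<kappa> * I h \<le> ennreal t} x \<partial>?E) = nexp (ennreal (\<mu> * \<kappa>) * I h)"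
      using assms \<kappa> by (simp add: exponential_tail ennreal_mult mult.assoc)
  qed
  \<comment> \<open>Independence factorises the expectation for finitely many interferers; the
    infinite sum is reached on both sides as a limit of partial sums, whose uniqueness gives the
    equality.\<close>
  also have "\<dots> = nexp (\<Sum>n. fading_loss g T z (X n) * indicator B n)"
  proof (rule LIMSEQ_unique)
    define IN where "IN N h = (\<Sum>n\<in>{..<N} \<inter> B. ennreal (G (X n)) * ennreal (h (Some (X n))))" for N and h :: "plane option \<Rightarrow> real"
    have IN: "(\<Sum>n<N. ennreal (h (Some (X n))) * ennreal (G (X n)) * indicator B n) = IN N h" for N h
      unfolding IN_def sum.inter_restrict[OF finite_lessThan] by (intro sum.cong) (auto simp: mult.commute)
    show "(\<lambda>N. \<integral>\<^sup>+h. nexp (ennreal (\<mu> * \<kappa>) * IN N h) \<partial>fading \<mu>) \<longlonglongrightarrow> (\<integral>\<^sup>+h. nexp (ennreal (\<mu> * \<kappa>) * I h) \<partial>fading \<mu>)"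
    proof (rule nn_integral_dominated_convergence[where w = "\<lambda>_. 1"])
      show "AE h in fading \<mu>. (\<lambda>N. nexp (ennreal (\<mu> * \<kappa>) * IN N h)) \<longlonglongrightarrow> nexp (ennreal (\<mu> * \<kappa>) * I h)"
        unfolding IN[symmetric] I_def
        by (intro AE_I2 nexp_tendsto ennreal_tendsto_cmult summable_LIMSEQ summableI) auto
    qed (auto simp: F.emeasure_space_1 IN_def)
    have step: "(\<integral>\<^sup>+h. nexp (ennreal (\<mu> * \<kappa>) * IN N h) \<partial>fading \<mu>) = nexp (\<Sum>n<N. fading_loss g T z (X n) * indicator B n)" for N
    proof -
      let ?J = "(\<lambda>n. Some (X n)) ` ({..<N} \<inter> B)"
      have inj: "inj_on (\<lambda>n. Some (X n)) ({..<N} \<inter> B)"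
        using X_inj by (auto simp: inj_on_def)
      have "(\<integral>\<^sup>+h. nexp (ennreal (\<mu> * \<kappa>) * IN N h) \<partial>fading \<mu>) =
          (\<integral>\<^sup>+h. (\<Prod>k\<in>?J. nexp (ennreal (\<mu> * \<kappa> * G (the k)) * ennreal (h k))) \<partial>fading \<mu>)"
        using assms \<kappa> unfolding IN_def
        by (intro nn_integral_cong) (simp add: nexp_sum sum_distrib_left prod.reindex[OF inj] ennreal_mult G_def mult.assoc)
      also have "\<dots> = (\<Prod>k\<in>?J. \<integral>\<^sup>+t. nexp (ennreal (\<mu> * \<kappa> * G (the k)) * ennreal t) \<partial>?E)"
        unfolding fading_def by (intro nn_integral_PiM_prod E.prob_space_axioms) auto
      also have "\<dots> = (\<Prod>k\<in>?J. nexp (fading_loss g T z (the k)))"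
        using assms \<kappa> by (intro prod.cong refl) (simp add: exponential_laplace G_def fading_loss_def \<kappa>_def)
      also have "\<dots> = nexp (\<Sum>n\<in>{..<N} \<inter> B. fading_loss g T z (X n))"
        by (simp add: nexp_sum prod.reindex[OF inj])
      also have "(\<Sum>n\<in>{..<N} \<inter> B. fading_loss g T z (X n)) = (\<Sum>n<N. fading_loss g T z (X n) * indicator B n)"
        unfolding sum.inter_restrict[OF finite_lessThan] by (intro sum.cong) auto
      finally show ?thesis .
    qed
    show "(\<lambda>N. \<integral>\<^sup>+h. nexp (ennreal (\<mu> * \<kappa>) * IN N h) \<partial>fading \<mu>) \<longlonglongrightarrow> nexp (\<Sum>n. fading_loss g T z (X n) * indicator B n)"
      unfolding step by (rule nexp_tendsto[OF summable_LIMSEQ[OF summableI]])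
  qed
  also have "(\<Sum>n. fading_loss g T z (X n) * indicator B n) = (\<integral>\<^sup>+x. fading_loss g T z x \<partial>count_space A)"
    unfolding B_def X_def by (rule nn_integral_count_space_countable[OF assms(4), symmetric])
  finally show ?thesis .
qed

lemma locally_finite_countable:
  assumes "locally_finite A"
  shows "countable A"
proof -
  have "countable (\<Union>n. A \<inter> cball 0 (real n))"
    using assms by (intro countable_UN[OF countableI_type] countable_finite) (auto simp: locally_finite_def)
  also have "(\<Union>n. A \<inter> cball 0 (real n)) = A"
    by (auto intro: real_arch_simple)
  finally show ?thesis .
qed

lemma success_prob_eq:
  assumes "0 < \<mu>" "0 < T" "0 < g z" "point_process M \<Phi>" and [measurable]: "g \<in> borel_measurable borel"
  shows "success_prob \<mu> g T z M \<Phi> =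
    (\<integral>\<^sup>+\<omega>. \<integral>\<^sup>+x. nexp (\<integral>\<^sup>+y. fading_loss g T z (y - x) \<partial>count_space (\<Phi> \<omega> - {x})) * indicator (cbox 0 One) x
      \<partial>count_space (\<Phi> \<omega>) \<partial>M) / intensity M \<Phi>"
proof -
  define F where "F A = nexp (\<integral>\<^sup>+x. fading_loss g T z x \<partial>count_space A)" for A
  have [measurable]: "fading_loss g T z \<in> borel_measurable borel"
    unfolding fading_loss_def[abs_def] by measurable
  have F: "F \<in> borel_measurable configs"
    unfolding F_def[abs_def]
    by (rule measurable_compose[OF count_integral_const_measurable[of "\<lambda>A. A"] nexp_measurable]) auto
  have "success_prob \<mu> g T z M \<Phi> = (\<integral>\<^sup>+A. F A \<partial>reduced_palm M \<Phi>)"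
    unfolding success_prob_def F_def using assms
    by (intro nn_integral_cong success_given_eq locally_finite_countable)
      (auto simp: sets_eq_imp_space_eq[OF sets_reduced_palm] space_configs)
  also have "\<dots> = (\<integral>\<^sup>+\<omega>. palm_sum F (\<Phi> \<omega>) \<partial>M) / intensity M \<Phi>"
    by (rule nn_integral_reduced_palm[OF assms(4) F])
  finally show ?thesis
    unfolding palm_sum_def F_def count_integral_reduced_shift .
qed

subsection \<open>Lower bound for Poisson transmitters\<close>

lemma nn_integral_lborel_shift:
  fixes f :: "plane \<Rightarrow> ennreal"
  assumes [measurable]: "f \<in> borel_measurable borel"
  shows "(\<integral>\<^sup>+y. f (y - q) \<partial>lborel) = (\<integral>\<^sup>+y. f y \<partial>lborel)"
proof -
  have "(\<integral>\<^sup>+y. f y \<partial>lborel) = (\<integral>\<^sup>+y. f y \<partial>distr lborel borel ((+) (- q)))"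
    by (simp add: lborel_distr_plus)
  also have "\<dots> = (\<integral>\<^sup>+y. f (y - q) \<partial>lborel)"
    by (subst nn_integral_distr) auto
  finally show ?thesis ..
qed

section \<open>Local upper bounds for the path loss\<close>

locale path_loss_link =
  fixes g :: "plane \<Rightarrow> real" and T :: real and z :: plane
  assumes path_loss: "path_loss g" and T_pos: "0 < T" and z_nonzero: "z \<noteq> 0"
begin

lemma g_pos: "x \<noteq> 0 \<Longrightarrow> 0 < g x"
  using path_loss by (simp add: path_loss_def)

lemma g_antimono:
  assumes "x \<noteq> 0" "norm x \<le> norm y"
  shows "g y \<le> g x"
proof -
  have "y \<noteq> 0" using assms by auto
  then show ?thesis using path_loss assms by (simp add: path_loss_def)
qed

lemma g_radial: "norm x = norm y \<Longrightarrow> g x = g y"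
  by (cases "x = 0") (auto intro!: antisym g_antimono)

lemma g_measurable [measurable]: "g \<in> borel_measurable borel"
  by (rule borel_measurable_continuous_countable_exceptions[of "{0}"])
    (use path_loss in \<open>auto simp: path_loss_def\<close>)

lemma gz_pos: "0 < g z"
  using g_pos z_nonzero by simp

definition profile :: "real \<Rightarrow> real" where
  "profile r = g (r *\<^sub>R axis 1 1)"

lemma g_eq_profile: "g x = profile (norm x)"
  unfolding profile_def by (rule g_radial) simp

lemma profile_pos: "0 < r \<Longrightarrow> 0 < profile r"
  unfolding profile_def by (rule g_pos) (simp add: axis_eq_0_iff)

lemma profile_antimono: "0 < r \<Longrightarrow> r \<le> s \<Longrightarrow> profile s \<le> profile r"
  unfolding profile_def by (rule g_antimono) (auto simp: axis_eq_0_iff)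

lemma isCont_profile: "0 < r \<Longrightarrow> isCont profile r"
proof -
  assume "0 < r"
  then have "(r *\<^sub>R axis 1 1 :: plane) \<in> - {0}"
    by (simp add: axis_eq_0_iff)
  moreover have "continuous_on (- {0}) g" "open (- {0 :: plane})"
    using path_loss by (auto simp: path_loss_def)
  ultimately have "isCont g (r *\<^sub>R axis 1 1)"
    using continuous_on_eq_continuous_at by blast
  moreover have "isCont (\<lambda>r. r *\<^sub>R axis 1 1 :: plane) r"
    by (intro continuous_intros)
  ultimately show ?thesis
    unfolding profile_def[abs_def] by (rule isCont_o2[rotated])
qed

lemma profile_measurable [measurable]: "profile \<in> borel_measurable borel"
  unfolding profile_def[abs_def] by measurable

lemma fading_loss_measurable [measurable]: "fading_loss g T z \<in> borel_measurable borel"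
  unfolding fading_loss_def[abs_def] by measurable

text \<open>An upper bound, uniform over a \<open>\<delta>\<close>-ball of observation points, for the loss caused at \<open>a\<close>; it is
  infinite near \<open>z\<close>, where \<open>g\<close> may be unbounded.\<close>

definition max_loss :: "real \<Rightarrow> plane \<Rightarrow> ennreal" where
  "max_loss \<delta> a = (if norm (a - z) \<le> \<delta> then \<top> else ennreal (ln (1 + T * profile (norm (a - z) - \<delta>) / g z)))"

lemma max_loss_measurable [measurable]: "max_loss \<delta> \<in> borel_measurable borel"
  unfolding max_loss_def[abs_def] by measurable

lemma ln_loss_mono:
  assumes "0 \<le> p" "p \<le> q"
  shows "ennreal (ln (1 + T * p / g z)) \<le> ennreal (ln (1 + T * q / g z))"
proof (rule ennreal_leI, rule ln_mono)
  show "0 < 1 + T * p / g z"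
    using assms T_pos gz_pos by (intro add_pos_nonneg) auto
  show "1 + T * p / g z \<le> 1 + T * q / g z"
    using assms T_pos gz_pos by (intro add_left_mono divide_right_mono mult_left_mono) auto
qed

lemma fading_loss_le_max_loss:
  assumes "norm (x - q) \<le> \<delta>"
  shows "fading_loss g T z (y - x) \<le> max_loss \<delta> (y - q)"
proof (cases "norm (y - q - z) \<le> \<delta>")
  case False
  have "norm (y - q - z) \<le> norm (y - x - z) + norm (x - q)"
    using norm_triangle_ineq[of "y - x - z" "x - q"] by (simp add: algebra_simps)
  then have le: "norm (y - q - z) - \<delta> \<le> norm (y - x - z)"
    using assms by simp
  then have "0 < norm (y - x - z)" using False by linarith
  then have "y - x - z \<noteq> 0" using zero_less_norm_iff by blast
  then have "0 < g (y - x - z)" by (rule g_pos)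
  moreover have "g (y - x - z) \<le> profile (norm (y - q - z) - \<delta>)"
    using profile_antimono[OF _ le] False by (simp add: g_eq_profile)
  ultimately show ?thesis
    using False by (simp add: fading_loss_def max_loss_def ln_loss_mono)
qed (simp add: max_loss_def)

lemma max_loss_mono:
  assumes "\<delta> \<le> \<epsilon>"
  shows "max_loss \<delta> a \<le> max_loss \<epsilon> a"
proof (cases "norm (a - z) \<le> \<epsilon>")
  case False
  then have "0 < profile (norm (a - z) - \<delta>)" using assms by (intro profile_pos) auto
  moreover have "profile (norm (a - z) - \<delta>) \<le> profile (norm (a - z) - \<epsilon>)"
    using False assms by (intro profile_antimono) auto
  ultimately show ?thesis
    using False assms by (simp add: max_loss_def ln_loss_mono)
qed (simp add: max_loss_def)

lemma max_loss_tendsto: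
  assumes "d \<longlonglongrightarrow> 0" "a \<noteq> z"
  shows "(\<lambda>n. max_loss (d n) a) \<longlonglongrightarrow> fading_loss g T z a"
proof -
  have r: "0 < norm (a - z)" using assms by simp
  have "(\<lambda>n. norm (a - z) - d n) \<longlonglongrightarrow> norm (a - z) - 0"
    by (intro tendsto_intros assms)
  then have "(\<lambda>n. profile (norm (a - z) - d n)) \<longlonglongrightarrow> profile (norm (a - z))"
    using isCont_tendsto_compose[OF isCont_profile[OF r]] by simp
  moreover have "0 < 1 + T * profile (norm (a - z)) / g z"
    using profile_pos[OF r] T_pos gz_pos by (intro add_pos_nonneg) auto
  ultimately have "(\<lambda>n. ln (1 + T * profile (norm (a - z) - d n) / g z)) \<longlonglongrightarrow> ln (1 + T * profile (norm (a - z)) / g z)"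
    using gz_pos by (intro tendsto_intros) auto
  moreover have "fading_loss g T z a = ennreal (ln (1 + T * profile (norm (a - z)) / g z))"
    using profile_pos[OF r] by (simp add: fading_loss_def g_eq_profile)
  ultimately have "(\<lambda>n. ennreal (ln (1 + T * profile (norm (a - z) - d n) / g z))) \<longlonglongrightarrow> fading_loss g T z a"
    by (simp add: tendsto_ennrealI)
  moreover have "\<forall>\<^sub>F n in sequentially. ennreal (ln (1 + T * profile (norm (a - z) - d n) / g z)) = max_loss (d n) a"
    using order_tendstoD(2)[OF assms(1) r] by eventually_elim (simp add: max_loss_def)
  ultimately show ?thesis
    by (rule Lim_transform_eventually)
qed

text \<open>The assumption g(x) / g(x - y) -> 1 for a unit vector y, read along the ray through y.
  It keeps the tail of \<open>max_loss 1\<close> comparable with \<open>g\<close> itself.\<close>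

lemma profile_ratio:
  "\<exists>r>1. \<forall>s>r. profile (s - 1) \<le> 2 * profile s"
proof -
  have "((\<lambda>x. g x / g (x - axis 1 1)) \<longlongrightarrow> 1) at_infinity"
    using path_loss by (simp add: path_loss_def)
  then have "\<forall>\<^sub>F x in at_infinity. 1 / 2 < g x / g (x - axis 1 1)"
    by (rule order_tendstoD) simp
  then obtain r where r: "\<And>x. r \<le> norm x \<Longrightarrow> 1 / 2 < g x / g (x - axis 1 1)"
    by (auto simp: eventually_at_infinity)
  show ?thesis
  proof (intro exI[of _ "max r 1 + 1"] conjI allI impI)
    fix s assume s: "max r 1 + 1 < s"
    have "(s *\<^sub>R axis 1 1 :: plane) - axis 1 1 = (s - 1) *\<^sub>R axis 1 1"
      by (simp add: scaleR_diff_left)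
    then have "1 / 2 < profile s / profile (s - 1)"
      using r[of "s *\<^sub>R axis 1 1"] s by (simp add: profile_def)
    moreover have "0 < profile (s - 1)" using s by (intro profile_pos) auto
    ultimately show "profile (s - 1) \<le> 2 * profile s"
      by (simp add: field_simps)
  qed simp
qed

lemma nexp_ln: "0 \<le> p \<Longrightarrow> 1 - nexp (ennreal (ln (1 + p))) = ennreal (p / (1 + p))"
  by (simp add: nexp_ennreal exp_minus ennreal_minus inverse_le_1_iff divide_simps flip: ennreal_1)

text \<open>This is the dominating function for the limit of vanishing mesh. Near the receiver
  \<open>1 - nexp\<close> is at most 1 on a ball, which absorbs the infinite values; far away it is
  at most a multiple of \<open>g\<close>, integrable off the unit ball.\<close>

lemma max_loss_integrable: "(\<integral>\<^sup>+a. 1 - nexp (max_loss 1 a) \<partial>lborel) < \<infinity>"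
proof -
  obtain r where r: "1 < r" "\<And>s. r < s \<Longrightarrow> profile (s - 1) \<le> 2 * profile s"
    using profile_ratio by blast
  have "set_integrable lborel (- ball 0 1) g"
    using path_loss by (simp add: path_loss_def)
  then have int: "(\<integral>\<^sup>+a. ennreal (norm (indicator (- ball 0 1) a *\<^sub>R g a)) \<partial>lborel) < \<infinity>"
    unfolding set_integrable_def integrable_iff_bounded by simp
  \<comment> \<open>The factor 2 is that of \<open>profile_ratio\<close>, and T / g z is left over
    from ln (1 + t) \<le> t.\<close>
  define C where "C = 2 * T / g z"
  have C: "0 \<le> C" using T_pos gz_pos by (simp add: C_def)
  have le: "1 - nexp (max_loss 1 (a + z)) \<le> indicator (cball 0 r) a + ennreal C * ennreal (norm (indicator (- ball 0 1) a *\<^sub>R g a))" for a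
  proof (cases "norm a \<le> r")
    case True
    then have "1 - nexp (max_loss 1 (a + z)) \<le> indicator (cball 0 r) a"
      by (simp add: diff_le_self_ennreal)
    then show ?thesis by (rule order_trans) simp
  next
    case False
    have p: "0 < profile (norm a - 1)" using False r(1) by (intro profile_pos) auto
    have ga: "0 < g a" using False r(1) by (intro g_pos) auto
    have "1 - nexp (max_loss 1 (a + z)) \<le> max_loss 1 (a + z)"
      by (rule one_minus_nexp_le)
    also have "\<dots> = ennreal (ln (1 + T * profile (norm a - 1) / g z))"
      using False r(1) by (simp add: max_loss_def)
    also have "\<dots> \<le> ennreal (T * profile (norm a - 1) / g z)"
      using p T_pos gz_pos by (intro ennreal_leI ln_add_one_self_le_self) auto
    also have "\<dots> \<le> ennreal (T * (2 * profile (norm a)) / g z)"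
      using r(2)[of "norm a"] False T_pos gz_pos by (intro ennreal_leI divide_right_mono mult_left_mono) auto
    also have "\<dots> = ennreal C * ennreal (norm (indicator (- ball 0 1) a *\<^sub>R g a))"
      using False r(1) ga C by (simp add: C_def g_eq_profile[symmetric] ennreal_mult[symmetric] indicator_def
          mult.assoc mult.left_commute[of T])
    finally show ?thesis by (rule order_trans) simp
  qed
  have "(\<integral>\<^sup>+a. 1 - nexp (max_loss 1 a) \<partial>lborel) = (\<integral>\<^sup>+a. 1 - nexp (max_loss 1 (a + z)) \<partial>lborel)"
    using nn_integral_lborel_shift[of "\<lambda>a. 1 - nexp (max_loss 1 a)" "- z"] by simp
  also have "\<dots> \<le> (\<integral>\<^sup>+a. indicator (cball 0 r) a + ennreal C * ennreal (norm (indicator (- ball 0 1) a *\<^sub>R g a)) \<partial>lborel)"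
    by (intro nn_integral_mono le)
  also have "\<dots> = emeasure lborel (cball (0 :: plane) r) + ennreal C * (\<integral>\<^sup>+a. ennreal (norm (indicator (- ball 0 1) a *\<^sub>R g a)) \<partial>lborel)"
    by (subst nn_integral_add) (auto simp: nn_integral_cmult intro!: borel_measurable_indicator borel_closed)
  also have "\<dots> < \<infinity>"
    using int emeasure_bounded_finite[OF bounded_cball] by (simp add: ennreal_mult_less_top)
  finally show ?thesis .
qed

lemma max_loss_integral_tendsto:
  assumes "d \<longlonglongrightarrow> 0" "\<And>n. d n \<le> 1"
  shows "(\<lambda>n. \<integral>\<^sup>+a. 1 - nexp (max_loss (d n) a) \<partial>lborel) \<longlonglongrightarrow> (\<integral>\<^sup>+a. 1 - nexp (fading_loss g T z a) \<partial>lborel)"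
proof (rule nn_integral_dominated_convergence[where w = "\<lambda>a. 1 - nexp (max_loss 1 a)"])
  show "AE a in lborel. 1 - nexp (max_loss (d j) a) \<le> 1 - nexp (max_loss 1 a)" for j
    using assms(2) by (intro AE_I2 ennreal_mono_minus nexp_antimono max_loss_mono)
  have "AE a in lborel. a \<noteq> z" by (rule AE_lborel_singleton)
  then show "AE a in lborel. (\<lambda>n. 1 - nexp (max_loss (d n) a)) \<longlonglongrightarrow> 1 - nexp (fading_loss g T z a)"
  proof eventually_elim
    case (elim a)
    show ?case
      by (rule tendsto_diff_ennreal_general[OF tendsto_const nexp_tendsto[OF max_loss_tendsto[OF assms(1) elim]]]) simp
  qed
qed (use max_loss_integrable in auto)

end

lemma One_nth: "(One :: real^'n) $ i = 1"
  using inner_sum_left_Basis[of "axis i 1 :: real^'n"] by (simp add: cart_eq_inner_axis axis_in_Basis_iff)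

lemma cell_corner_nth: "(q + t *\<^sub>R One) $ i = (q :: real^'n) $ i + t"
  by (simp only: vector_add_component vector_scaleR_component One_nth) simp

section \<open>Cell decomposition of the Poisson Palm average\<close>

context path_loss_link
begin

text \<open>The first factor is the probability of exactly one point in the cell. On that event the
  sum over \<open>Q\<close> has a single term, whose interferers all lie outside \<open>Q\<close>
  and are independent of the count in \<open>Q\<close>.\<close>

lemma poisson_success_cell:
  fixes q :: plane
  assumes "homogeneous_poisson M l \<Psi>" and m: "0 < (m :: nat)"
  defines "Q \<equiv> box q (q + (1 / real m) *\<^sub>R One)"
  shows "ennreal (l / real m ^ 2 * exp (- (l / real m ^ 2))) * nexp (ennreal l * (\<integral>\<^sup>+a. 1 - nexp (max_loss (2 / real m) a) \<partial>lborel)) \<le>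
    (\<integral>\<^sup>+\<omega>. \<integral>\<^sup>+x. nexp (\<integral>\<^sup>+y. fading_loss g T z (y - x) \<partial>count_space (\<Psi> \<omega> - {x})) * indicator Q x \<partial>count_space (\<Psi> \<omega>) \<partial>M)"
proof -
  interpret homogeneous_poisson M l \<Psi> by fact
  \<comment> \<open>The weight vanishes on \<open>Q\<close>, as \<open>laplace_functional\<close>
    demands. Nothing is lost, since the only point in \<open>Q\<close> is the observer, which the
    reduced Palm sum removes anyway.\<close>
  define w where "w y = max_loss (2 / real m) (y - q) * indicator (- Q) y" for y
  have Q: "Q \<in> sets borel" "bounded Q"
    unfolding Q_def by auto
  note [measurable] = Q(1)
  have [measurable]: "w \<in> borel_measurable borel"
    unfolding w_def[abs_def] by measurable
  have area: "emeasure lborel Q = ennreal (1 / real m ^ 2)"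
    unfolding Q_def using m by (subst emeasure_lborel_box) (auto simp: inner_add_left power_divide)
  then have measure_Q: "measure lborel Q = 1 / real m ^ 2"
    by (simp add: measure_def)
  \<comment> \<open>Two coordinates of size at most 1 / m bound the distance to the corner through
    the l1 norm; this 2 / m is the radius in \<open>max_loss\<close>.\<close>
  have near: "norm (x - q) \<le> 2 / real m" if "x \<in> Q" for x
  proof -
    have "\<bar>(x - q) $ i\<bar> \<le> 1 / real m" for i
      using that unfolding Q_def mem_box_cart cell_corner_nth by (auto simp: less_imp_le algebra_simps dest!: spec[of _ i])
    then have "(\<Sum>i\<in>UNIV. \<bar>(x - q) $ i\<bar>) \<le> (\<Sum>i\<in>(UNIV :: 2 set). 1 / real m)"
      by (intro sum_mono)
    then show ?thesis
      using norm_le_l1_cart[of "x - q"] by simp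
  qed
  have "(\<integral>\<^sup>+\<omega>. indicator {1} (card (\<Psi> \<omega> \<inter> Q)) \<partial>M) =
      (\<Sum>n. indicator {1} n * ennreal (exp (- (l * measure lborel Q)) * (l * measure lborel Q) ^ n / fact n))"
    by (rule nn_integral_count[OF Q])
  also have "\<dots> = (\<Sum>n\<in>{1}. indicator {1} n * ennreal (exp (- (l * measure lborel Q)) * (l * measure lborel Q) ^ n / fact n))"
    by (rule suminf_finite) auto
  also have "\<dots> = ennreal (l / real m ^ 2 * exp (- (l / real m ^ 2)))"
    by (simp add: measure_Q mult.commute)
  finally have one: "(\<integral>\<^sup>+\<omega>. indicator {1} (card (\<Psi> \<omega> \<inter> Q)) \<partial>M) = ennreal (l / real m ^ 2 * exp (- (l / real m ^ 2)))" .
  have "(\<integral>\<^sup>+x. 1 - nexp (w x) \<partial>lborel) \<le> (\<integral>\<^sup>+x. 1 - nexp (max_loss (2 / real m) (x - q)) \<partial>lborel)"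
    unfolding w_def by (intro nn_integral_mono ennreal_mono_minus nexp_antimono) (auto split: split_indicator)
  also have "\<dots> = (\<integral>\<^sup>+a. 1 - nexp (max_loss (2 / real m) a) \<partial>lborel)"
    by (rule nn_integral_lborel_shift) measurable
  finally have w_int: "(\<integral>\<^sup>+x. 1 - nexp (w x) \<partial>lborel) \<le> (\<integral>\<^sup>+a. 1 - nexp (max_loss (2 / real m) a) \<partial>lborel)" .
  have "ennreal (l / real m ^ 2 * exp (- (l / real m ^ 2))) * nexp (ennreal l * (\<integral>\<^sup>+a. 1 - nexp (max_loss (2 / real m) a) \<partial>lborel)) \<le>
      (\<integral>\<^sup>+\<omega>. indicator {1} (card (\<Psi> \<omega> \<inter> Q)) \<partial>M) * nexp (ennreal l * (\<integral>\<^sup>+x. 1 - nexp (w x) \<partial>lborel))"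
    unfolding one by (intro mult_left_mono nexp_antimono w_int) auto
  also have "\<dots> = (\<integral>\<^sup>+\<omega>. indicator {1} (card (\<Psi> \<omega> \<inter> Q)) * nexp (\<integral>\<^sup>+x. w x \<partial>count_space (\<Psi> \<omega>)) \<partial>M)"
    by (rule laplace_functional[symmetric]) (auto simp: Q w_def split: split_indicator)
  also have "\<dots> \<le> (\<integral>\<^sup>+\<omega>. \<integral>\<^sup>+x. nexp (\<integral>\<^sup>+y. fading_loss g T z (y - x) \<partial>count_space (\<Psi> \<omega> - {x})) * indicator Q x \<partial>count_space (\<Psi> \<omega>) \<partial>M)"
  proof (rule nn_integral_mono)
    fix \<omega>
    show "indicator {1} (card (\<Psi> \<omega> \<inter> Q)) * nexp (\<integral>\<^sup>+x. w x \<partial>count_space (\<Psi> \<omega>)) \<le>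
        (\<integral>\<^sup>+x. nexp (\<integral>\<^sup>+y. fading_loss g T z (y - x) \<partial>count_space (\<Psi> \<omega> - {x})) * indicator Q x \<partial>count_space (\<Psi> \<omega>))"
    proof (cases "card (\<Psi> \<omega> \<inter> Q) = 1")
      case True
      then obtain x where x: "\<Psi> \<omega> \<inter> Q = {x}" by (auto simp: card_1_singleton_iff)
      then have xQ: "x \<in> \<Psi> \<omega>" "x \<in> Q" by auto
      have "(\<integral>\<^sup>+y. fading_loss g T z (y - x) \<partial>count_space (\<Psi> \<omega> - {x})) \<le> (\<integral>\<^sup>+y. w y \<partial>count_space (\<Psi> \<omega> - {x}))"
      proof (rule nn_integral_mono)
        fix y assume "y \<in> space (count_space (\<Psi> \<omega> - {x}))"
        then have "y \<notin> Q" using x by auto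
        then show "fading_loss g T z (y - x) \<le> w y"
          using fading_loss_le_max_loss[OF near[OF xQ(2)]] by (simp add: w_def)
      qed
      also have "\<dots> \<le> (\<integral>\<^sup>+y. w y \<partial>count_space (\<Psi> \<omega>))"
        unfolding count_integral_Diff by (intro nn_integral_mono) (auto split: split_indicator)
      finally have "nexp (\<integral>\<^sup>+x. w x \<partial>count_space (\<Psi> \<omega>)) \<le>
          nexp (\<integral>\<^sup>+y. fading_loss g T z (y - x) \<partial>count_space (\<Psi> \<omega> - {x})) * indicator Q x"
        using xQ by (simp add: nexp_antimono)
      also have "\<dots> \<le> (\<integral>\<^sup>+x. nexp (\<integral>\<^sup>+y. fading_loss g T z (y - x) \<partial>count_space (\<Psi> \<omega> - {x})) * indicator Q x \<partial>count_space (\<Psi> \<omega>))"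
        by (rule nn_integral_ge_point) fact
      finally show ?thesis using True by simp
    qed simp
  qed
  finally show ?thesis .
qed

lemma poisson_success_lower:
  assumes P: "poisson_process M l \<Psi>" and l: "0 < l" and "0 < \<mu>"
  shows "nexp (ennreal l * (\<integral>\<^sup>+a. 1 - nexp (fading_loss g T z a) \<partial>lborel)) \<le> success_prob \<mu> g T z M \<Psi>"
proof -
  interpret homogeneous_poisson M l \<Psi> using P l by unfold_locales auto
  define S where "S \<omega> x = nexp (\<integral>\<^sup>+y. fading_loss g T z (y - x) \<partial>count_space (\<Psi> \<omega> - {x}))" for \<omega> x
  define K where "K m = (\<integral>\<^sup>+a. 1 - nexp (max_loss (2 / real m) a) \<partial>lborel)" for m :: nat
  have pp: "point_process M \<Psi>" using P by (simp add: poisson_process_def)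
  have "emeasure lborel (cbox 0 (One :: plane)) = 1"
    by (subst emeasure_lborel_cbox) auto
  then have intensity: "intensity M \<Psi> = ennreal l"
    unfolding intensity_def by (subst nn_integral_count_mean) auto
  have success: "success_prob \<mu> g T z M \<Psi> = (\<integral>\<^sup>+\<omega>. \<integral>\<^sup>+x. S \<omega> x * indicator (cbox 0 One) x \<partial>count_space (\<Psi> \<omega>) \<partial>M) / ennreal l"
    using success_prob_eq[OF \<open>0 < \<mu>\<close> T_pos gz_pos pp g_measurable] by (simp add: S_def intensity)
  have bound: "ennreal (exp (- (l / real m ^ 2))) * nexp (ennreal l * K m) \<le> success_prob \<mu> g T z M \<Psi>" if m: "0 < m" for m
  proof -
    define q where "q k = (vector [real (fst k) / real m, real (snd k) / real m] :: plane)" for k :: "nat \<times> nat"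
    define Q where "Q k = box (q k) (q k + (1 / real m) *\<^sub>R One)" for k
    define I where "I = {..<m} \<times> {..<m}"
    have fin: "finite I" and card: "card I = m * m" by (simp_all add: I_def)
    have Q_iff: "x \<in> Q k \<longleftrightarrow> real (fst k) / real m < x $ 1 \<and> x $ 1 < (real (fst k) + 1) / real m \<and>
        real (snd k) / real m < x $ 2 \<and> x $ 2 < (real (snd k) + 1) / real m" for x k
      unfolding Q_def mem_box_cart cell_corner_nth by (auto simp: q_def forall_2 add_divide_distrib)
    have uniq: "a = b" if "real a / real m < t" "t < (real a + 1) / real m" "real b / real m < t" "t < (real b + 1) / real m" for a b t
    proof -
      have "real a < real b + 1" "real b < real a + 1"
        using that m by (simp_all add: field_simps)
      then show ?thesis by linarith
    qed
    \<comment> \<open>Open cells are pairwise disjoint and miss the grid lines, so their indicators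
      sum to at most that of the square, which is the direction needed.\<close>
    have ind: "(\<Sum>k\<in>I. indicator (Q k) x :: ennreal) \<le> indicator (cbox 0 One) x" for x
    proof (cases "\<exists>k\<in>I. x \<in> Q k")
      case True
      then obtain k where k: "k \<in> I" "x \<in> Q k" by auto
      have unique: "j = k" if "x \<in> Q j" for j
      proof (rule prod_eqI)
        note bounds = that[unfolded Q_iff] k(2)[unfolded Q_iff]
        show "fst j = fst k"
          by (rule uniq[of _ "x $ 1"]) (simp_all only: bounds)
        show "snd j = snd k"
          by (rule uniq[of _ "x $ 2"]) (simp_all only: bounds)
      qed
      have "x \<in> Q j \<longleftrightarrow> j = k" for j
        using unique k(2) by blast
      then have "indicator (Q j) x = (if j = k then 1 else 0 :: ennreal)" for j
        by (simp add: indicator_def)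
      then have "(\<Sum>k\<in>I. indicator (Q k) x :: ennreal) = 1"
        using k(1) fin by simp
      moreover have "x \<in> cbox 0 One"
      proof -
        have "(real (fst k) + 1) / real m \<le> 1" "(real (snd k) + 1) / real m \<le> 1"
          using k(1) m by (auto simp: I_def field_simps)
        moreover have "0 \<le> real (fst k) / real m" "0 \<le> real (snd k) / real m" by auto
        ultimately show ?thesis
          using k(2) unfolding Q_iff mem_box_cart forall_2 One_nth zero_index by (intro conjI; linarith)
      qed
      ultimately show ?thesis by simp
    next
      case False
      then have "(\<Sum>k\<in>I. indicator (Q k) x :: ennreal) = 0" by (simp add: fin)
      then show ?thesis by simp
    qed
    \<comment> \<open>There are m * m cells with equal contributions, so the factors l / m^2 add up
      to the intensity, which cancels in the Palm average.\<close>
    have "ennreal l * (ennreal (exp (- (l / real m ^ 2))) * nexp (ennreal l * K m)) =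
        (\<Sum>k\<in>I. ennreal (l / real m ^ 2 * exp (- (l / real m ^ 2))) * nexp (ennreal l * K m))"
      using m l by (simp add: card ennreal_mult[symmetric] mult.assoc[symmetric] power2_eq_square
          ennreal_of_nat_eq_real_of_nat del: of_nat_mult) (simp add: field_simps)
    also have "\<dots> \<le> (\<Sum>k\<in>I. \<integral>\<^sup>+\<omega>. \<integral>\<^sup>+x. S \<omega> x * indicator (Q k) x \<partial>count_space (\<Psi> \<omega>) \<partial>M)"
      unfolding S_def Q_def K_def
      by (intro sum_mono poisson_success_cell[OF homogeneous_poisson_axioms m])
    also have "\<dots> \<le> (\<integral>\<^sup>+\<omega>. (\<Sum>k\<in>I. \<integral>\<^sup>+x. S \<omega> x * indicator (Q k) x \<partial>count_space (\<Psi> \<omega>)) \<partial>M)"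
    proof (intro eq_refl nn_integral_sum[symmetric])
      fix k
      \<comment> \<open>Joint measurability in the configuration and the removed point is inherited
        from \<open>reduced_shift_measurable\<close>.\<close>
      have H: "(\<lambda>\<omega>. \<integral>\<^sup>+x. (\<lambda>(\<omega>, x). nexp (\<integral>\<^sup>+y. fading_loss g T z y \<partial>count_space (reduced_shift (\<Psi> \<omega>) x)) * indicator (Q k) x) (\<omega>, x) \<partial>count_space (\<Psi> \<omega>)) \<in> borel_measurable M"
      proof (rule count_integral_measurable[OF Y_measurable])
        have 1: "(\<lambda>p. (\<Psi> (fst p), snd p)) \<in> measurable (M \<Otimes>\<^sub>M borel) (configs \<Otimes>\<^sub>M (borel :: plane measure))"
          using measurable_compose[OF measurable_fst Y_measurable] by (intro measurable_Pair) auto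
        have "(\<lambda>p. reduced_shift (\<Psi> (fst p)) (snd p)) \<in> measurable (M \<Otimes>\<^sub>M borel) configs"
          using measurable_compose[OF 1 reduced_shift_measurable] by simp
        from count_integral_const_measurable[OF this fading_loss_measurable]
        show "(\<lambda>(\<omega>, x). nexp (\<integral>\<^sup>+y. fading_loss g T z y \<partial>count_space (reduced_shift (\<Psi> \<omega>) x)) * indicator (Q k) x) \<in> borel_measurable (M \<Otimes>\<^sub>M borel)"
          by (simp add: case_prod_beta Q_def borel_measurable_times_ennreal)
      qed
      then show "(\<lambda>\<omega>. \<integral>\<^sup>+x. S \<omega> x * indicator (Q k) x \<partial>count_space (\<Psi> \<omega>)) \<in> borel_measurable M"
        by (simp add: S_def count_integral_reduced_shift)
    qed
    also have "\<dots> = (\<integral>\<^sup>+\<omega>. \<integral>\<^sup>+x. S \<omega> x * (\<Sum>k\<in>I. indicator (Q k) x) \<partial>count_space (\<Psi> \<omega>) \<partial>M)"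
      by (subst nn_integral_sum[symmetric]) (auto simp: sum_distrib_left)
    also have "\<dots> \<le> (\<integral>\<^sup>+\<omega>. \<integral>\<^sup>+x. S \<omega> x * indicator (cbox 0 One) x \<partial>count_space (\<Psi> \<omega>) \<partial>M)"
      by (intro nn_integral_mono mult_left_mono ind) auto
    finally have "ennreal l * (ennreal (exp (- (l / real m ^ 2))) * nexp (ennreal l * K m)) / ennreal l \<le> success_prob \<mu> g T z M \<Psi>"
      unfolding success by (rule divide_right_mono_ennreal)
    then show ?thesis
      using l by (simp add: mult_divide_eq_ennreal mult.commute[of "ennreal l"])
  qed
  \<comment> \<open>Starting at mesh index 2 keeps the radius 2 / (n + 2) at most 1, within reach of
    the dominating function \<open>max_loss 1\<close>.\<close>
  have "(\<lambda>n. K (n + 2)) \<longlonglongrightarrow> (\<integral>\<^sup>+a. 1 - nexp (fading_loss g T z a) \<partial>lborel)"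
    unfolding K_def
  proof (rule max_loss_integral_tendsto)
    show "(\<lambda>n. 2 / real (n + 2)) \<longlonglongrightarrow> 0" by real_asymp
  qed simp
  moreover have "(\<lambda>n. exp (- (l / real (n + 2) ^ 2))) \<longlonglongrightarrow> 1"
    using l by real_asymp
  ultimately have "(\<lambda>n. ennreal (exp (- (l / real (n + 2) ^ 2))) * nexp (ennreal l * K (n + 2))) \<longlonglongrightarrow>
      ennreal 1 * nexp (ennreal l * (\<integral>\<^sup>+a. 1 - nexp (fading_loss g T z a) \<partial>lborel))"
    by (intro tendsto_mult_ennreal tendsto_ennrealI nexp_tendsto ennreal_tendsto_cmult) auto
  then have "ennreal 1 * nexp (ennreal l * (\<integral>\<^sup>+a. 1 - nexp (fading_loss g T z a) \<partial>lborel)) \<le> success_prob \<mu> g T z M \<Psi>"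
  proof (rule LIMSEQ_le_const2, intro exI allI impI)
    fix n
    show "ennreal (exp (- (l / real (n + 2) ^ 2))) * nexp (ennreal l * K (n + 2)) \<le> success_prob \<mu> g T z M \<Psi>"
      by (rule bound) simp
  qed
  then show ?thesis by simp
qed

end

subsection \<open>Independent Poisson clusters\<close>

locale poisson_cluster =
  fixes c :: real and f :: "plane \<Rightarrow> real"
  assumes c_pos: "0 < c" and density: "isotropic_density f"
begin

lemma f_measurable [measurable]: "f \<in> borel_measurable borel"
  and f_nonneg: "0 \<le> f x"
  and f_integral: "(\<integral>\<^sup>+x. ennreal (f x) \<partial>lborel) = 1"
  and f_minus: "f (- x) = f x"
  using density norm_minus_cancel[of x] unfolding isotropic_density_def by blast+

abbreviation displacement :: "plane measure" where
  "displacement \<equiv> density lborel (\<lambda>x. ennreal (f x))"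

abbreviation counts :: "(nat \<Rightarrow> nat) measure" where
  "counts \<equiv> Pi\<^sub>M UNIV (\<lambda>_. measure_pmf (poisson_pmf c))"

abbreviation displacements :: "(nat \<times> nat \<Rightarrow> plane) measure" where
  "displacements \<equiv> Pi\<^sub>M UNIV (\<lambda>_. displacement)"

sublocale displacement: prob_space displacement
  by (rule prob_spaceI) (simp add: emeasure_density f_integral)

sublocale counts: prob_space counts
  by (intro prob_space_PiM prob_space_measure_pmf)

sublocale displacements: prob_space displacements
  by (intro prob_space_PiM displacement.prob_space_axioms)

lemma counts_measurable [measurable]: "(\<lambda>N. N i) \<in> measurable counts (count_space UNIV)"
  using measurable_component_singleton[of i UNIV "\<lambda>_. measure_pmf (poisson_pmf c)"]
  by (simp cong: measurable_cong_sets)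

lemma displacements_measurable [measurable]: "(\<lambda>d. d k) \<in> borel_measurable displacements"
  using measurable_component_singleton[of k UNIV "\<lambda>_. displacement"]
  by (simp cong: measurable_cong_sets)

lemma nn_integral_poisson:
  "(\<integral>\<^sup>+n. \<phi> n \<partial>measure_pmf (poisson_pmf c)) = (\<Sum>n. \<phi> n * ennreal (exp (- c) * c ^ n / fact n))"
  using c_pos by (simp add: nn_integral_measure_pmf nn_integral_count_space_nat mult.commute)

text \<open>The probability that point number \<open>j\<close> of a cluster is present, counting
  from 0. These tails sum to the mean cluster size.\<close>

definition count_tail :: "nat \<Rightarrow> ennreal" where
  "count_tail j = (\<integral>\<^sup>+n. indicator {j<..} n \<partial>measure_pmf (poisson_pmf c))"

lemma suminf_count_tail: "(\<Sum>j. count_tail j) = ennreal c"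
proof -
  have "(\<Sum>j. count_tail j) = (\<integral>\<^sup>+n. (\<Sum>j. indicator {j<..} n) \<partial>measure_pmf (poisson_pmf c))"
    unfolding count_tail_def by (rule nn_integral_suminf[symmetric]) simp
  also have "\<dots> = (\<integral>\<^sup>+n. of_nat n \<partial>measure_pmf (poisson_pmf c))"
  proof (rule nn_integral_cong)
    fix n :: nat
    show "(\<Sum>j. indicator {j<..} n :: ennreal) = of_nat n"
      by (subst suminf_finite[of "{..<n}"]) auto
  qed
  also have "(\<integral>\<^sup>+n. of_nat n \<partial>measure_pmf (poisson_pmf c)) = ennreal c"
    using c_pos by (simp add: nn_integral_poisson suminf_poisson_mean)
  finally show ?thesis .
qed

text \<open>Here \<open>y\<close> is the position of the observer relative to the parent. For the
  fading loss this is, up to a rotation, \<open>\<beta>\<close>: the mean reduction by one point of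
  the cluster.\<close>

definition mark :: "(plane \<Rightarrow> ennreal) \<Rightarrow> plane \<Rightarrow> ennreal" where
  "mark u y = (\<integral>\<^sup>+x. 1 - nexp (u (x - y)) \<partial>displacement)"

lemma mark_measurable [measurable]:
  assumes [measurable]: "u \<in> borel_measurable borel"
  shows "mark u \<in> borel_measurable borel"
  unfolding mark_def[abs_def] by measurable

lemma mark_le_1: "mark u y \<le> 1"
  unfolding mark_def
  using nn_integral_mono[of displacement "\<lambda>x. 1 - nexp (u (x - y))" "\<lambda>_. 1"] displacement.emeasure_space_1
  by (simp add: diff_le_self_ennreal)

lemma one_minus_nexp_integral:
  assumes [measurable]: "u \<in> borel_measurable borel"
  shows "1 - (\<integral>\<^sup>+x. nexp (u (x - y)) \<partial>displacement) = mark u y"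
proof -
  have "(\<integral>\<^sup>+x. nexp (u (x - y)) \<partial>displacement) \<le> (\<integral>\<^sup>+x. 1 \<partial>displacement)"
    by (intro nn_integral_mono) simp
  then have "(\<integral>\<^sup>+x. nexp (u (x - y)) \<partial>displacement) \<noteq> \<infinity>"
    using displacement.emeasure_space_1 by (auto simp: top_unique)
  then have "mark u y = (\<integral>\<^sup>+x. 1 \<partial>displacement) - (\<integral>\<^sup>+x. nexp (u (x - y)) \<partial>displacement)"
    unfolding mark_def by (intro nn_integral_diff) auto
  then show ?thesis using displacement.emeasure_space_1 by simp
qed

lemma counts_integral:
  assumes J: "finite J" "i \<notin> J" and m: "\<And>k. m k \<le> 1"
  shows "(\<integral>\<^sup>+N. indicator {j<..} (N i) * (\<Prod>k\<in>J. m k ^ N k) \<partial>counts) =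
    count_tail j * (\<Prod>k\<in>J. nexp (ennreal c * (1 - m k)))"
proof -
  define \<phi> where "\<phi> k n = (if k = i then indicator {j<..} n else m k ^ n)" for k n
  have "(\<integral>\<^sup>+N. indicator {j<..} (N i) * (\<Prod>k\<in>J. m k ^ N k) \<partial>counts) = (\<integral>\<^sup>+N. (\<Prod>k\<in>insert i J. \<phi> k (N k)) \<partial>counts)"
  proof (rule nn_integral_cong)
    fix N
    have "(\<Prod>k\<in>J. m k ^ N k) = (\<Prod>k\<in>J. \<phi> k (N k))"
      using J by (intro prod.cong) (auto simp: \<phi>_def)
    then show "indicator {j<..} (N i) * (\<Prod>k\<in>J. m k ^ N k) = (\<Prod>k\<in>insert i J. \<phi> k (N k))"
      using J by (simp add: \<phi>_def)
  qed
  also have "\<dots> = (\<Prod>k\<in>insert i J. \<integral>\<^sup>+n. \<phi> k n \<partial>measure_pmf (poisson_pmf c))"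
    using J by (intro nn_integral_PiM_prod prob_space_measure_pmf) auto
  also have "\<dots> = count_tail j * (\<Prod>k\<in>J. \<integral>\<^sup>+n. \<phi> k n \<partial>measure_pmf (poisson_pmf c))"
    using J by (simp add: \<phi>_def count_tail_def)
  also have "(\<Prod>k\<in>J. \<integral>\<^sup>+n. \<phi> k n \<partial>measure_pmf (poisson_pmf c)) = (\<Prod>k\<in>J. nexp (ennreal c * (1 - m k)))"
  proof (rule prod.cong[OF refl])
    fix k assume "k \<in> J"
    then have "\<phi> k n = m k ^ n" for n
      using J by (auto simp: \<phi>_def)
    then show "(\<integral>\<^sup>+n. \<phi> k n \<partial>measure_pmf (poisson_pmf c)) = nexp (ennreal c * (1 - m k))"
      using c_pos m by (simp add: nn_integral_poisson suminf_poisson_power)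
  qed
  finally show ?thesis .
qed

text \<open>Given the sizes, the displacements in cluster \<open>k\<close> contribute independent
  equal factors and hence a power with exponent \<open>N k\<close>; averaging over the Poisson size
  turns the power into an exponential. The observer is point \<open>j\<close> of cluster
  \<open>i\<close>, whose presence has weight \<open>count_tail j\<close>.\<close>

lemma cluster_finite:
  assumes J: "finite J" "i \<notin> J" and [measurable]: "u \<in> borel_measurable borel" "\<psi> \<in> borel_measurable borel"
  shows "(\<integral>\<^sup>+N. \<integral>\<^sup>+d. indicator {j<..} (N i) * (\<psi> (d (i, j)) *
      nexp (\<Sum>i'\<in>J. \<Sum>j'<N i'. u (q i' + d (i', j') - (q i + d (i, j))))) \<partial>displacements \<partial>counts) =
    count_tail j * (\<integral>\<^sup>+x. \<psi> x * nexp (\<Sum>i'\<in>J. ennreal c * mark u (q i + x - q i')) \<partial>displacement)"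
proof -
  define m where "m x k = (\<integral>\<^sup>+y. nexp (u (y - (q i + x - q k))) \<partial>displacement)" for x k
  have m_le: "m x k \<le> 1" for x k
    unfolding m_def
    using nn_integral_mono[of displacement "\<lambda>y. nexp (u (y - (q i + x - q k)))" "\<lambda>_. 1"] displacement.emeasure_space_1
    by simp
  have [measurable]: "(\<lambda>x. m x k) \<in> borel_measurable borel" for k
    unfolding m_def by measurable
  have inner: "(\<integral>\<^sup>+d. nexp (\<Sum>i'\<in>J. \<Sum>j'<N i'. u (q i' + d (i', j') - (q i + x))) \<partial>displacements) = (\<Prod>k\<in>J. m x k ^ N k)"
    for N :: "nat \<Rightarrow> nat" and x
  proof -
    \<comment> \<open>One factor per existing point. Factors depend only on the cluster index, which
      leads to the powers.\<close>
    let ?K = "Sigma J (\<lambda>k. {..<N k})"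
    have "(\<integral>\<^sup>+d. nexp (\<Sum>i'\<in>J. \<Sum>j'<N i'. u (q i' + d (i', j') - (q i + x))) \<partial>displacements) =
        (\<integral>\<^sup>+d. (\<Prod>k\<in>?K. nexp (u (d k - (q i + x - q (fst k))))) \<partial>displacements)"
      using J by (intro nn_integral_cong) (simp add: nexp_sum prod.Sigma case_prod_beta algebra_simps)
    also have "\<dots> = (\<Prod>k\<in>?K. m x (fst k))"
      unfolding m_def using J by (intro nn_integral_PiM_prod displacement.prob_space_axioms) auto
    also have "\<dots> = (\<Prod>k\<in>J. m x k ^ N k)"
      using J prod.Sigma[of J "\<lambda>k. {..<N k}" "\<lambda>k _. m x k"] by (simp add: case_prod_beta)
    finally show ?thesis .
  qed
  have "(\<integral>\<^sup>+d. indicator {j<..} (N i) * (\<psi> (d (i, j)) *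
      nexp (\<Sum>i'\<in>J. \<Sum>j'<N i'. u (q i' + d (i', j') - (q i + d (i, j))))) \<partial>displacements) =
      (\<integral>\<^sup>+x. \<psi> x * (indicator {j<..} (N i) * (\<Prod>k\<in>J. m x k ^ N k)) \<partial>displacement)" for N :: "nat \<Rightarrow> nat"
  proof -
    \<comment> \<open>The observer's displacement is redrawn as \<open>x\<close>. As
      \<open>i\<close> is not in \<open>J\<close>, no other term reads the coordinate
      \<open>(i, j)\<close>, so the remaining displacements integrate out with \<open>x\<close>
      fixed.\<close>
    have "(\<integral>\<^sup>+d. indicator {j<..} (N i) * (\<psi> (d (i, j)) *
        nexp (\<Sum>i'\<in>J. \<Sum>j'<N i'. u (q i' + d (i', j') - (q i + d (i, j))))) \<partial>displacements) =
        (\<integral>\<^sup>+x. \<integral>\<^sup>+d. indicator {j<..} (N i) * (\<psi> ((d((i, j) := x)) (i, j)) *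
        nexp (\<Sum>i'\<in>J. \<Sum>j'<N i'. u (q i' + (d((i, j) := x)) (i', j') - (q i + (d((i, j) := x)) (i, j))))) \<partial>displacements \<partial>displacement)"
      by (rule nn_integral_PiM_split[OF displacement.prob_space_axioms]) measurable
    also have "\<dots> = (\<integral>\<^sup>+x. \<integral>\<^sup>+d. (\<psi> x * indicator {j<..} (N i)) * nexp (\<Sum>i'\<in>J. \<Sum>j'<N i'. u (q i' + d (i', j') - (q i + x))) \<partial>displacements \<partial>displacement)"
    proof (intro nn_integral_cong)
      fix x d
      have "(\<Sum>i'\<in>J. \<Sum>j'<N i'. u (q i' + (d((i, j) := x)) (i', j') - (q i + (d((i, j) := x)) (i, j)))) =
          (\<Sum>i'\<in>J. \<Sum>j'<N i'. u (q i' + d (i', j') - (q i + x)))"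
        using J by (intro sum.cong refl) auto
      then show "indicator {j<..} (N i) * (\<psi> ((d((i, j) := x)) (i, j)) *
          nexp (\<Sum>i'\<in>J. \<Sum>j'<N i'. u (q i' + (d((i, j) := x)) (i', j') - (q i + (d((i, j) := x)) (i, j))))) =
          (\<psi> x * indicator {j<..} (N i)) * nexp (\<Sum>i'\<in>J. \<Sum>j'<N i'. u (q i' + d (i', j') - (q i + x)))"
        by (simp add: ac_simps)
    qed
    also have "\<dots> = (\<integral>\<^sup>+x. (\<psi> x * indicator {j<..} (N i)) * (\<Prod>k\<in>J. m x k ^ N k) \<partial>displacement)"
      by (intro nn_integral_cong) (subst nn_integral_cmult, auto simp: inner)
    finally show ?thesis by (simp add: mult.assoc)
  qed
  then have "(\<integral>\<^sup>+N. \<integral>\<^sup>+d. indicator {j<..} (N i) * (\<psi> (d (i, j)) *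
      nexp (\<Sum>i'\<in>J. \<Sum>j'<N i'. u (q i' + d (i', j') - (q i + d (i, j))))) \<partial>displacements \<partial>counts) =
      (\<integral>\<^sup>+N. \<integral>\<^sup>+x. \<psi> x * (indicator {j<..} (N i) * (\<Prod>k\<in>J. m x k ^ N k)) \<partial>displacement \<partial>counts)"
    by simp
  also have "\<dots> = (\<integral>\<^sup>+x. \<integral>\<^sup>+N. \<psi> x * (indicator {j<..} (N i) * (\<Prod>k\<in>J. m x k ^ N k)) \<partial>counts \<partial>displacement)"
  proof -
    interpret pair_sigma_finite displacement counts ..
    have N: "(\<lambda>p. snd p k) \<in> measurable (displacement \<Otimes>\<^sub>M counts) (count_space UNIV)" for k
      by (rule measurable_compose[OF measurable_snd counts_measurable])
    have x: "(\<lambda>p. h (fst p)) \<in> borel_measurable (displacement \<Otimes>\<^sub>M counts)"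
      if "h \<in> borel_measurable borel" for h :: "plane \<Rightarrow> ennreal"
      by (rule measurable_compose[OF measurable_fst]) (use that in simp)
    \<comment> \<open>The exponent is random too, so measurability is obtained by splitting over its
      countably many values.\<close>
    have "(\<lambda>p. m (fst p) k ^ (snd p) k) \<in> borel_measurable (displacement \<Otimes>\<^sub>M counts)" for k
    proof (rule measurable_compose_countable[where g = "\<lambda>p. snd p k" and f = "\<lambda>n p. m (fst p) k ^ n", OF _ N])
      show "(\<lambda>p. m (fst p) k ^ n) \<in> borel_measurable (displacement \<Otimes>\<^sub>M counts)" for n
        by (rule x) simp
    qed
    then have "(\<lambda>(x, N). \<psi> x * (indicator {j<..} (N i) * (\<Prod>k\<in>J. m x k ^ N k))) \<in> borel_measurable (displacement \<Otimes>\<^sub>M counts)"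
      unfolding case_prod_beta
      by (intro borel_measurable_times_ennreal borel_measurable_prod_ennreal x measurable_compose[OF N]) auto
    then show ?thesis by (rule Fubini')
  qed
  also have "\<dots> = (\<integral>\<^sup>+x. count_tail j * (\<psi> x * nexp (\<Sum>i'\<in>J. ennreal c * mark u (q i + x - q i'))) \<partial>displacement)"
  proof (rule nn_integral_cong)
    fix x
    have "(\<integral>\<^sup>+N. \<psi> x * (indicator {j<..} (N i) * (\<Prod>k\<in>J. m x k ^ N k)) \<partial>counts) =
        \<psi> x * (\<integral>\<^sup>+N. indicator {j<..} (N i) * (\<Prod>k\<in>J. m x k ^ N k) \<partial>counts)"
    proof (rule nn_integral_cmult)
      have "(\<lambda>N. m x k ^ N k) \<in> borel_measurable counts" for k
        by (rule measurable_compose[OF counts_measurable]) simp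
      then show "(\<lambda>N. indicator {j<..} (N i) * (\<Prod>k\<in>J. m x k ^ N k)) \<in> borel_measurable counts"
        by (intro borel_measurable_times_ennreal borel_measurable_prod_ennreal measurable_compose[OF counts_measurable]) auto
    qed
    also have "\<dots> = \<psi> x * (count_tail j * (\<Prod>k\<in>J. nexp (ennreal c * (1 - m x k))))"
      using J m_le by (simp add: counts_integral)
    also have "(\<Prod>k\<in>J. nexp (ennreal c * (1 - m x k))) = nexp (\<Sum>i'\<in>J. ennreal c * mark u (q i + x - q i'))"
      using J by (simp add: nexp_sum m_def one_minus_nexp_integral)
    finally show "(\<integral>\<^sup>+N. \<psi> x * (indicator {j<..} (N i) * (\<Prod>k\<in>J. m x k ^ N k)) \<partial>counts) =
        count_tail j * (\<psi> x * nexp (\<Sum>i'\<in>J. ennreal c * mark u (q i + x - q i')))"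
      by (simp add: ac_simps)
  qed
  also have "\<dots> = count_tail j * (\<integral>\<^sup>+x. \<psi> x * nexp (\<Sum>i'\<in>J. ennreal c * mark u (q i + x - q i')) \<partial>displacement)"
  proof (rule nn_integral_cmult)
    have "(\<lambda>x. mark u (q i + x - q k)) \<in> borel_measurable displacement" for k
      by (rule measurable_compose[OF _ mark_measurable[OF \<open>u \<in> _\<close>]]) simp
    then show "(\<lambda>x. \<psi> x * nexp (\<Sum>i'\<in>J. ennreal c * mark u (q i + x - q i'))) \<in> borel_measurable displacement"
      by (intro borel_measurable_times_ennreal measurable_compose[OF _ nexp_measurable] borel_measurable_sum) auto
  qed
  finally show ?thesis .
qed

text \<open>Omitting cluster \<open>i\<close> as a whole makes the sum depend on the size and
  displacements of that cluster only through the observation point \<open>p\<close>.\<close>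

definition other_clusters ::
  "(plane \<Rightarrow> ennreal) \<Rightarrow> (nat \<Rightarrow> plane) \<Rightarrow> (nat \<Rightarrow> nat) \<Rightarrow> (nat \<times> nat \<Rightarrow> plane) \<Rightarrow> nat \<Rightarrow> plane \<Rightarrow> ennreal" where
  "other_clusters u q N d i p =
    (\<Sum>i'. if i' = i then 0 else \<Sum>j'. if j' < N i' then u (q i' + d (i', j') - p) else 0)"

lemma other_clusters_measurable:
  assumes [measurable]: "u \<in> borel_measurable borel"
    "\<And>i. (\<lambda>\<omega>. q \<omega> i) \<in> borel_measurable K" "\<And>i. (\<lambda>\<omega>. N \<omega> i) \<in> measurable K (count_space UNIV)"
    "\<And>k. (\<lambda>\<omega>. d \<omega> k) \<in> borel_measurable K" "p \<in> borel_measurable K"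
  shows "(\<lambda>\<omega>. other_clusters u (q \<omega>) (N \<omega>) (d \<omega>) i (p \<omega>)) \<in> borel_measurable K"
  unfolding other_clusters_def by measurable

text \<open>Every finite set of clusters gives an upper bound, as fewer interferers mean a larger
  \<open>nexp\<close>. Hence only the right-hand side has to be passed to the limit.\<close>

lemma cluster_le:
  assumes [measurable]: "u \<in> borel_measurable borel" "\<psi> \<in> borel_measurable borel" and \<psi>: "\<And>x. \<psi> x \<le> 1"
  shows "(\<integral>\<^sup>+N. \<integral>\<^sup>+d. indicator {j<..} (N i) * (\<psi> (d (i, j)) *
      nexp (other_clusters u q N d i (q i + d (i, j)))) \<partial>displacements \<partial>counts) \<le>
    count_tail j * (\<integral>\<^sup>+x. \<psi> x * nexp (\<Sum>i'. if i' = i then 0 else ennreal c * mark u (q i + x - q i')) \<partial>displacement)"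
    (is "?L \<le> _")
proof (rule LIMSEQ_le_const)
  let ?J = "\<lambda>n. {..<n} - {i}"
  have eq: "(\<Sum>i'\<in>?J n. h i') = (\<Sum>i'<n. if i' = i then 0 else h i')" for n and h :: "nat \<Rightarrow> ennreal"
    by (rule sum.mono_neutral_cong_left) auto
  show "(\<lambda>n. count_tail j * (\<integral>\<^sup>+x. \<psi> x * nexp (\<Sum>i'\<in>?J n. ennreal c * mark u (q i + x - q i')) \<partial>displacement)) \<longlonglongrightarrow>
      count_tail j * (\<integral>\<^sup>+x. \<psi> x * nexp (\<Sum>i'. if i' = i then 0 else ennreal c * mark u (q i + x - q i')) \<partial>displacement)"
  proof (rule ennreal_tendsto_cmult)
    have "count_tail j \<le> (\<integral>\<^sup>+n. 1 \<partial>measure_pmf (poisson_pmf c))"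
      unfolding count_tail_def by (intro nn_integral_mono) (simp split: split_indicator)
    then show "count_tail j < \<top>"
      by (simp add: le_less_trans)
    show "(\<lambda>n. \<integral>\<^sup>+x. \<psi> x * nexp (\<Sum>i'\<in>?J n. ennreal c * mark u (q i + x - q i')) \<partial>displacement) \<longlonglongrightarrow>
      (\<integral>\<^sup>+x. \<psi> x * nexp (\<Sum>i'. if i' = i then 0 else ennreal c * mark u (q i + x - q i')) \<partial>displacement)"
    proof (rule nn_integral_dominated_convergence[where w = "\<lambda>_. 1"])
      show "AE x in displacement. \<psi> x * nexp (\<Sum>i'\<in>?J n. ennreal c * mark u (q i + x - q i')) \<le> 1" for n
        using mult_mono[OF \<psi> nexp_le_1] by (intro AE_I2) simp
      have "\<psi> x < \<top>" for x using \<psi>[of x] by (simp add: le_less_trans)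
      then show "AE x in displacement. (\<lambda>n. \<psi> x * nexp (\<Sum>i'\<in>?J n. ennreal c * mark u (q i + x - q i'))) \<longlonglongrightarrow>
          \<psi> x * nexp (\<Sum>i'. if i' = i then 0 else ennreal c * mark u (q i + x - q i'))"
        unfolding eq by (intro AE_I2 ennreal_tendsto_cmult nexp_tendsto summable_LIMSEQ summableI)
    qed (use displacement.emeasure_space_1 in auto)
  qed
  have "?L \<le> count_tail j * (\<integral>\<^sup>+x. \<psi> x * nexp (\<Sum>i'\<in>?J n. ennreal c * mark u (q i + x - q i')) \<partial>displacement)" for n
  proof -
    have "(\<Sum>i'\<in>?J n. \<Sum>j'<N i'. u (q i' + d (i', j') - (q i + d (i, j)))) \<le> other_clusters u q N d i (q i + d (i, j))" for N d
    proof -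
      have inner: "(\<Sum>j'<N i'. u (q i' + d (i', j') - p)) = (\<Sum>j'. if j' < N i' then u (q i' + d (i', j') - p) else 0)" for i' p
        by (subst suminf_finite[of "{..<N i'}"]) (auto intro!: sum.cong)
      show ?thesis
        unfolding eq other_clusters_def inner by (rule sum_le_suminf[OF summableI]) auto
    qed
    then have "?L \<le> (\<integral>\<^sup>+N. \<integral>\<^sup>+d. indicator {j<..} (N i) * (\<psi> (d (i, j)) *
      nexp (\<Sum>i'\<in>?J n. \<Sum>j'<N i'. u (q i' + d (i', j') - (q i + d (i, j))))) \<partial>displacements \<partial>counts)"
      by (intro nn_integral_mono mult_left_mono nexp_antimono) auto
    also have "\<dots> = count_tail j * (\<integral>\<^sup>+x. \<psi> x * nexp (\<Sum>i'\<in>?J n. ennreal c * mark u (q i + x - q i')) \<partial>displacement)"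
      by (rule cluster_finite) auto
    finally show ?thesis .
  qed
  then show "\<exists>n0. \<forall>n\<ge>n0. ?L \<le> count_tail j * (\<integral>\<^sup>+x. \<psi> x * nexp (\<Sum>i'\<in>?J n. ennreal c * mark u (q i + x - q i')) \<partial>displacement)"
    by blast
qed

text \<open>A displacement with a density hits a value fixed by the other coordinates with
  probability 0. It ensures that distinct indices give distinct points.\<close>

lemma displacements_distinct:
  assumes "k \<noteq> k'"
  shows "(\<integral>\<^sup>+d. indicator {0} (a + d k - d k') \<partial>displacements) = 0"
proof -
  interpret pair_sigma_finite displacement displacements ..
  have "(\<integral>\<^sup>+d. indicator {0} (a + d k - d k') \<partial>displacements) =
      (\<integral>\<^sup>+x. \<integral>\<^sup>+d. indicator {0} (a + (d(k := x)) k - (d(k := x)) k') \<partial>displacements \<partial>displacement)"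
    by (rule nn_integral_PiM_split[OF displacement.prob_space_axioms]) measurable
  also have "\<dots> = (\<integral>\<^sup>+x. \<integral>\<^sup>+d. indicator {0} (a + x - d k') \<partial>displacements \<partial>displacement)"
    using assms by simp
  also have "\<dots> = (\<integral>\<^sup>+d. \<integral>\<^sup>+x. indicator {0} (a + x - d k') \<partial>displacement \<partial>displacements)"
  proof (rule Fubini'[symmetric])
    show "(\<lambda>(x, d). indicator {0} (a + x - d k') :: ennreal) \<in> borel_measurable (displacement \<Otimes>\<^sub>M displacements)"
      unfolding case_prod_beta by measurable
  qed
  also have "\<dots> = (\<integral>\<^sup>+d. 0 \<partial>displacements)"
  proof (rule nn_integral_cong)
    fix d
    have "AE x in lborel. x \<noteq> d k' - a" by (rule AE_lborel_singleton)
    then have "AE x in displacement. x \<noteq> d k' - a"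
      by (subst AE_density) auto
    then have "AE x in displacement. indicator {0} (a + x - d k') = (0 :: ennreal)"
      by eventually_elim (auto simp: algebra_simps split: split_indicator)
    then have "(\<integral>\<^sup>+x. indicator {0} (a + x - d k') \<partial>displacement) = (\<integral>\<^sup>+x. 0 \<partial>displacement)"
      by (rule nn_integral_cong_AE)
    then show "(\<integral>\<^sup>+x. indicator {0} (a + x - d k') \<partial>displacement) = 0" by simp
  qed
  finally show ?thesis by simp
qed

end

subsection \<open>Upper bound for Neyman-Scott transmitters\<close>

abbreviation mark_space :: "((nat \<Rightarrow> plane) \<times> (nat \<Rightarrow> nat) \<times> (nat \<times> nat \<Rightarrow> plane)) measure" where
  "mark_space \<equiv> Pi\<^sub>M UNIV (\<lambda>_. borel) \<Otimes>\<^sub>M (Pi\<^sub>M UNIV (\<lambda>_. count_space UNIV) \<Otimes>\<^sub>M Pi\<^sub>M UNIV (\<lambda>_. borel))"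

lemma parent_measurable [measurable]: "(\<lambda>p. fst p i) \<in> borel_measurable mark_space"
  by (rule measurable_compose[OF measurable_fst measurable_component_singleton[OF UNIV_I]])

lemma cluster_size_measurable [measurable]: "(\<lambda>p. fst (snd p) i) \<in> measurable mark_space (count_space UNIV)"
  by (rule measurable_compose[OF measurable_compose[OF measurable_snd measurable_fst] measurable_component_singleton[OF UNIV_I]])

lemma displacement_measurable [measurable]: "(\<lambda>p. snd (snd p) k) \<in> borel_measurable mark_space"
  by (rule measurable_compose[OF measurable_compose[OF measurable_snd measurable_snd] measurable_component_singleton[OF UNIV_I]])

lemma cluster_tail_measurable [measurable]:
  "(\<lambda>p. indicator {j<..} (fst (snd p) i) :: ennreal) \<in> borel_measurable mark_space"
  by (rule measurable_compose[OF cluster_size_measurable]) simp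

locale neyman_scott = poisson_cluster c f
  for c :: real and f :: "plane \<Rightarrow> real" +
  fixes M :: "'a measure" and lp :: real and \<Phi> Y :: "'a \<Rightarrow> plane set"
    and X :: "nat \<Rightarrow> 'a \<Rightarrow> plane" and N :: "nat \<Rightarrow> 'a \<Rightarrow> nat" and D :: "nat \<times> nat \<Rightarrow> 'a \<Rightarrow> plane"
  assumes lp_pos: "0 < lp" and process: "point_process M \<Phi>" and parents: "poisson_process M lp Y"
    and X_measurable [measurable]: "\<And>i. X i \<in> borel_measurable M"
    and N_measurable [measurable]: "\<And>i. N i \<in> measurable M (count_space UNIV)"
    and D_measurable [measurable]: "\<And>k. D k \<in> borel_measurable M"
    and enumeration: "AE \<omega> in M. bij_betw (\<lambda>i. X i \<omega>) UNIV (Y \<omega>)"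
    and law: "distr M
        (Pi\<^sub>M UNIV (\<lambda>_. borel) \<Otimes>\<^sub>M (Pi\<^sub>M UNIV (\<lambda>_. count_space UNIV) \<Otimes>\<^sub>M Pi\<^sub>M UNIV (\<lambda>_. borel)))
        (\<lambda>\<omega>. (\<lambda>i. X i \<omega>, \<lambda>i. N i \<omega>, \<lambda>k. D k \<omega>)) =
      distr M (Pi\<^sub>M UNIV (\<lambda>_. borel)) (\<lambda>\<omega> i. X i \<omega>) \<Otimes>\<^sub>M
        (Pi\<^sub>M UNIV (\<lambda>_. measure_pmf (poisson_pmf c)) \<Otimes>\<^sub>M
         Pi\<^sub>M UNIV (\<lambda>_. density lborel (\<lambda>x. ennreal (f x))))"
    and clusters: "AE \<omega> in M. \<Phi> \<omega> = (\<Union>i. {X i \<omega> + D (i, j) \<omega> | j. j < N i \<omega>})"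
begin

sublocale parents: homogeneous_poisson M lp Y
  using parents lp_pos by unfold_locales auto

text \<open>Turns the equation of laws into an iterated integral, so that sizes and displacements
  can be averaged with the parents held fixed.\<close>

lemma nn_integral_law:
  assumes G: "G \<in> borel_measurable mark_space"
  shows "(\<integral>\<^sup>+\<omega>. G (\<lambda>i. X i \<omega>, \<lambda>i. N i \<omega>, \<lambda>k. D k \<omega>) \<partial>M) =
    (\<integral>\<^sup>+\<omega>. \<integral>\<^sup>+n. \<integral>\<^sup>+d. G (\<lambda>i. X i \<omega>, n, d) \<partial>displacements \<partial>counts \<partial>M)"
proof -
  interpret cd: pair_prob_space counts displacements ..
  have X: "(\<lambda>\<omega> i. X i \<omega>) \<in> measurable M (Pi\<^sub>M UNIV (\<lambda>_. borel))"
    by (rule measurable_PiM_single') (auto simp: PiE_def)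
  have N: "(\<lambda>\<omega> i. N i \<omega>) \<in> measurable M (Pi\<^sub>M UNIV (\<lambda>_. count_space UNIV))"
    by (rule measurable_PiM_single') (auto simp: PiE_def)
  have D: "(\<lambda>\<omega> k. D k \<omega>) \<in> measurable M (Pi\<^sub>M UNIV (\<lambda>_. borel))"
    by (rule measurable_PiM_single') (auto simp: PiE_def)
  let ?PX = "distr M (Pi\<^sub>M UNIV (\<lambda>_. borel)) (\<lambda>\<omega> i. X i \<omega>)"
  \<comment> \<open>Equal measures have equal sigma-algebras, so \<open>law\<close> itself
    identifies the two product structures.\<close>
  have "sets mark_space = sets (?PX \<Otimes>\<^sub>M (counts \<Otimes>\<^sub>M displacements))"
    using arg_cong[OF law, of sets] by simp
  then have G': "G \<in> borel_measurable (?PX \<Otimes>\<^sub>M (counts \<Otimes>\<^sub>M displacements))"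
    using G measurable_cong_sets by blast
  have "(\<integral>\<^sup>+\<omega>. G (\<lambda>i. X i \<omega>, \<lambda>i. N i \<omega>, \<lambda>k. D k \<omega>) \<partial>M) =
      (\<integral>\<^sup>+p. G p \<partial>distr M mark_space (\<lambda>\<omega>. (\<lambda>i. X i \<omega>, \<lambda>i. N i \<omega>, \<lambda>k. D k \<omega>)))"
    using G X N D by (intro nn_integral_distr[symmetric] measurable_Pair) auto
  also have "\<dots> = (\<integral>\<^sup>+p. G p \<partial>(?PX \<Otimes>\<^sub>M (counts \<Otimes>\<^sub>M displacements)))"
    by (simp only: law)
  also have "\<dots> = (\<integral>\<^sup>+q. \<integral>\<^sup>+p. G (q, p) \<partial>(counts \<Otimes>\<^sub>M displacements) \<partial>?PX)"
    by (rule cd.nn_integral_fst[symmetric, OF G'])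
  also have "\<dots> = (\<integral>\<^sup>+\<omega>. \<integral>\<^sup>+p. G (\<lambda>i. X i \<omega>, p) \<partial>(counts \<Otimes>\<^sub>M displacements) \<partial>M)"
  proof (rule nn_integral_distr[OF X])
    have "(\<lambda>q. \<integral>\<^sup>+p. G (q, p) \<partial>(counts \<Otimes>\<^sub>M displacements)) \<in> borel_measurable ?PX"
      by (rule cd.borel_measurable_nn_integral_fst[OF G'])
    then show "(\<lambda>q. \<integral>\<^sup>+p. G (q, p) \<partial>(counts \<Otimes>\<^sub>M displacements)) \<in> borel_measurable (distr M (Pi\<^sub>M UNIV (\<lambda>_. borel)) (\<lambda>\<omega> i. X i \<omega>))"
      by simp
  qed
  also have "\<dots> = (\<integral>\<^sup>+\<omega>. \<integral>\<^sup>+n. \<integral>\<^sup>+d. G (\<lambda>i. X i \<omega>, n, d) \<partial>displacements \<partial>counts \<partial>M)"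
  proof (rule nn_integral_cong)
    fix \<omega> assume "\<omega> \<in> space M"
    then have "(\<lambda>i. X i \<omega>) \<in> space ?PX" using measurable_space[OF X] by simp
    then have "(\<lambda>p. G (\<lambda>i. X i \<omega>, p)) \<in> borel_measurable (counts \<Otimes>\<^sub>M displacements)"
      using G' by (rule measurable_compose_Pair1)
    then show "(\<integral>\<^sup>+p. G (\<lambda>i. X i \<omega>, p) \<partial>(counts \<Otimes>\<^sub>M displacements)) =
        (\<integral>\<^sup>+n. \<integral>\<^sup>+d. G (\<lambda>i. X i \<omega>, n, d) \<partial>displacements \<partial>counts)"
      by (rule displacements.nn_integral_fst[symmetric])
  qed
  finally show ?thesis .
qed

abbreviation unit_square :: "plane set" where
  "unit_square \<equiv> cbox 0 One"

definition cluster_point :: "'a \<Rightarrow> nat \<times> nat \<Rightarrow> plane" where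
  "cluster_point \<omega> k = X (fst k) \<omega> + D k \<omega>"

definition cluster_indices :: "'a \<Rightarrow> (nat \<times> nat) set" where
  "cluster_indices \<omega> = {k. snd k < N (fst k) \<omega>}"

lemma tail_measurable [measurable]: "(\<lambda>\<omega>. indicator {j<..} (N i \<omega>) :: ennreal) \<in> borel_measurable M"
  by (rule measurable_compose[OF N_measurable]) simp

text \<open>Configurations are sets, so a coincidence of two cluster points would be counted once.
  Excluding it makes sums over the points equal sums over the indices.\<close>

lemma points_distinct: "AE \<omega> in M. inj (cluster_point \<omega>)"
proof -
  have "AE \<omega> in M. k \<noteq> k' \<longrightarrow> cluster_point \<omega> k \<noteq> cluster_point \<omega> k'" for k k'
  proof (cases "k = k'")
    case False
    let ?G = "\<lambda>(q, n, d). indicator {0} ((q (fst k) - q (fst k')) + d k - d k') :: ennreal"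
    have "(\<integral>\<^sup>+\<omega>. ?G (\<lambda>i. X i \<omega>, \<lambda>i. N i \<omega>, \<lambda>k. D k \<omega>) \<partial>M) =
        (\<integral>\<^sup>+\<omega>. \<integral>\<^sup>+n. \<integral>\<^sup>+d. ?G (\<lambda>i. X i \<omega>, n, d) \<partial>displacements \<partial>counts \<partial>M)"
    proof (rule nn_integral_law)
        show "?G \<in> borel_measurable mark_space"
        unfolding case_prod_beta by measurable
    qed
    also have "\<dots> = 0"
      using displacements_distinct[OF False] by simp
    finally have "AE \<omega> in M. indicator {0} ((X (fst k) \<omega> - X (fst k') \<omega>) + D k \<omega> - D k' \<omega>) = (0 :: ennreal)"
      by (subst (asm) nn_integral_0_iff_AE) auto
    then show ?thesis
      by eventually_elim (auto simp: cluster_point_def algebra_simps split: split_indicator_asm)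
  qed simp
  then have "AE \<omega> in M. \<forall>k k'. k \<noteq> k' \<longrightarrow> cluster_point \<omega> k \<noteq> cluster_point \<omega> k'"
    unfolding AE_all_countable by blast
  then show ?thesis
    by eventually_elim (auto simp: inj_def)
qed

lemma \<Phi>_eq: "AE \<omega> in M. \<Phi> \<omega> = cluster_point \<omega> ` cluster_indices \<omega>"
  using clusters
proof eventually_elim
  case (elim \<omega>)
  show ?case
  proof (intro set_eqI iffI)
    fix x assume "x \<in> \<Phi> \<omega>"
    then obtain i j where "x = X i \<omega> + D (i, j) \<omega>" "j < N i \<omega>"
      unfolding elim by blast
    then show "x \<in> cluster_point \<omega> ` cluster_indices \<omega>"
      by (intro image_eqI[of _ _ "(i, j)"]) (simp_all add: cluster_point_def cluster_indices_def)
  next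
    fix x assume "x \<in> cluster_point \<omega> ` cluster_indices \<omega>"
    then obtain i j where "x = X i \<omega> + D (i, j) \<omega>" "j < N i \<omega>"
      by (auto simp: cluster_point_def cluster_indices_def)
    then show "x \<in> \<Phi> \<omega>"
      unfolding elim by blast
  qed
qed

lemma nn_integral_cluster_indices: "(\<integral>\<^sup>+k. h k \<partial>count_space (cluster_indices \<omega>)) = (\<Sum>i. \<Sum>j. if j < N i \<omega> then h (i, j) else 0)"
proof -
  have "(\<integral>\<^sup>+k. h k \<partial>count_space (cluster_indices \<omega>)) = (\<integral>\<^sup>+k. h k * indicator (cluster_indices \<omega>) k \<partial>count_space UNIV)"
    by (rule nn_integral_count_space_indicator) simp
  also have "\<dots> = (\<integral>\<^sup>+i. \<integral>\<^sup>+j. h (i, j) * indicator (cluster_indices \<omega>) (i, j) \<partial>count_space UNIV \<partial>count_space UNIV)"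
    by (rule nn_integral_fst_count_space[symmetric])
  also have "\<dots> = (\<Sum>i. \<Sum>j. if j < N i \<omega> then h (i, j) else 0)"
    unfolding nn_integral_count_space_nat by (intro suminf_cong) (simp add: cluster_indices_def)
  finally show ?thesis .
qed

lemma emeasure_unit_square: "emeasure lborel unit_square = 1"
  by (subst emeasure_lborel_cbox) auto

text \<open>The substitution p = X i + x places the typical point at a deterministic position and
  turns the displacement law into the weight f (p - X i) of the parent. The tails sum to
  \<open>c\<close> because nothing else depends on \<open>j\<close>.\<close>

lemma window_sum:
  assumes h: "\<And>i. (\<lambda>(\<omega>, p). h i \<omega> p) \<in> borel_measurable (M \<Otimes>\<^sub>M borel)"
  shows "(\<Sum>i. \<Sum>j. \<integral>\<^sup>+\<omega>. count_tail j * (\<integral>\<^sup>+x. indicator unit_square (X i \<omega> + x) * h i \<omega> (X i \<omega> + x) \<partial>displacement) \<partial>M) =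
    ennreal c * (\<integral>\<^sup>+p. indicator unit_square p * (\<integral>\<^sup>+\<omega>. (\<Sum>i. ennreal (f (p - X i \<omega>)) * h i \<omega> p) \<partial>M) \<partial>lborel)"
proof -
  interpret pair_sigma_finite M lborel ..
  define R where "R i \<omega> = (\<integral>\<^sup>+p. indicator unit_square p * (ennreal (f (p - X i \<omega>)) * h i \<omega> p) \<partial>lborel)" for i \<omega>
  have [measurable]: "(\<lambda>p. h i (fst p) (snd p)) \<in> borel_measurable (M \<Otimes>\<^sub>M borel)" for i
    using h[of i] by (simp add: case_prod_beta)
  have [measurable]: "(\<lambda>p. ennreal (f (snd p - X i (fst p)))) \<in> borel_measurable (M \<Otimes>\<^sub>M borel)" for i
    by measurable
  have joint: "(\<lambda>(\<omega>, p). indicator unit_square p * (ennreal (f (p - X i \<omega>)) * h i \<omega> p)) \<in> borel_measurable (M \<Otimes>\<^sub>M lborel)" for i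
    unfolding case_prod_beta by measurable
  have slice: "h i \<omega> \<in> borel_measurable borel" if "\<omega> \<in> space M" for i \<omega>
    using measurable_compose_Pair1[OF that h[of i]] by simp
  have R_measurable [measurable]: "R i \<in> borel_measurable M" for i
    using lborel.borel_measurable_nn_integral_fst[OF joint[of i]] by (simp add: R_def[abs_def])
  have R: "(\<integral>\<^sup>+x. indicator unit_square (X i \<omega> + x) * h i \<omega> (X i \<omega> + x) \<partial>displacement) = R i \<omega>" if "\<omega> \<in> space M" for i \<omega>
  proof -
    note [measurable] = slice[OF that, of i]
    have "(\<integral>\<^sup>+x. indicator unit_square (X i \<omega> + x) * h i \<omega> (X i \<omega> + x) \<partial>displacement) =
        (\<integral>\<^sup>+x. ennreal (f x) * (indicator unit_square (X i \<omega> + x) * h i \<omega> (X i \<omega> + x)) \<partial>lborel)"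
      by (subst nn_integral_density) auto
    also have "\<dots> = (\<integral>\<^sup>+p. (\<lambda>x. ennreal (f x) * (indicator unit_square (X i \<omega> + x) * h i \<omega> (X i \<omega> + x))) (p - X i \<omega>) \<partial>lborel)"
      by (rule nn_integral_lborel_shift[symmetric]) measurable
    also have "\<dots> = R i \<omega>"
      unfolding R_def by (intro nn_integral_cong) (simp add: ac_simps)
    finally show ?thesis .
  qed
  have "(\<Sum>i. \<Sum>j. \<integral>\<^sup>+\<omega>. count_tail j * (\<integral>\<^sup>+x. indicator unit_square (X i \<omega> + x) * h i \<omega> (X i \<omega> + x) \<partial>displacement) \<partial>M) =
      (\<Sum>i. \<Sum>j. \<integral>\<^sup>+\<omega>. count_tail j * R i \<omega> \<partial>M)"
    by (intro suminf_cong nn_integral_cong) (simp add: R)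
  also have "\<dots> = (\<Sum>i. ennreal c * (\<integral>\<^sup>+\<omega>. R i \<omega> \<partial>M))"
    by (simp add: nn_integral_cmult ennreal_suminf_multc suminf_count_tail)
  also have "\<dots> = ennreal c * (\<integral>\<^sup>+\<omega>. (\<Sum>i. R i \<omega>) \<partial>M)"
    by (simp add: ennreal_suminf_cmult nn_integral_suminf)
  also have "(\<integral>\<^sup>+\<omega>. (\<Sum>i. R i \<omega>) \<partial>M) = (\<integral>\<^sup>+\<omega>. \<integral>\<^sup>+p. (\<Sum>i. indicator unit_square p * (ennreal (f (p - X i \<omega>)) * h i \<omega> p)) \<partial>lborel \<partial>M)"
  proof (rule nn_integral_cong)
    fix \<omega> assume \<omega>: "\<omega> \<in> space M"
    have shifted: "(\<lambda>x. ennreal (f (x - a))) \<in> borel_measurable borel" for a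
      by measurable
    show "(\<Sum>i. R i \<omega>) = (\<integral>\<^sup>+p. (\<Sum>i. indicator unit_square p * (ennreal (f (p - X i \<omega>)) * h i \<omega> p)) \<partial>lborel)"
      unfolding R_def using slice[OF \<omega>] shifted
      by (intro nn_integral_suminf[symmetric]) (auto intro!: borel_measurable_times_ennreal)
  qed
  also have "\<dots> = (\<integral>\<^sup>+p. \<integral>\<^sup>+\<omega>. (\<Sum>i. indicator unit_square p * (ennreal (f (p - X i \<omega>)) * h i \<omega> p)) \<partial>M \<partial>lborel)"
  proof (rule Fubini'[symmetric])
    show "(\<lambda>(\<omega>, p). \<Sum>i. indicator unit_square p * (ennreal (f (p - X i \<omega>)) * h i \<omega> p)) \<in> borel_measurable (M \<Otimes>\<^sub>M lborel)"
      unfolding case_prod_beta by measurable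
  qed
  also have "\<dots> = (\<integral>\<^sup>+p. indicator unit_square p * (\<integral>\<^sup>+\<omega>. (\<Sum>i. ennreal (f (p - X i \<omega>)) * h i \<omega> p) \<partial>M) \<partial>lborel)"
  proof (rule nn_integral_cong)
    fix p :: plane
    have [measurable]: "(\<lambda>\<omega>. h i \<omega> p) \<in> borel_measurable M" for i
      using measurable_compose[OF measurable_Pair2'[of p borel M] h[of i]] by simp
    have "(\<integral>\<^sup>+\<omega>. (\<Sum>i. indicator unit_square p * (ennreal (f (p - X i \<omega>)) * h i \<omega> p)) \<partial>M) =
        (\<integral>\<^sup>+\<omega>. indicator unit_square p * (\<Sum>i. ennreal (f (p - X i \<omega>)) * h i \<omega> p) \<partial>M)"
      by (simp add: ennreal_suminf_cmult)
    also have "\<dots> = indicator unit_square p * (\<integral>\<^sup>+\<omega>. (\<Sum>i. ennreal (f (p - X i \<omega>)) * h i \<omega> p) \<partial>M)"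
      by (rule nn_integral_cmult) measurable
    finally show "(\<integral>\<^sup>+\<omega>. (\<Sum>i. indicator unit_square p * (ennreal (f (p - X i \<omega>)) * h i \<omega> p)) \<partial>M) =
        indicator unit_square p * (\<integral>\<^sup>+\<omega>. (\<Sum>i. ennreal (f (p - X i \<omega>)) * h i \<omega> p) \<partial>M)" .
  qed
  finally show ?thesis .
qed

lemma f_integral_reflect: "(\<integral>\<^sup>+x. ennreal (f (p - x)) \<partial>lborel) = 1"
proof -
  have "f (p - x) = f (x - p)" for x
    using f_minus[of "x - p"] by simp
  then show ?thesis
    using nn_integral_lborel_shift[of "\<lambda>x. ennreal (f x)" p] by (simp add: f_integral)
qed

lemma sum_parents:
  assumes "bij_betw (\<lambda>i. X i \<omega>) UNIV (Y \<omega>)"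
  shows "(\<Sum>i. h (X i \<omega>)) = (\<integral>\<^sup>+x. h x \<partial>count_space (Y \<omega>))"
  using nn_integral_bij_count_space[OF assms, of h] by (simp add: nn_integral_count_space_nat)

lemma sum_other_parents:
  assumes "bij_betw (\<lambda>i. X i \<omega>) UNIV (Y \<omega>)"
  shows "(\<Sum>i'. if i' = i then 0 else h (X i' \<omega>)) = (\<integral>\<^sup>+x. h x \<partial>count_space (Y \<omega> - {X i \<omega>}))"
proof -
  have bij: "bij_betw (\<lambda>i. X i \<omega>) (UNIV - {i}) (Y \<omega> - {X i \<omega>})"
    using assms by (auto simp: bij_betw_def inj_on_def)
  have "(\<Sum>i'. if i' = i then 0 else h (X i' \<omega>)) = (\<integral>\<^sup>+i'. h (X i' \<omega>) * indicator (- {i}) i' \<partial>count_space UNIV)"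
    unfolding nn_integral_count_space_nat by (intro suminf_cong) simp
  also have "\<dots> = (\<integral>\<^sup>+i'. h (X i' \<omega>) \<partial>count_space (UNIV - {i}))"
    by (rule count_integral_Diff[symmetric])
  also have "\<dots> = (\<integral>\<^sup>+x. h x \<partial>count_space (Y \<omega> - {X i \<omega>}))"
    by (rule nn_integral_bij_count_space[OF bij])
  finally show ?thesis .
qed

lemma intensity_eq: "intensity M \<Phi> = ennreal c * ennreal lp"
proof -
  have \<Phi>: "\<Phi> \<in> measurable M configs" using process by (simp add: point_process_def)
  have "intensity M \<Phi> = (\<integral>\<^sup>+\<omega>. (\<Sum>i. \<Sum>j. indicator {j<..} (N i \<omega>) * indicator unit_square (X i \<omega> + D (i, j) \<omega>)) \<partial>M)"
    unfolding intensity_def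
  proof (rule nn_integral_cong_AE)
    have "AE \<omega> in M. \<omega> \<in> space M" by simp
    with points_distinct \<Phi>_eq
    show "AE \<omega> in M. of_nat (card (\<Phi> \<omega> \<inter> unit_square)) = (\<Sum>i. \<Sum>j. indicator {j<..} (N i \<omega>) * indicator unit_square (X i \<omega> + D (i, j) \<omega>) :: ennreal)"
    proof eventually_elim
      case (elim \<omega>)
      have "finite (\<Phi> \<omega> \<inter> unit_square)"
        using measurable_space[OF \<Phi> elim(3)] by (simp add: space_configs locally_finite_def)
      then have "of_nat (card (\<Phi> \<omega> \<inter> unit_square)) = (\<integral>\<^sup>+x. indicator unit_square x \<partial>count_space (\<Phi> \<omega>))"
        by (simp add: count_integral_indicator)
      also have "\<dots> = (\<integral>\<^sup>+k. indicator unit_square (cluster_point \<omega> k) \<partial>count_space (cluster_indices \<omega>))"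
        using elim(1) unfolding elim(2)
        by (intro nn_integral_bij_count_space[symmetric]) (auto simp: bij_betw_def intro: inj_on_subset)
      also have "\<dots> = (\<Sum>i. \<Sum>j. indicator {j<..} (N i \<omega>) * indicator unit_square (X i \<omega> + D (i, j) \<omega>))"
        unfolding nn_integral_cluster_indices cluster_point_def by (intro suminf_cong) (auto split: split_indicator)
      finally show ?case .
    qed
  qed
  also have "\<dots> = (\<Sum>i. \<integral>\<^sup>+\<omega>. (\<Sum>j. indicator {j<..} (N i \<omega>) * indicator unit_square (X i \<omega> + D (i, j) \<omega>)) \<partial>M)"
    by (rule nn_integral_suminf) measurable
  also have "\<dots> = (\<Sum>i. \<Sum>j. \<integral>\<^sup>+\<omega>. indicator {j<..} (N i \<omega>) * indicator unit_square (X i \<omega> + D (i, j) \<omega>) \<partial>M)"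
    by (intro suminf_cong nn_integral_suminf borel_measurable_times_ennreal tail_measurable) measurable
  \<comment> \<open>The same computation as for the Palm sum, with \<open>J = {}\<close> so that no
    cluster is weighted and with 1 in the place of \<open>h\<close> in
    \<open>window_sum\<close>.\<close>
  also have "\<dots> = (\<Sum>i. \<Sum>j. \<integral>\<^sup>+\<omega>. count_tail j * (\<integral>\<^sup>+x. indicator unit_square (X i \<omega> + x) * 1 \<partial>displacement) \<partial>M)"
  proof (intro suminf_cong)
    fix i j :: nat
    let ?G = "\<lambda>(q, n, d). indicator {j<..} (n i) * indicator unit_square (q i + d (i, j)) :: ennreal"
    have "?G \<in> borel_measurable mark_space"
      unfolding case_prod_beta by measurable
    then have "(\<integral>\<^sup>+\<omega>. ?G (\<lambda>i. X i \<omega>, \<lambda>i. N i \<omega>, \<lambda>k. D k \<omega>) \<partial>M) =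
        (\<integral>\<^sup>+\<omega>. \<integral>\<^sup>+n. \<integral>\<^sup>+d. ?G (\<lambda>i. X i \<omega>, n, d) \<partial>displacements \<partial>counts \<partial>M)"
      by (rule nn_integral_law)
    also have "\<dots> = (\<integral>\<^sup>+\<omega>. count_tail j * (\<integral>\<^sup>+x. indicator unit_square (X i \<omega> + x) * 1 \<partial>displacement) \<partial>M)"
      using cluster_finite[of "{}" i "\<lambda>_. 0" "\<lambda>x. indicator unit_square (X i \<omega> + x)" j for \<omega>]
      by (intro nn_integral_cong) simp
    finally show "(\<integral>\<^sup>+\<omega>. indicator {j<..} (N i \<omega>) * indicator unit_square (X i \<omega> + D (i, j) \<omega>) \<partial>M) =
        (\<integral>\<^sup>+\<omega>. count_tail j * (\<integral>\<^sup>+x. indicator unit_square (X i \<omega> + x) * 1 \<partial>displacement) \<partial>M)"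
      by simp
  qed
  also have "\<dots> = ennreal c * (\<integral>\<^sup>+p. indicator unit_square p * (\<integral>\<^sup>+\<omega>. (\<Sum>i. ennreal (f (p - X i \<omega>)) * 1) \<partial>M) \<partial>lborel)"
    by (rule window_sum) simp
  also have "\<dots> = ennreal c * (\<integral>\<^sup>+p. indicator unit_square p * ennreal lp \<partial>lborel)"
  proof -
    have "(\<integral>\<^sup>+\<omega>. (\<Sum>i. ennreal (f (p - X i \<omega>)) * 1) \<partial>M) = ennreal lp" for p
    proof -
      have "(\<integral>\<^sup>+\<omega>. (\<Sum>i. ennreal (f (p - X i \<omega>)) * 1) \<partial>M) = (\<integral>\<^sup>+\<omega>. \<integral>\<^sup>+x. ennreal (f (p - x)) \<partial>count_space (Y \<omega>) \<partial>M)"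
        using enumeration by (intro nn_integral_cong_AE) (auto elim!: eventually_mono simp: sum_parents[where h = "\<lambda>x. ennreal (f (p - x))"])
      also have "\<dots> = ennreal lp * (\<integral>\<^sup>+x. ennreal (f (p - x)) \<partial>lborel)"
        by (rule parents.campbell) measurable
      finally show ?thesis by (simp add: f_integral_reflect)
    qed
    then show ?thesis by simp
  qed
  also have "\<dots> = ennreal c * ennreal lp"
    by (simp add: nn_integral_multc emeasure_unit_square)
  finally show ?thesis .
qed

text \<open>The factor \<open>ennreal c * ennreal lp\<close> is the intensity and cancels in the
  Palm average; what remains is the exponential functional of a Poisson process with the reduced
  intensity.\<close>

lemma cluster_sum_le:
  assumes [measurable]: "u \<in> borel_measurable borel" and B: "0 \<le> B" "\<And>y. mark u y \<le> ennreal B"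
  shows "(\<integral>\<^sup>+\<omega>. \<integral>\<^sup>+x. nexp (\<integral>\<^sup>+y. u (y - x) \<partial>count_space (\<Phi> \<omega> - {x})) * indicator unit_square x \<partial>count_space (\<Phi> \<omega>) \<partial>M) \<le>
    ennreal c * ennreal lp * nexp (ennreal (lp * c / (1 + c * B)) * (\<integral>\<^sup>+a. 1 - nexp (u a) \<partial>lborel))"
proof -
  define h where "h i \<omega> p = nexp (\<Sum>i'. if i' = i then 0 else ennreal c * mark u (p - X i' \<omega>))" for i \<omega> p
  define L where "L = nexp (ennreal (lp * c / (1 + c * B)) * (\<integral>\<^sup>+a. 1 - nexp (u a) \<partial>lborel))"
  let ?oc = "\<lambda>i j \<omega>. other_clusters u (\<lambda>i. X i \<omega>) (\<lambda>i. N i \<omega>) (\<lambda>k. D k \<omega>) i (X i \<omega> + D (i, j) \<omega>)"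
  have [measurable]: "?oc i j \<in> borel_measurable M" for i j
    by (rule other_clusters_measurable) auto
  have "(\<integral>\<^sup>+\<omega>. \<integral>\<^sup>+x. nexp (\<integral>\<^sup>+y. u (y - x) \<partial>count_space (\<Phi> \<omega> - {x})) * indicator unit_square x \<partial>count_space (\<Phi> \<omega>) \<partial>M) \<le>
      (\<integral>\<^sup>+\<omega>. (\<Sum>i. \<Sum>j. indicator {j<..} (N i \<omega>) * (indicator unit_square (X i \<omega> + D (i, j) \<omega>) * nexp (?oc i j \<omega>))) \<partial>M)"
  proof (rule nn_integral_mono_AE)
    show "AE \<omega> in M. (\<integral>\<^sup>+x. nexp (\<integral>\<^sup>+y. u (y - x) \<partial>count_space (\<Phi> \<omega> - {x})) * indicator unit_square x \<partial>count_space (\<Phi> \<omega>)) \<le>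
        (\<Sum>i. \<Sum>j. indicator {j<..} (N i \<omega>) * (indicator unit_square (X i \<omega> + D (i, j) \<omega>) * nexp (?oc i j \<omega>)))"
      using points_distinct \<Phi>_eq
    proof eventually_elim
      case (elim \<omega>)
      have bij: "bij_betw (cluster_point \<omega>) (cluster_indices \<omega>) (\<Phi> \<omega>)"
        using elim(1) unfolding elim(2) by (auto simp: bij_betw_def intro: inj_on_subset)
      have "(\<integral>\<^sup>+x. nexp (\<integral>\<^sup>+y. u (y - x) \<partial>count_space (\<Phi> \<omega> - {x})) * indicator unit_square x \<partial>count_space (\<Phi> \<omega>)) =
          (\<integral>\<^sup>+k. nexp (\<integral>\<^sup>+y. u (y - cluster_point \<omega> k) \<partial>count_space (\<Phi> \<omega> - {cluster_point \<omega> k})) * indicator unit_square (cluster_point \<omega> k) \<partial>count_space (cluster_indices \<omega>))"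
        by (rule nn_integral_bij_count_space[OF bij, symmetric])
      also have "\<dots> \<le> (\<integral>\<^sup>+k. indicator unit_square (cluster_point \<omega> k) * nexp (?oc (fst k) (snd k) \<omega>) \<partial>count_space (cluster_indices \<omega>))"
      proof (rule nn_integral_mono)
        fix k assume "k \<in> space (count_space (cluster_indices \<omega>))"
        then have bij': "bij_betw (cluster_point \<omega>) (cluster_indices \<omega> - {k}) (\<Phi> \<omega> - {cluster_point \<omega> k})"
          using elim(1) unfolding elim(2) by (auto simp: bij_betw_def image_set_diff intro: inj_on_subset)
        have "?oc (fst k) (snd k) \<omega> = (\<integral>\<^sup>+k'. (if fst k' = fst k then 0 else u (cluster_point \<omega> k' - cluster_point \<omega> k)) \<partial>count_space (cluster_indices \<omega>))"
          unfolding nn_integral_cluster_indices other_clusters_def cluster_point_def by (intro suminf_cong) (simp cong: if_cong)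
        also have "\<dots> \<le> (\<integral>\<^sup>+k'. u (cluster_point \<omega> k' - cluster_point \<omega> k) * indicator (- {k}) k' \<partial>count_space (cluster_indices \<omega>))"
          by (intro nn_integral_mono) (auto split: split_indicator)
        also have "\<dots> = (\<integral>\<^sup>+k'. u (cluster_point \<omega> k' - cluster_point \<omega> k) \<partial>count_space (cluster_indices \<omega> - {k}))"
          by (rule count_integral_Diff[symmetric])
        also have "\<dots> = (\<integral>\<^sup>+y. u (y - cluster_point \<omega> k) \<partial>count_space (\<Phi> \<omega> - {cluster_point \<omega> k}))"
          by (rule nn_integral_bij_count_space[OF bij'])
        finally show "nexp (\<integral>\<^sup>+y. u (y - cluster_point \<omega> k) \<partial>count_space (\<Phi> \<omega> - {cluster_point \<omega> k})) * indicator unit_square (cluster_point \<omega> k) \<le>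
            indicator unit_square (cluster_point \<omega> k) * nexp (?oc (fst k) (snd k) \<omega>)"
          by (subst mult.commute) (intro mult_left_mono nexp_antimono, auto)
      qed
      also have "\<dots> = (\<Sum>i. \<Sum>j. indicator {j<..} (N i \<omega>) * (indicator unit_square (X i \<omega> + D (i, j) \<omega>) * nexp (?oc i j \<omega>)))"
        unfolding nn_integral_cluster_indices cluster_point_def by (intro suminf_cong) (auto split: split_indicator)
      finally show ?case .
    qed
  qed
  also have "\<dots> = (\<Sum>i. \<integral>\<^sup>+\<omega>. (\<Sum>j. indicator {j<..} (N i \<omega>) * (indicator unit_square (X i \<omega> + D (i, j) \<omega>) * nexp (?oc i j \<omega>))) \<partial>M)"
    by (rule nn_integral_suminf) measurable
  also have "\<dots> = (\<Sum>i. \<Sum>j. \<integral>\<^sup>+\<omega>. indicator {j<..} (N i \<omega>) * (indicator unit_square (X i \<omega> + D (i, j) \<omega>) * nexp (?oc i j \<omega>)) \<partial>M)"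
    by (intro suminf_cong nn_integral_suminf borel_measurable_times_ennreal tail_measurable) measurable
  also have "\<dots> \<le> (\<Sum>i. \<Sum>j. \<integral>\<^sup>+\<omega>. count_tail j * (\<integral>\<^sup>+x. indicator unit_square (X i \<omega> + x) * h i \<omega> (X i \<omega> + x) \<partial>displacement) \<partial>M)"
  proof (intro suminf_le summableI)
    fix i j :: nat
    let ?G = "\<lambda>(q, n, d). indicator {j<..} (n i) * (indicator unit_square (q i + d (i, j)) * nexp (other_clusters u q n d i (q i + d (i, j))))"
    have oc: "(\<lambda>p. other_clusters u (fst p) (fst (snd p)) (snd (snd p)) i (fst p i + snd (snd p) (i, j))) \<in> borel_measurable mark_space"
      by (rule other_clusters_measurable) auto
    have "?G \<in> borel_measurable mark_space"
      unfolding case_prod_beta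
      by (intro borel_measurable_times_ennreal cluster_tail_measurable measurable_compose[OF oc nexp_measurable]) measurable
    then have "(\<integral>\<^sup>+\<omega>. ?G (\<lambda>i. X i \<omega>, \<lambda>i. N i \<omega>, \<lambda>k. D k \<omega>) \<partial>M) =
        (\<integral>\<^sup>+\<omega>. \<integral>\<^sup>+n. \<integral>\<^sup>+d. ?G (\<lambda>i. X i \<omega>, n, d) \<partial>displacements \<partial>counts \<partial>M)"
      by (rule nn_integral_law)
    also have "\<dots> \<le> (\<integral>\<^sup>+\<omega>. count_tail j * (\<integral>\<^sup>+x. indicator unit_square (X i \<omega> + x) * h i \<omega> (X i \<omega> + x) \<partial>displacement) \<partial>M)"
    proof (rule nn_integral_mono)
      fix \<omega>
      show "(\<integral>\<^sup>+n. \<integral>\<^sup>+d. ?G (\<lambda>i. X i \<omega>, n, d) \<partial>displacements \<partial>counts) \<le>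
          count_tail j * (\<integral>\<^sup>+x. indicator unit_square (X i \<omega> + x) * h i \<omega> (X i \<omega> + x) \<partial>displacement)"
        unfolding h_def prod.case by (rule cluster_le) (auto simp: indicator_def)
    qed
    finally show "(\<integral>\<^sup>+\<omega>. indicator {j<..} (N i \<omega>) * (indicator unit_square (X i \<omega> + D (i, j) \<omega>) * nexp (?oc i j \<omega>)) \<partial>M) \<le>
        (\<integral>\<^sup>+\<omega>. count_tail j * (\<integral>\<^sup>+x. indicator unit_square (X i \<omega> + x) * h i \<omega> (X i \<omega> + x) \<partial>displacement) \<partial>M)"
      by simp
  qed
  also have "\<dots> = ennreal c * (\<integral>\<^sup>+p. indicator unit_square p * (\<integral>\<^sup>+\<omega>. (\<Sum>i. ennreal (f (p - X i \<omega>)) * h i \<omega> p) \<partial>M) \<partial>lborel)"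
  proof (rule window_sum)
    have [measurable]: "(\<lambda>p. mark u (snd p - X i' (fst p))) \<in> borel_measurable (M \<Otimes>\<^sub>M borel)" for i'
      by (rule measurable_compose[OF _ mark_measurable[OF assms(1)]]) measurable
    show "(\<lambda>(\<omega>, p). h i \<omega> p) \<in> borel_measurable (M \<Otimes>\<^sub>M borel)" for i
      unfolding h_def case_prod_beta by measurable
  qed
  also have "\<dots> \<le> ennreal c * (\<integral>\<^sup>+p. indicator unit_square p * (ennreal lp * L) \<partial>lborel)"
  proof (intro mult_left_mono nn_integral_mono)
    fix p :: plane
    \<comment> \<open>Fubini, translation invariance and total mass 1 of the displacement: spreading
      the points around their parents does not change the integrated loss. This is the identity for
      the integral of \<open>\<beta>\<close>.\<close>
    have shift: "(\<integral>\<^sup>+y. mark u (p - y) \<partial>lborel) = (\<integral>\<^sup>+a. 1 - nexp (u a) \<partial>lborel)"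
    proof -
      interpret pair_sigma_finite lborel displacement ..
      have "(\<integral>\<^sup>+y. mark u (p - y) \<partial>lborel) = (\<integral>\<^sup>+x. \<integral>\<^sup>+y. 1 - nexp (u (x - (p - y))) \<partial>lborel \<partial>displacement)"
        unfolding mark_def by (rule Fubini'[symmetric]) measurable
      also have "\<dots> = (\<integral>\<^sup>+x. \<integral>\<^sup>+a. 1 - nexp (u a) \<partial>lborel \<partial>displacement)"
      proof (rule nn_integral_cong)
        fix x
        show "(\<integral>\<^sup>+y. 1 - nexp (u (x - (p - y))) \<partial>lborel) = (\<integral>\<^sup>+a. 1 - nexp (u a) \<partial>lborel)"
          using nn_integral_lborel_shift[of "\<lambda>a. 1 - nexp (u a)" "p - x"] by (simp add: algebra_simps)
      qed
      finally show ?thesis using displacement.emeasure_space_1 by simp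
    qed
    \<comment> \<open>From exp t \<ge> 1 + t with t = c r, followed by r \<le> B in the denominator
      only.\<close>
    have mark_bound: "ennreal (c / (1 + c * B)) * mark u y \<le> 1 - nexp (ennreal c * mark u y)" for y
    proof -
      obtain r where r: "mark u y = ennreal r" "0 \<le> r"
        using mark_le_1[of u y] by (cases "mark u y") (auto simp: top_unique)
      have rB: "r \<le> B" using B(2)[of y] r B(1) by simp
      have "exp (- (c * r)) \<le> 1 / (1 + c * r)"
        using exp_ge_add_one_self[of "c * r"] c_pos r by (simp add: exp_minus divide_simps add_pos_nonneg)
      moreover have "c * r / (1 + c * r) = 1 - 1 / (1 + c * r)"
      proof -
        have "1 + c * r \<noteq> 0" using c_pos r by (simp add: add_pos_nonneg less_imp_neq[symmetric])
        then show ?thesis by (simp add: field_simps)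
      qed
      ultimately have "c * r / (1 + c * r) \<le> 1 - exp (- (c * r))"
        by linarith
      moreover have "c * r / (1 + c * B) \<le> c * r / (1 + c * r)"
        using c_pos r rB B(1) by (intro divide_left_mono mult_pos_pos add_pos_nonneg) auto
      ultimately show ?thesis
        using c_pos r B(1) by (simp add: nexp_ennreal ennreal_minus ennreal_mult[symmetric] flip: ennreal_1)
    qed
    \<comment> \<open>With \<open>p\<close> fixed, every parent sees the same weight
      \<open>ennreal c * mark u (p - y)\<close>, which is the form that \<open>mecke_le\<close>
      accepts. That weight is at most \<open>c\<close>, hence finite even where \<open>u\<close> is
      not.\<close>
    have "(\<integral>\<^sup>+\<omega>. (\<Sum>i. ennreal (f (p - X i \<omega>)) * h i \<omega> p) \<partial>M) =
        (\<integral>\<^sup>+\<omega>. \<integral>\<^sup>+x. ennreal (f (p - x)) * nexp (\<integral>\<^sup>+y. ennreal c * mark u (p - y) \<partial>count_space (Y \<omega> - {x})) \<partial>count_space (Y \<omega>) \<partial>M)"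
    proof (rule nn_integral_cong_AE)
      show "AE \<omega> in M. (\<Sum>i. ennreal (f (p - X i \<omega>)) * h i \<omega> p) =
          (\<integral>\<^sup>+x. ennreal (f (p - x)) * nexp (\<integral>\<^sup>+y. ennreal c * mark u (p - y) \<partial>count_space (Y \<omega> - {x})) \<partial>count_space (Y \<omega>))"
        using enumeration
        proof eventually_elim
          case (elim \<omega>)
          show ?case
            unfolding h_def sum_other_parents[OF elim, where h = "\<lambda>y. ennreal c * mark u (p - y)"]
            by (rule sum_parents[OF elim])
        qed
    qed
    also have "\<dots> \<le> ennreal lp * (\<integral>\<^sup>+x. ennreal (f (p - x)) \<partial>lborel) * nexp (ennreal lp * (\<integral>\<^sup>+y. 1 - nexp (ennreal c * mark u (p - y)) \<partial>lborel))"
    proof (rule parents.mecke_le)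
      have "mark u y < \<top>" for y using mark_le_1[of u y] by (simp add: le_less_trans)
      then show "ennreal c * mark u (p - x) < \<top>" for x by (simp add: ennreal_mult_less_top)
      show "(\<lambda>y. ennreal c * mark u (p - y)) \<in> borel_measurable borel"
        by (intro borel_measurable_times_ennreal measurable_compose[OF _ mark_measurable[OF assms(1)]]) auto
    qed measurable
    also have "\<dots> \<le> ennreal lp * L"
    proof -
      have "ennreal (lp * c / (1 + c * B)) * (\<integral>\<^sup>+a. 1 - nexp (u a) \<partial>lborel) =
          ennreal lp * (ennreal (c / (1 + c * B)) * (\<integral>\<^sup>+y. mark u (p - y) \<partial>lborel))"
        using lp_pos c_pos B(1) by (simp add: shift ennreal_mult[symmetric] mult.assoc[symmetric])
      also have "\<dots> = ennreal lp * (\<integral>\<^sup>+y. ennreal (c / (1 + c * B)) * mark u (p - y) \<partial>lborel)"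
        by (subst nn_integral_cmult) (auto intro!: measurable_compose[OF _ mark_measurable])
      also have "\<dots> \<le> ennreal lp * (\<integral>\<^sup>+y. 1 - nexp (ennreal c * mark u (p - y)) \<partial>lborel)"
        by (intro mult_left_mono nn_integral_mono mark_bound) auto
      finally show ?thesis
        unfolding f_integral_reflect L_def by (simp add: mult_left_mono nexp_antimono)
    qed
    finally show "(\<integral>\<^sup>+\<omega>. (\<Sum>i. ennreal (f (p - X i \<omega>)) * h i \<omega> p) \<partial>M) \<le> ennreal lp * L" .
  qed simp_all
  also have "\<dots> = ennreal c * ennreal lp * L"
    by (simp add: nn_integral_multc emeasure_unit_square mult.assoc)
  finally show ?thesis unfolding L_def .
qed

end

subsection \<open>Rotation invariance and the comparison\<close>

text \<open>The preimage of a box is its image under the inverse map, again orthogonal and therefore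
  measure preserving; boxes determine Lebesgue measure.\<close>

lemma lborel_distr_orthogonal:
  fixes \<rho> :: "plane \<Rightarrow> plane"
  assumes \<rho>: "orthogonal_transformation \<rho>"
  shows "distr lborel borel \<rho> = lborel"
proof (rule lborel_eqI[symmetric])
  have [measurable]: "\<rho> \<in> borel_measurable borel"
    using orthogonal_transformation_linear[OF \<rho>]
    by (intro borel_measurable_continuous_onI linear_continuous_on linear_conv_bounded_linear[THEN iffD1])
  fix l u :: plane assume lu: "\<And>b. b \<in> Basis \<Longrightarrow> l \<bullet> b \<le> u \<bullet> b"
  have box: "box l u \<in> lmeasurable"
    by simp
  have inv: "orthogonal_transformation (inv \<rho>)"
    by (rule orthogonal_transformation_inv[OF \<rho>])
  have vimage: "\<rho> -` box l u = inv \<rho> ` box l u"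
    by (rule bij_vimage_eq_inv_image[OF orthogonal_transformation_bij[OF \<rho>]])
  have borel: "\<rho> -` box l u \<in> sets borel"
    using measurable_sets[OF \<open>\<rho> \<in> _\<close>, of "box l u"] by simp
  have "emeasure (distr lborel borel \<rho>) (box l u) = emeasure lborel (\<rho> -` box l u)"
    by (subst emeasure_distr) auto
  also have "\<dots> = emeasure lebesgue (inv \<rho> ` box l u)"
    using borel by (simp add: vimage)
  also have "\<dots> = ennreal (measure lebesgue (inv \<rho> ` box l u))"
    using measurable_orthogonal_image[OF inv box] by (rule emeasure_eq_measure2)
  also have "\<dots> = ennreal (measure lebesgue (box l u))"
    by (simp add: measure_orthogonal_image[OF inv box])
  also have "\<dots> = emeasure lborel (box l u)"
    using box by (simp add: emeasure_eq_measure2[symmetric])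
  also have "\<dots> = ennreal (\<Prod>b\<in>Basis. (u - l) \<bullet> b)"
    using lu by (rule emeasure_lborel_box)
  finally show "emeasure (distr lborel borel \<rho>) (box l u) = ennreal (\<Prod>b\<in>Basis. (u - l) \<bullet> b)" .
qed simp

locale path_loss_cluster = path_loss_link g T z + poisson_cluster c f
  for g :: "plane \<Rightarrow> real" and T :: real and z :: plane and c :: real and f :: "plane \<Rightarrow> real"
begin

abbreviation z0 :: plane where
  "z0 \<equiv> vector [norm z, 0]"

lemma norm_z0: "norm z0 = norm z"
  by (simp add: norm_vec_def L2_set_def sum_2)

text \<open>With t = T g / g z, 1 - 1 / (1 + t) = t / (1 + t) is the integrand both in
  \<open>cluster_beta\<close> and in the exponent of the Poisson success probability.\<close>

lemma one_minus_nexp_fading_loss: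
  "1 - nexp (fading_loss g T z a) = ennreal (max 0 (g (a - z)) / (g z / T + max 0 (g (a - z))))"
proof -
  have "1 - nexp (fading_loss g T z a) = ennreal (T * max 0 (g (a - z)) / g z / (1 + T * max 0 (g (a - z)) / g z))"
    unfolding fading_loss_def using T_pos gz_pos by (intro nexp_ln) auto
  also have "T * G / g z / (1 + T * G / g z) = G / (g z / T + G)" if "0 \<le> G" for G
  proof -
    have "0 < g z + T * G" using that T_pos gz_pos by (simp add: add_pos_nonneg)
    then show ?thesis using T_pos gz_pos by (simp add: divide_simps) (simp add: algebra_simps)
  qed
  finally show ?thesis by simp
qed

text \<open>\<open>cluster_beta\<close> puts the receiver on the first axis, whereas
  \<open>z\<close> is an arbitrary point of the same norm. The rotation \<rho> preserves
  \<open>g\<close>, \<open>f\<close> and Lebesgue measure, so it only moves the argument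
  \<open>y\<close>.\<close>

lemma cluster_beta_eq_mark:
  assumes \<rho>: "orthogonal_transformation \<rho>" "\<rho> z0 = z"
  shows "0 \<le> cluster_beta f g T (norm z) y"
    and "ennreal (cluster_beta f g T (norm z) y) = mark (fading_loss g T z) (\<rho> y)"
proof -
  have \<rho>_measurable: "\<rho> \<in> borel_measurable borel"
    using orthogonal_transformation_linear[OF \<rho>(1)]
    by (intro borel_measurable_continuous_onI linear_continuous_on linear_conv_bounded_linear[THEN iffD1])
  have norm_\<rho>: "norm (\<rho> x) = norm x" for x
    using \<rho>(1) by (simp add: orthogonal_transformation)
  have \<rho>_diff: "\<rho> (a - b) = \<rho> a - \<rho> b" for a b
    using orthogonal_transformation_linear[OF \<rho>(1)] by (rule linear_diff)
  have loss_shifted: "(\<lambda>x. 1 - nexp (fading_loss g T z (x - a))) \<in> borel_measurable borel" for a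
    by measurable
  have mark_integrand: "(\<lambda>x. ennreal (f x) * (1 - nexp (fading_loss g T z (x - a)))) \<in> borel_measurable borel" for a
    by measurable
  define v where "v x = max 0 (g (x - y - z0)) / (g z / T + max 0 (g (x - y - z0)))" for x
  have v: "0 \<le> v x" "v x \<le> 1" for x
    using T_pos gz_pos by (auto simp: v_def divide_simps add_pos_nonneg)
  have gain: "(\<lambda>x. g (x - y - z0)) \<in> borel_measurable borel"
    by (rule measurable_compose[OF _ g_measurable]) simp
  then have v_measurable: "v \<in> borel_measurable borel"
    unfolding v_def[abs_def]
    by (intro borel_measurable_divide borel_measurable_max borel_measurable_add borel_measurable_const)
  have vf_measurable: "(\<lambda>x. v x * f x) \<in> borel_measurable lborel"
    unfolding measurable_lborel2 by (intro borel_measurable_times v_measurable f_measurable)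
  have "cluster_beta f g T (norm z) y = (\<integral>x. v x * f x \<partial>lborel)"
    unfolding cluster_beta_def Let_def
  proof (rule integral_cong_AE)
    \<comment> \<open>At this one point \<open>g\<close> is evaluated at 0, where its value is
      arbitrary; everywhere else \<open>g\<close> is positive and \<open>max 0\<close> has no
      effect.\<close>
    have "AE x in lborel. x \<noteq> y + z0" by (rule AE_lborel_singleton)
    then show "AE x in lborel. g (x - y - z0) / (g z0 / T + g (x - y - z0)) * f x = v x * f x"
    proof eventually_elim
      case (elim x)
      then have "x - y - z0 \<noteq> 0" by (auto simp: algebra_simps)
      then have "0 < g (x - y - z0)" by (rule g_pos)
      then show ?case by (simp add: v_def g_radial[OF norm_z0])
    qed
    show "(\<lambda>x. g (x - y - z0) / (g z0 / T + g (x - y - z0)) * f x) \<in> borel_measurable lborel"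
      unfolding measurable_lborel2
      by (intro borel_measurable_times borel_measurable_divide borel_measurable_add borel_measurable_const gain f_measurable)
  qed (rule vf_measurable)
  moreover have int: "integrable lborel (\<lambda>x. v x * f x)"
  proof (rule Bochner_Integration.integrable_bound)
    show "integrable lborel f"
      using f_nonneg f_integral by (intro integrableI_nonneg) auto
    show "AE x in lborel. norm (v x * f x) \<le> norm (f x)"
      using v f_nonneg by (intro AE_I2) (auto simp: abs_mult intro!: mult_left_le_one_le)
  qed (rule vf_measurable)
  moreover have "0 \<le> (\<integral>x. v x * f x \<partial>lborel)"
    using v f_nonneg by (intro Bochner_Integration.integral_nonneg) auto
  ultimately show "0 \<le> cluster_beta f g T (norm z) y" by simp
  have "ennreal (cluster_beta f g T (norm z) y) = (\<integral>\<^sup>+x. ennreal (v x * f x) \<partial>lborel)"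
    unfolding \<open>cluster_beta f g T (norm z) y = _\<close>
    using v f_nonneg by (intro nn_integral_eq_integral[OF int, symmetric]) auto
  also have "\<dots> = (\<integral>\<^sup>+x. ennreal (f (\<rho> x)) * (1 - nexp (fading_loss g T z (\<rho> x - \<rho> y))) \<partial>lborel)"
  proof (rule nn_integral_cong)
    fix x
    have "\<rho> x - \<rho> y - z = \<rho> (x - y - z0)"
      by (simp only: \<rho>_diff \<rho>(2))
    then have "g (\<rho> x - \<rho> y - z) = g (x - y - z0)"
      by (intro g_radial) (simp only: norm_\<rho>)
    moreover have "f (\<rho> x) = f x"
      using density norm_\<rho>[of x] unfolding isotropic_density_def by blast
    ultimately show "ennreal (v x * f x) = ennreal (f (\<rho> x)) * (1 - nexp (fading_loss g T z (\<rho> x - \<rho> y)))"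
      unfolding one_minus_nexp_fading_loss using v[of x] f_nonneg[of x]
      by (simp add: v_def ennreal_mult[symmetric] mult.commute)
  qed
  also have "\<dots> = (\<integral>\<^sup>+x. ennreal (f x) * (1 - nexp (fading_loss g T z (x - \<rho> y))) \<partial>distr lborel borel \<rho>)"
    using \<rho>_measurable mark_integrand by (intro nn_integral_distr[symmetric]) auto
  also have "\<dots> = mark (fading_loss g T z) (\<rho> y)"
    unfolding lborel_distr_orthogonal[OF \<rho>(1)] mark_def using loss_shifted
    by (intro nn_integral_density[symmetric]) auto
  finally show "ennreal (cluster_beta f g T (norm z) y) = mark (fading_loss g T z) (\<rho> y)" .
qed

text \<open>A real supremum bounds its family only if the family is bounded above; here 1 is a
  bound, because \<open>mark\<close> averages values in [0, 1]. Surjectivity of \<rho> carries the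
  estimate to all arguments of \<open>mark\<close>.\<close>

lemma mark_le_SUP:
  defines "B \<equiv> SUP y. cluster_beta f g T (norm z) y"
  shows "0 \<le> B" and "mark (fading_loss g T z) y \<le> ennreal B"
proof -
  obtain \<rho> where \<rho>: "orthogonal_transformation \<rho>" "\<rho> z0 = z"
    using orthogonal_transformation_exists[OF norm_z0] by blast
  note beta = cluster_beta_eq_mark[OF \<rho>]
  have "cluster_beta f g T (norm z) y \<le> 1" for y
  proof -
    have "ennreal (cluster_beta f g T (norm z) y) \<le> ennreal 1"
      unfolding beta(2) using mark_le_1 by simp
    then show ?thesis by (subst (asm) ennreal_le_iff) auto
  qed
  then have bdd: "bdd_above (range (cluster_beta f g T (norm z)))"
    by (intro bdd_aboveI[where M = 1]) auto
  have upper: "cluster_beta f g T (norm z) y \<le> B" for y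
    unfolding B_def by (rule cSUP_upper[OF UNIV_I bdd])
  show "0 \<le> B"
    using beta(1) upper by (rule order_trans)
  have "y = \<rho> (inv \<rho> y)"
    using orthogonal_transformation_surj[OF \<rho>(1)] by (simp add: surj_f_inv_f)
  then show "mark (fading_loss g T z) y \<le> ennreal B"
    using beta(2)[of "inv \<rho> y"] upper[of "inv \<rho> y"] by (metis ennreal_leI)
qed

end

theorem lemma6:
  fixes M :: "'a measure" and \<Phi> :: "'a \<Rightarrow> plane set"
    and M' :: "'b measure" and \<Psi> :: "'b \<Rightarrow> plane set"
    and f g :: "plane \<Rightarrow> real" and lp c \<mu> T R :: real and z :: plane
  assumes "path_loss g" and "isotropic_density f"
    and "lp > 0" and "c > 0" and "\<mu> > 0" and "T > 0" and "R > 0" and "norm z = R"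
    and "neyman_scott_process M lp c f \<Phi>"
    and "poisson_process M' (lp * c / (1 + c * (SUP y. cluster_beta f g T R y))) \<Psi>"
  shows "success_prob \<mu> g T z M \<Phi> \<le> success_prob \<mu> g T z M' \<Psi>"
proof -
  have "z \<noteq> 0" using assms by auto
  interpret path_loss_cluster g T z c f
    by unfold_locales fact+
  define B where "B = (SUP y. cluster_beta f g T R y)"
  have B: "0 \<le> B" "mark (fading_loss g T z) y \<le> ennreal B" for y
    using mark_le_SUP assms(8) by (simp_all add: B_def)
  define l where "l = lp * c / (1 + c * B)"
  have l: "0 < l"
    using assms B(1) by (simp add: l_def add_pos_nonneg)
  obtain Y :: "'a \<Rightarrow> plane set" and X :: "nat \<Rightarrow> 'a \<Rightarrow> plane"
    and N :: "nat \<Rightarrow> 'a \<Rightarrow> nat" and D :: "nat \<times> nat \<Rightarrow> 'a \<Rightarrow> plane"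
    where "poisson_process M lp Y"
    and "\<And>i. X i \<in> borel_measurable M" "\<And>i. N i \<in> measurable M (count_space UNIV)" "\<And>k. D k \<in> borel_measurable M"
    and "AE \<omega> in M. bij_betw (\<lambda>i. X i \<omega>) UNIV (Y \<omega>)"
    and "distr M
        (Pi\<^sub>M UNIV (\<lambda>_. borel) \<Otimes>\<^sub>M (Pi\<^sub>M UNIV (\<lambda>_. count_space UNIV) \<Otimes>\<^sub>M Pi\<^sub>M UNIV (\<lambda>_. borel)))
        (\<lambda>\<omega>. (\<lambda>i. X i \<omega>, \<lambda>i. N i \<omega>, \<lambda>k. D k \<omega>)) =
      distr M (Pi\<^sub>M UNIV (\<lambda>_. borel)) (\<lambda>\<omega> i. X i \<omega>) \<Otimes>\<^sub>M
        (Pi\<^sub>M UNIV (\<lambda>_. measure_pmf (poisson_pmf c)) \<Otimes>\<^sub>M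
         Pi\<^sub>M UNIV (\<lambda>_. density lborel (\<lambda>x. ennreal (f x))))"
    and "AE \<omega> in M. \<Phi> \<omega> = (\<Union>i. {X i \<omega> + D (i, j) \<omega> | j. j < N i \<omega>})"
    and proc: "point_process M \<Phi>"
    using assms(9) unfolding neyman_scott_process_def by blast
  interpret neyman_scott c f M lp \<Phi> Y X N D
    by unfold_locales fact+
  \<comment> \<open>The closed form of the success probability of a Poisson process of intensity
    \<open>l\<close>. It separates the two processes: each is compared with \<open>L\<close> on its
    own probability space.\<close>
  define L where "L = nexp (ennreal l * (\<integral>\<^sup>+a. 1 - nexp (fading_loss g T z a) \<partial>lborel))"
  have "success_prob \<mu> g T z M \<Phi> \<le> ennreal c * ennreal lp * L / (ennreal c * ennreal lp)"
    unfolding success_prob_eq[OF \<open>\<mu> > 0\<close> T_pos gz_pos proc g_measurable] intensity_eq L_def l_def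
    by (intro divide_right_mono_ennreal cluster_sum_le B fading_loss_measurable)
  also have "\<dots> = L"
    using assms by (simp add: mult.commute[of _ L] mult_divide_eq_ennreal ennreal_mult[symmetric])
  also have "L \<le> success_prob \<mu> g T z M' \<Psi>"
    unfolding L_def using assms l by (intro poisson_success_lower) (simp_all add: l_def B_def)
  finally show ?thesis .
qed

end
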